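(* Let $n\ge0$, let $G$ be a group, $M$ a proper non-compact $CAT(0)$ space, $A$ a $\mathbb{Z}G$-module of type $FP_n$, and $\rho\in\mathrm{Hom}(G,\mathrm{Isom}(M))$ an isometric action of $G$ on $M$. Write ${}_{\rho}M$ for $M$ endowed with the action $\rho$. (i) If $\Sigma^{n}({}_{\rho}M;A)=\partial M$, then there is a neighborhood $N$ of $\rho$ in $\mathrm{Hom}(G,\mathrm{Isom}(M))$ (with the compact-open topology) such that $\Sigma^{n}({}_{\rho'}M;A)=\partial M$ for all $\rho'\in N$. (ii) ${}^{\circ}\Sigma^{n}({}_{\rho}M;A)$ is open in the Tits metric topology on $\partial M$.
   Context: Setting. $G$ is discrete and $\mathrm{Isom}(M)$ carries the compact-open topology. $\partial M$ is the set of asymptoty classes of geodesic rays in $(M,d)$, with the cone topology unless the Tits metric is mentioned; an isometric action of $G$ on $M$ induces an action on $\partial M$. For a geodesic ray $\gamma$ with endpoint $\gamma(\infty)=e\in\partial M$, the Busemann function is $\beta_\gamma(x)=\lim_{t\to\infty}(t-d(x,\gamma(t)))$ (so it tends to $+\infty$ towards $e$). Resolutions and control. $fS$ is the set of finite subsets of a set $S$. A based free resolution $\mathbf F\twoheadrightarrow A$ is a resolution by free (left) $\mathbb{Z}G$-modules $F_k$, $k\ge0$, with chosen $\mathbb{Z}G$-bases $X_k$ and augmentation $\epsilon:F_0\to A$; $Y_k=GX_k$ is the induced $\mathbb{Z}$-basis, $X=\bigcup X_k$, $Y=\bigcup Y_k$. It is always assumed admissible: $\partial x\ne0$ for $x\in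 X_k$, $k\ge1$, and $\epsilon(x)\neq0$ for $x\in X_0$. $\mathbf F^{(n)}$ is the $n$-skeleton ($F_k$ replaced by $0$ for $k>n$). $A$ has type $FP_n$ if such a resolution exists with $\mathbf F^{(n)}$ finitely generated. For $c\in\mathbf F$, $\mathrm{supp}(c)\subseteq Y$ is the set of $y$ occurring in the expansion of $c$. A control map (for a given action $\rho$ on $M$) is a $G$-map $h:\mathbf F\to fM$ with $h(c)=\bigcup_{y\in\mathrm{supp}(c)}h(y)$ (so $h(0)=\emptyset$) and $h(x)\neq\emptyset$ for $x\in X$. Put $v_\gamma(c)=\min\beta_\gamma(h(c))$ for $c\ne0$, $v_\gamma(0)=\infty$, and $v_\gamma(a)=\infty$ for $a\in A$. Finitary maps and pushes. An additive homomorphism $\varphi:B\to C$ of $G$-modules is $G$-finitary if there is a $G$-map $\Phi:B\to fC$ with $\varphi(b)\in\Phi(b)$ for all $b\in B$. For $\varphi:\mathbf F^{(n)}\to\mathbf F^{(n)}$ additive and $\gamma(\infty)=e$, $\mathrm{gsh}_e(\varphi)=\inf\{v_\gamma(\varphi(c))-v_\gamma(c)\mid 0\ne c\in \mathbf F^{(n)}\}$ (independent of the ray $\gamma$ with endpoint $e$); $\varphi$ pushes $\mathbf F^{(n)}$ towards $e$ if $\mathrm{gsh}_e(\varphi)>0$. A chain map $\varphi$ induces $\mathrm{id}_A$ if $\epsilon\varphi=\epsilon$ on $F_0$. Invariants of $M={}_\rho M$. Choose $\mathbf F\twoheadrightarrow A$ with $\mathbf F^{(n)}$ finitely generated and a control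 map $h$ (the invariants do not depend on these choices). ${}^{\circ}\Sigma^n(M;A)$ is the set of $e\in\partial M$ for which there is a $G$-finitary chain map $\mathbf F^{(n)}\to\mathbf F^{(n)}$ inducing $\mathrm{id}_A$ and pushing $\mathbf F^{(n)}$ towards $e$. $\mathbf F\twoheadrightarrow A$ is $CA^{m-1}$ over $e=\gamma(\infty)$ if for every real $s$ there is $\lambda(s)\ge0$, with $s-\lambda(s)\to+\infty$ as $s\to+\infty$, such that for $-1\le i\le m-1$ every $i$-cycle $z$ of the augmented complex $\mathbf F\to A$ with $v_\gamma(z)\ge s$ is the boundary of an $(i+1)$-chain $c$ with $v_\gamma(c)\ge s-\lambda(s)$ (degree $-1$ being $A$, with boundary $\epsilon:F_0\to A$). $\Sigma^n(M;A)$ is the set of $e\in\partial M$ such that $\mathbf F\twoheadrightarrow A$ is $CA^{k}$ over $e$ for all $k$ with $-1\le k<n$. *)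

theory Defs
  imports "HOL-Analysis.Analysis" "HOL-Algebra.Group" "HOL-Library.Poly_Mapping"
begin

section \<open>CAT(0) spaces\<close>

definition geodesic_segment :: "'m::metric_space \<Rightarrow> 'm \<Rightarrow> 'm set \<Rightarrow> bool" where
  "geodesic_segment p q S \<longleftrightarrow>
     (\<exists>c :: real \<Rightarrow> 'm. c 0 = p \<and> c (dist p q) = q \<and>
        (\<forall>s\<in>{0..dist p q}. \<forall>t\<in>{0..dist p q}. dist (c s) (c t) = \<bar>s - t\<bar>) \<and>
        S = c ` {0..dist p q})"

text \<open>Geodesic triangles are compared with Euclidean ones. Two points on different sides of a
  triangle lie on two sides issuing from a common vertex, which is called \<open>p\<close> below;
  for two points on the same side the comparison inequality is trivially an equality.\<close>

definition CAT0_space :: "'m::metric_space itself \<Rightarrow> bool" where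
  "CAT0_space _ \<longleftrightarrow>
     (\<forall>p q :: 'm. \<exists>S. geodesic_segment p q S) \<and>
     (\<forall>(p :: 'm) q r S T (p' :: real^2) q' r' x y x' y'.
        geodesic_segment p q S \<and> geodesic_segment p r T \<and>
        dist p' q' = dist p q \<and> dist p' r' = dist p r \<and> dist q' r' = dist q r \<and>
        x \<in> S \<and> y \<in> T \<and>
        x' \<in> closed_segment p' q' \<and> dist p' x' = dist p x \<and>
        y' \<in> closed_segment p' r' \<and> dist p' y' = dist p y
        \<longrightarrow> dist x y \<le> dist x' y')"

section \<open>The boundary at infinity\<close>

text \<open>A ray is a function on the reals of which only the values on \<open>{0..}\<close> matter.\<close>

definition geodesic_ray :: "(real \<Rightarrow> 'm::metric_space) \<Rightarrow> bool" where
  "geodesic_ray \<gamma> \<longleftrightarrow> (\<forall>s\<ge>0. \<forall>t\<ge>0. dist (\<gamma> s) (\<gamma> t) = \<bar>s - t\<bar>)"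

definition asymptotic_rel :: "((real \<Rightarrow> 'm::metric_space) \<times> (real \<Rightarrow> 'm)) set" where
  "asymptotic_rel = {(\<gamma>, \<gamma>'). geodesic_ray \<gamma> \<and> geodesic_ray \<gamma>' \<and>
     (\<exists>C. \<forall>t\<ge>0. dist (\<gamma> t) (\<gamma>' t) \<le> C)}"

definition ideal_boundary :: "(real \<Rightarrow> 'm::metric_space) set set" where
  "ideal_boundary = {\<gamma>. geodesic_ray \<gamma>} // asymptotic_rel"

definition busemann :: "(real \<Rightarrow> 'm::metric_space) \<Rightarrow> 'm \<Rightarrow> real" where
  "busemann \<gamma> x = Lim at_top (\<lambda>t. t - dist x (\<gamma> t))"

subsection \<open>The Tits metric\<close>

text \<open>The angle at the vertex corresponding to \<open>p\<close> in a Euclidean comparison triangle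
  (law of cosines), for \<open>x\<close> and \<open>y\<close> distinct from \<open>p\<close>.\<close>

definition comparison_angle :: "'m::metric_space \<Rightarrow> 'm \<Rightarrow> 'm \<Rightarrow> real" where
  "comparison_angle p x y =
     arccos (((dist p x)\<^sup>2 + (dist p y)\<^sup>2 - (dist x y)\<^sup>2) / (2 * dist p x * dist p y))"

definition alexandrov_angle :: "(real \<Rightarrow> 'm::metric_space) \<Rightarrow> (real \<Rightarrow> 'm) \<Rightarrow> ereal" where
  "alexandrov_angle c c' =
     Limsup (at_right 0 \<times>\<^sub>F at_right 0)
       (\<lambda>(t, t'). ereal (comparison_angle (c 0) (c t) (c' t')))"

text \<open>The supremum over all points \<open>x\<close> of the angle at \<open>x\<close> between the rays from \<open>x\<close> that
  represent the two boundary points.\<close>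

definition angular_metric ::
  "(real \<Rightarrow> 'm::metric_space) set \<Rightarrow> (real \<Rightarrow> 'm) set \<Rightarrow> ereal" where
  "angular_metric \<xi> \<eta> =
     Sup {alexandrov_angle \<gamma> \<gamma>' | \<gamma> \<gamma>'. \<gamma> \<in> \<xi> \<and> \<gamma>' \<in> \<eta> \<and> \<gamma> 0 = \<gamma>' 0}"

text \<open>The Tits metric is the length metric associated to the angular metric; it may be infinite.\<close>

definition angular_path :: "(real \<Rightarrow> (real \<Rightarrow> 'm::metric_space) set) \<Rightarrow> bool" where
  "angular_path c \<longleftrightarrow> c ` {0..1} \<subseteq> ideal_boundary \<and>
     (\<forall>t\<in>{0..1}. \<forall>\<epsilon>>0. \<exists>\<delta>>0. \<forall>s\<in>{0..1}. \<bar>s - t\<bar> < \<delta> \<longrightarrow> angular_metric (c s) (c t) < ereal \<epsilon>)"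

definition angular_length :: "(real \<Rightarrow> (real \<Rightarrow> 'm::metric_space) set) \<Rightarrow> ereal" where
  "angular_length c =
     (SUP ts \<in> {ts. sorted ts \<and> set ts \<subseteq> {0..1}}.
        \<Sum>i < length ts - 1. angular_metric (c (ts ! i)) (c (ts ! Suc i)))"

definition tits_metric ::
  "(real \<Rightarrow> 'm::metric_space) set \<Rightarrow> (real \<Rightarrow> 'm) set \<Rightarrow> ereal" where
  "tits_metric \<xi> \<eta> = Inf {angular_length c | c. angular_path c \<and> c 0 = \<xi> \<and> c 1 = \<eta>}"

definition tits_topology :: "(real \<Rightarrow> 'm::metric_space) set topology" where
  "tits_topology = topology (\<lambda>U. U \<subseteq> ideal_boundary \<and>
     (\<forall>\<xi>\<in>U. \<exists>\<epsilon>>0. \<forall>\<eta>\<in>ideal_boundary. tits_metric \<xi> \<eta> < ereal \<epsilon> \<longrightarrow> \<eta> \<in> U))"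

lemma openin_tits_topology:
  "openin tits_topology U \<longleftrightarrow> U \<subseteq> ideal_boundary \<and>
     (\<forall>\<xi>\<in>U. \<exists>\<epsilon>>0. \<forall>\<eta>\<in>ideal_boundary. tits_metric \<xi> \<eta> < ereal \<epsilon> \<longrightarrow> \<eta> \<in> U)"
proof -
  have "istopology (\<lambda>U :: (real \<Rightarrow> 'a) set set. U \<subseteq> ideal_boundary \<and>
     (\<forall>\<xi>\<in>U. \<exists>\<epsilon>>0. \<forall>\<eta>\<in>ideal_boundary. tits_metric \<xi> \<eta> < ereal \<epsilon> \<longrightarrow> \<eta> \<in> U))"
    (is "istopology ?P")
    unfolding istopology_def
  proof (intro conjI allI impI)
    fix S T assume S: "?P S" and T: "?P T"
    show "S \<inter> T \<subseteq> ideal_boundary" using S by blast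
    show "\<forall>\<xi>\<in>S \<inter> T. \<exists>\<epsilon>>0. \<forall>\<eta>\<in>ideal_boundary. tits_metric \<xi> \<eta> < ereal \<epsilon> \<longrightarrow> \<eta> \<in> S \<inter> T"
    proof
      fix \<xi> assume "\<xi> \<in> S \<inter> T"
      then obtain a b where "a > 0" "b > 0"
        and a: "\<forall>\<eta>\<in>ideal_boundary. tits_metric \<xi> \<eta> < ereal a \<longrightarrow> \<eta> \<in> S"
        and b: "\<forall>\<eta>\<in>ideal_boundary. tits_metric \<xi> \<eta> < ereal b \<longrightarrow> \<eta> \<in> T"
        using S T by (metis IntE)
      moreover have "\<eta> \<in> S \<inter> T"
        if "\<eta> \<in> ideal_boundary" and "tits_metric \<xi> \<eta> < ereal (min a b)" for \<eta>
        proof -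
        have "tits_metric \<xi> \<eta> < ereal a" "tits_metric \<xi> \<eta> < ereal b"
          using that(2) by (auto elim!: less_le_trans)
        then show ?thesis using that(1) a b by blast
      qed
      ultimately show "\<exists>\<epsilon>>0. \<forall>\<eta>\<in>ideal_boundary. tits_metric \<xi> \<eta> < ereal \<epsilon> \<longrightarrow> \<eta> \<in> S \<inter> T"
        by (intro exI[of _ "min a b"]) auto
    qed
  next
    fix K assume K: "\<forall>U\<in>K. ?P U"
    then show "\<Union>K \<subseteq> ideal_boundary" by blast
    show "\<forall>\<xi>\<in>\<Union>K. \<exists>\<epsilon>>0. \<forall>\<eta>\<in>ideal_boundary. tits_metric \<xi> \<eta> < ereal \<epsilon> \<longrightarrow> \<eta> \<in> \<Union>K"
      using K by (meson Union_iff)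
  qed
  then show ?thesis by (simp add: tits_topology_def topology_inverse')
qed

section \<open>The space of isometric actions\<close>

definition Isom_group :: "('m::metric_space \<Rightarrow> 'm) monoid" where
  "Isom_group = \<lparr>carrier = {f. surj f \<and> (\<forall>x y. dist (f x) (f y) = dist x y)},
                 mult = (\<circ>), one = id\<rparr>"

definition compact_open_topology :: "'a topology \<Rightarrow> 'b topology \<Rightarrow> ('a \<Rightarrow> 'b) topology" where
  "compact_open_topology X Y = topology_generated_by
     {{f. continuous_map X Y f \<and> f ` K \<subseteq> U} | K U. compactin X K \<and> openin Y U}"

definition Isom_topology :: "('m::metric_space \<Rightarrow> 'm) topology" where
  "Isom_topology =
     subtopology (compact_open_topology euclidean euclidean) (carrier Isom_group)"

text \<open>Two elements of \<^const>\<open>hom\<close> that agree on \<^term>\<open>carrier G\<close> are the same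
  homomorphism; they have the same neighbourhoods here.\<close>

definition Hom_topology ::
  "('g, 'b) monoid_scheme \<Rightarrow> ('g \<Rightarrow> 'm::metric_space \<Rightarrow> 'm) topology" where
  "Hom_topology G =
     subtopology (compact_open_topology (discrete_topology (carrier G)) Isom_topology)
       (hom G Isom_group)"

section \<open>Based free resolutions\<close>

text \<open>A left module over the integral group ring of \<open>G\<close> is an abelian group with an additive
  left action of \<open>G\<close>.\<close>

definition ZG_module :: "('g, 'b) monoid_scheme \<Rightarrow> ('g \<Rightarrow> 'a::ab_group_add \<Rightarrow> 'a) \<Rightarrow> bool" where
  "ZG_module G act \<longleftrightarrow> (\<forall>a. act \<one>\<^bsub>G\<^esub> a = a) \<and>
     (\<forall>g\<in>carrier G. \<forall>h\<in>carrier G. \<forall>a. act (g \<otimes>\<^bsub>G\<^esub> h) a = act g (act h a)) \<and>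
     (\<forall>g\<in>carrier G. \<forall>a b. act g (a + b) = act g a + act g b)"

text \<open>The free module with basis \<open>S\<close> is the free abelian group on \<open>carrier G \<times> S\<close>, the pair
  \<open>(g, x)\<close> standing for \<open>gx\<close>; so \<^const>\<open>Poly_Mapping.keys\<close> is the support of a chain.\<close>

type_synonym ('g, 'x) chain = "('g \<times> 'x) \<Rightarrow>\<^sub>0 int"

definition free_module :: "('g, 'b) monoid_scheme \<Rightarrow> 'x set \<Rightarrow> ('g, 'x) chain set" where
  "free_module G S = {c. Poly_Mapping.keys c \<subseteq> carrier G \<times> S}"

definition translate ::
  "('g, 'b) monoid_scheme \<Rightarrow> 'g \<Rightarrow> ('g, 'x) chain \<Rightarrow> ('g, 'x) chain" where
  "translate G g = frag_extend (\<lambda>(h, x). frag_of (g \<otimes>\<^bsub>G\<^esub> h, x))"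

definition additive_on :: "'c::ab_group_add set \<Rightarrow> ('c \<Rightarrow> 'd::ab_group_add) \<Rightarrow> bool" where
  "additive_on B f \<longleftrightarrow> (\<forall>a\<in>B. \<forall>b\<in>B. f (a + b) = f a + f b)"

definition equivariant_on ::
  "('g, 'b) monoid_scheme \<Rightarrow> ('g \<Rightarrow> 'c \<Rightarrow> 'c) \<Rightarrow> ('g \<Rightarrow> 'd \<Rightarrow> 'd) \<Rightarrow> 'c set \<Rightarrow> ('c \<Rightarrow> 'd) \<Rightarrow> bool" where
  "equivariant_on G act act' B f \<longleftrightarrow> (\<forall>g\<in>carrier G. \<forall>b\<in>B. f (act g b) = act' g (f b))"

definition finitely_generated ::
  "('g, 'b) monoid_scheme \<Rightarrow> ('g \<Rightarrow> 'c::ab_group_add \<Rightarrow> 'c) \<Rightarrow> 'c set \<Rightarrow> bool" where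
  "finitely_generated G act B \<longleftrightarrow>
     (\<exists>S. finite S \<and> S \<subseteq> B \<and>
        (\<forall>H. S \<subseteq> H \<and> 0 \<in> H \<and> (\<forall>a\<in>H. \<forall>b\<in>H. a - b \<in> H) \<and>
             (\<forall>g\<in>carrier G. \<forall>a\<in>H. act g a \<in> H) \<longrightarrow> B \<subseteq> H))"

text \<open>\<open>gens F k\<close> is the chosen basis in degree \<open>k\<close>. The maps are only relevant on the
  chains of the resolution, \<open>aug\<close> only on those of degree 0.\<close>

record ('g, 'x, 'a) resolution =
  gens :: "nat \<Rightarrow> 'x set"
  bd :: "('g, 'x) chain \<Rightarrow> ('g, 'x) chain"
  aug :: "('g, 'x) chain \<Rightarrow> 'a"

definition chains_deg ::
  "('g, 'b) monoid_scheme \<Rightarrow> ('g, 'x, 'a) resolution \<Rightarrow> nat \<Rightarrow> ('g, 'x) chain set" where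
  "chains_deg G F k = free_module G (gens F k)"

definition all_chains ::
  "('g, 'b) monoid_scheme \<Rightarrow> ('g, 'x, 'a) resolution \<Rightarrow> ('g, 'x) chain set" where
  "all_chains G F = free_module G (\<Union>k. gens F k)"

definition skeleton ::
  "('g, 'b) monoid_scheme \<Rightarrow> ('g, 'x, 'a) resolution \<Rightarrow> nat \<Rightarrow> ('g, 'x) chain set" where
  "skeleton G F n = free_module G (\<Union>k\<le>n. gens F k)"

definition cycles ::
  "('g, 'b) monoid_scheme \<Rightarrow> ('g, 'x, 'a::zero) resolution \<Rightarrow> nat \<Rightarrow> ('g, 'x) chain set" where
  "cycles G F i = {z \<in> chains_deg G F i. if i = 0 then aug F z = 0 else bd F z = 0}"

text \<open>Admissibility is the pair of non-vanishing conditions at the end.\<close>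

definition based_free_resolution ::
  "('g, 'b) monoid_scheme \<Rightarrow> ('g \<Rightarrow> 'a::ab_group_add \<Rightarrow> 'a) \<Rightarrow> ('g, 'x, 'a) resolution \<Rightarrow> bool" where
  "based_free_resolution G act F \<longleftrightarrow>
     disjoint_family (gens F) \<and>
     additive_on (all_chains G F) (bd F) \<and>
     equivariant_on G (translate G) (translate G) (all_chains G F) (bd F) \<and>
     (\<forall>c\<in>chains_deg G F 0. bd F c = 0) \<and>
     additive_on (chains_deg G F 0) (aug F) \<and>
     equivariant_on G (translate G) act (chains_deg G F 0) (aug F) \<and>
     aug F ` chains_deg G F 0 = UNIV \<and>
     (\<forall>k. bd F ` chains_deg G F (Suc k) = cycles G F k) \<and>
     (\<forall>k\<ge>1. \<forall>x\<in>gens F k. bd F (frag_of (\<one>\<^bsub>G\<^esub>, x)) \<noteq> 0) \<and>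
     (\<forall>x\<in>gens F 0. aug F (frag_of (\<one>\<^bsub>G\<^esub>, x)) \<noteq> 0)"

section \<open>Control maps and the invariants\<close>

definition control_map ::
  "('g, 'b) monoid_scheme \<Rightarrow> ('g, 'x, 'a) resolution \<Rightarrow> ('g \<Rightarrow> 'm \<Rightarrow> 'm)
     \<Rightarrow> (('g, 'x) chain \<Rightarrow> 'm set) \<Rightarrow> bool" where
  "control_map G F \<rho> h \<longleftrightarrow>
     (\<forall>c\<in>all_chains G F. finite (h c) \<and> h c = (\<Union>y\<in>Poly_Mapping.keys c. h (frag_of y))) \<and>
     equivariant_on G (translate G) (\<lambda>g S. \<rho> g ` S) (all_chains G F) h \<and>
     (\<forall>k. \<forall>x\<in>gens F k. h (frag_of (\<one>\<^bsub>G\<^esub>, x)) \<noteq> {})"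

definition valuation ::
  "(real \<Rightarrow> 'm::metric_space) \<Rightarrow> (('g, 'x) chain \<Rightarrow> 'm set) \<Rightarrow> ('g, 'x) chain \<Rightarrow> ereal" where
  "valuation \<gamma> h c = (if c = 0 then \<infinity> else ereal (Min (busemann \<gamma> ` h c)))"

text \<open>\<open>CA G F h \<gamma> m\<close> is the property $CA^{m-1}$. Its first clause is the case of degree \<open>-1\<close>,
  where every element of the module is a cycle of value \<open>\<infinity>\<close>.\<close>

definition CA ::
  "('g, 'b) monoid_scheme \<Rightarrow> ('g, 'x, 'a::ab_group_add) resolution
     \<Rightarrow> (('g, 'x) chain \<Rightarrow> 'm::metric_space set) \<Rightarrow> (real \<Rightarrow> 'm) \<Rightarrow> nat \<Rightarrow> bool" where
  "CA G F h \<gamma> m \<longleftrightarrow>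
     (\<exists>\<Lambda> :: real \<Rightarrow> real. (\<forall>s. \<Lambda> s \<ge> 0) \<and> filterlim (\<lambda>s. s - \<Lambda> s) at_top at_top \<and>
        (\<forall>s. (\<forall>a. \<exists>c\<in>chains_deg G F 0. aug F c = a \<and> valuation \<gamma> h c \<ge> ereal (s - \<Lambda> s)) \<and>
             (\<forall>i<m. \<forall>z\<in>cycles G F i. valuation \<gamma> h z \<ge> ereal s \<longrightarrow>
                (\<exists>c\<in>chains_deg G F (Suc i). bd F c = z \<and>
                   valuation \<gamma> h c \<ge> ereal (s - \<Lambda> s)))))"

text \<open>\<open>CA\<close> and \<open>gsh\<close> do not depend on the choice of the ray within its asymptoty class, so
  the quantifier over \<open>\<gamma> \<in> e\<close> in the next definitions could equally be existential.
  The range \<open>m \<le> n\<close> is $-1 \le k < n$ for $k = m - 1$.\<close>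

definition Sigma_inv ::
  "nat \<Rightarrow> ('g, 'b) monoid_scheme \<Rightarrow> ('g, 'x, 'a::ab_group_add) resolution
     \<Rightarrow> (('g, 'x) chain \<Rightarrow> 'm::metric_space set) \<Rightarrow> (real \<Rightarrow> 'm) set set" where
  "Sigma_inv n G F h = {e \<in> ideal_boundary. \<forall>\<gamma>\<in>e. \<forall>m\<le>n. CA G F h \<gamma> m}"

definition finitary ::
  "('g, 'b) monoid_scheme \<Rightarrow> ('g \<Rightarrow> 'c \<Rightarrow> 'c) \<Rightarrow> 'c set \<Rightarrow> ('g \<Rightarrow> 'd \<Rightarrow> 'd) \<Rightarrow> 'd set
     \<Rightarrow> ('c \<Rightarrow> 'd) \<Rightarrow> bool" where
  "finitary G actB B actC C f \<longleftrightarrow>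
     (\<exists>\<Phi>. equivariant_on G actB (\<lambda>g. image (actC g)) B \<Phi> \<and>
        (\<forall>b\<in>B. finite (\<Phi> b) \<and> \<Phi> b \<subseteq> C \<and> f b \<in> \<Phi> b))"

definition skeleton_chain_map ::
  "('g, 'b) monoid_scheme \<Rightarrow> ('g, 'x, 'a::ab_group_add) resolution \<Rightarrow> nat
     \<Rightarrow> (('g, 'x) chain \<Rightarrow> ('g, 'x) chain) \<Rightarrow> bool" where
  "skeleton_chain_map G F n \<phi> \<longleftrightarrow>
     additive_on (skeleton G F n) \<phi> \<and>
     (\<forall>k\<le>n. \<phi> ` chains_deg G F k \<subseteq> chains_deg G F k) \<and>
     (\<forall>c\<in>skeleton G F n. bd F (\<phi> c) = \<phi> (bd F c))"

definition gsh ::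
  "('g, 'b) monoid_scheme \<Rightarrow> ('g, 'x, 'a) resolution \<Rightarrow> nat
     \<Rightarrow> (('g, 'x) chain \<Rightarrow> 'm::metric_space set) \<Rightarrow> (real \<Rightarrow> 'm)
     \<Rightarrow> (('g, 'x) chain \<Rightarrow> ('g, 'x) chain) \<Rightarrow> ereal" where
  "gsh G F n h \<gamma> \<phi> = (INF c \<in> skeleton G F n - {0}. valuation \<gamma> h (\<phi> c) - valuation \<gamma> h c)"

definition oSigma_inv ::
  "nat \<Rightarrow> ('g, 'b) monoid_scheme \<Rightarrow> ('g, 'x, 'a::ab_group_add) resolution
     \<Rightarrow> (('g, 'x) chain \<Rightarrow> 'm::metric_space set) \<Rightarrow> (real \<Rightarrow> 'm) set set" where
  "oSigma_inv n G F h = {e \<in> ideal_boundary. \<exists>\<phi>.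
     skeleton_chain_map G F n \<phi> \<and>
     (\<forall>c\<in>chains_deg G F 0. aug F (\<phi> c) = aug F c) \<and>
     finitary G (translate G) (skeleton G F n) (translate G) (skeleton G F n) \<phi> \<and>
     (\<forall>\<gamma>\<in>e. gsh G F n h \<gamma> \<phi> > 0)}"

end

theory Submission
  imports Defs
begin

text \<open>
  For two rays issuing from a common point at an angle less than \<open>\<epsilon>\<close>, the Busemann functions
  differ near that point by at most a multiple of \<open>sqrt \<epsilon>\<close> times the distance. Integrating along
  geodesics, a small change of the end in the Tits metric changes the differences
  \<open>\<beta> p - \<beta> q\<close> by a small multiple of \<open>dist p q\<close>. A finitary map moves cells by a bounded amount,
  so a map that pushes towards an end pushes towards all ends nearby: this gives (ii).

  For (i), controlled acyclicity over every end is turned into chain maps pushing by 1 towards a given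
  end, with values on a basis element taken from a finite set that depends neither on the end nor
  on the action in a neighbourhood of \<open>\<rho>\<close>. Such a set exists because the space of rays from
  a base point is compact and because finitely many heights depend continuously on the ray and the action.
  The chain maps are built degree by degree: the boundary of a cell is first pushed so often that
  the lag in the controlled acyclicity is made up for, and then filled. Conversely, a pushing chain
  map \<open>\<phi>\<close> and a homotopy from the identity to \<open>\<phi>\<close> with bounded displacement give controlled
  acyclicity: if \<open>z = \<partial>c\<close> then \<open>z\<close> also bounds \<open>\<phi>\<^sup>N c\<close> minus the trace of \<open>z\<close> under the
  homotopy, which is high for large \<open>N\<close>.
\<close>

section \<open>Comparison inequalities\<close>

text \<open>A map pushing towards an end is in general not G-equivariant, because G moves the end.
  Its value at the cell gx is the g-translate of a value chosen at x for the end moved by g^-1. One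
  end thus forces choices for its whole orbit, and the displacement stays bounded only if finitely
  many values at x serve all these ends. Conjugating a map by g and moving the height function along
  reduces every question at gx to one at x. For this reason heights are treated as abstract weights
  on cells, in families closed under the group; ray and action then vary together and matter only
  through finitely many weights, up to an additive constant.

  The other obstacle is that the extension to the next degree is an extension of a power of the
  lower map. The finite value sets have to survive taking powers, and the fillings have to be
  selected before the map is known.\<close>

lemma norm_vector_2: "norm (vector [a, b] :: real^2) = sqrt (a\<^sup>2 + b\<^sup>2)"
  by (simp add: norm_vec_def L2_set_def sum_2 vector_2)

text \<open>The first vertex is put at the origin and the second at \<open>(a, 0)\<close>; the law
  of cosines then dictates the first coordinate of the third.\<close>

lemma comparison_triangle:
  fixes a b c :: real
  assumes "a \<ge> 0" "b \<ge> 0" "c \<ge> 0" "a \<le> b + c" "b \<le> a + c" "c \<le> a + b"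
  obtains p q r :: "real^2" where "dist p q = a" "dist p r = b" "dist q r = c"
proof (cases "a = 0")
  case True
  then have "b = c" using assms by auto
  then show ?thesis
    using True that[of 0 0 "vector [b, 0]"] assms by (simp add: dist_norm norm_vector_2)
next
  case False
  \<comment> \<open>Foot of the altitude. The triangle inequalities amount to \<bar>u\<bar> \<le> b,
    so that the altitude \<open>v\<close> below is real.\<close>
  define u where "u = (a\<^sup>2 + b\<^sup>2 - c\<^sup>2) / (2 * a)"
  have a: "a > 0" using False assms by simp
  have "2 * a * u = a\<^sup>2 + b\<^sup>2 - c\<^sup>2" using a by (simp add: u_def)
  moreover have "(b - a)\<^sup>2 \<le> c\<^sup>2" using assms by (intro power2_le_iff_abs_le[THEN iffD2]) auto
  moreover have "c\<^sup>2 \<le> (a + b)\<^sup>2" using assms by (intro power_mono) auto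
  ultimately have "2 * a * u \<le> 2 * a * b" "2 * a * (- b) \<le> 2 * a * u"
    by (auto simp: power2_eq_square algebra_simps)
  then have "a * u \<le> a * b" "a * (- b) \<le> a * u" by auto
  then have "\<bar>u\<bar> \<le> b" using a unfolding mult_le_cancel_left_pos[OF a] by linarith
  then have "u\<^sup>2 \<le> b\<^sup>2" using assms(2) power2_le_iff_abs_le by blast
  define v where "v = sqrt (b\<^sup>2 - u\<^sup>2)"
  have v: "v\<^sup>2 = b\<^sup>2 - u\<^sup>2" using \<open>u\<^sup>2 \<le> b\<^sup>2\<close> by (simp add: v_def)
  have 1: "vector [a, 0] - vector [u, v] = (vector [a - u, - v] :: real^2)"
    by (simp add: vec_eq_iff forall_2 vector_2)
  have "(a - u)\<^sup>2 + v\<^sup>2 = c\<^sup>2"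
    using \<open>2 * a * u = _\<close> by (simp add: v power2_diff)
  then show ?thesis
    using that[of 0 "vector [a, 0]" "vector [u, v]"] assms
    by (simp add: dist_norm norm_vector_2 1 v)
qed

lemma euclidean_stewart:
  fixes p q r :: "'e::real_inner"
  shows "(dist (p + l *\<^sub>R (q - p)) r)\<^sup>2
    = (1 - l) * (dist p r)\<^sup>2 + l * (dist q r)\<^sup>2 - l * (1 - l) * (dist p q)\<^sup>2"
  by (simp add: dist_norm power2_norm_eq_inner inner_commute algebra_simps)

lemma geodesic_segment_dist:
  assumes "geodesic_segment p q S" "x \<in> S"
  shows "dist p x + dist x q = dist p q"
proof -
  obtain c :: "real \<Rightarrow> 'a" where c: "c 0 = p" "c (dist p q) = q" "S = c ` {0..dist p q}"
    "\<forall>s\<in>{0..dist p q}. \<forall>t\<in>{0..dist p q}. dist (c s) (c t) = \<bar>s - t\<bar>"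
    using assms(1) unfolding geodesic_segment_def by blast
  obtain t where t: "t \<in> {0..dist p q}" "x = c t" using c assms(2) by blast
  have "dist (c 0) (c t) = t" "dist (c t) (c (dist p q)) = dist p q - t"
    using c(4) t by auto
  then show ?thesis using c t by simp
qed

lemma geodesic_segment_ends:
  assumes "geodesic_segment p q S"
  shows "p \<in> S" "q \<in> S"
proof -
  obtain c :: "real \<Rightarrow> 'a" where "c 0 = p" "c (dist p q) = q" "S = c ` {0..dist p q}"
    using assms unfolding geodesic_segment_def by blast
  then show "p \<in> S" "q \<in> S" by (auto intro: image_eqI[of _ c 0] image_eqI[of _ c "dist p q"])
qed

lemma geodesic_segment_point:
  assumes "geodesic_segment p q S" "0 \<le> l" "l \<le> 1"
  obtains x where "x \<in> S" "dist p x = l * dist p q" "dist x q = (1 - l) * dist p q"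
proof -
  obtain c :: "real \<Rightarrow> 'a" where c: "c 0 = p" "c (dist p q) = q" "S = c ` {0..dist p q}"
    "\<forall>s\<in>{0..dist p q}. \<forall>t\<in>{0..dist p q}. dist (c s) (c t) = \<bar>s - t\<bar>"
    using assms(1) unfolding geodesic_segment_def by blast
  have l: "l * dist p q \<in> {0..dist p q}" using assms by (auto simp: mult_left_le_one_le)
  then have "dist (c 0) (c (l * dist p q)) = l * dist p q" using c(4) by auto
  then show ?thesis
    using that[of "c (l * dist p q)"] c l geodesic_segment_dist[OF assms(1), of "c (l * dist p q)"]
    by (auto simp: algebra_simps)
qed

locale proper_CAT0 =
  fixes M :: "'m::metric_space itself"
  assumes CAT0: "CAT0_space M"
    and proper: "\<And>(x::'m) r. compact (cball x r)"
begin

lemma geodesic_exists: obtains S where "geodesic_segment (p::'m) q S"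
  using CAT0 unfolding CAT0_space_def by blast

lemma comparison_parameters:
  fixes p q r :: 'm
  assumes "geodesic_segment p q S" "geodesic_segment p r T" "x \<in> S" "y \<in> T"
    and "dist p x = l * dist p q" "dist p y = k * dist p r"
    and "0 \<le> l" "l \<le> 1" "0 \<le> k" "k \<le> 1"
  obtains p' q' r' :: "real^2" where "dist p' q' = dist p q" "dist p' r' = dist p r"
    "dist q' r' = dist q r"
    "dist x y \<le> dist (p' + l *\<^sub>R (q' - p')) (p' + k *\<^sub>R (r' - p'))"
proof -
  obtain p' q' r' :: "real^2" where d: "dist p' q' = dist p q" "dist p' r' = dist p r"
    "dist q' r' = dist q r"
    using comparison_triangle[of "dist p q" "dist p r" "dist q r"]
      dist_triangle[of p q r] dist_triangle[of p r q] dist_triangle[of q r p]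
    by (auto simp: dist_commute)
  have *: "p' + l *\<^sub>R (q' - p') \<in> closed_segment p' q'" "p' + k *\<^sub>R (r' - p') \<in> closed_segment p' r'"
    using assms by (auto simp: in_segment algebra_simps intro: exI[of _ l] exI[of _ k])
  have "dist p' (p' + l *\<^sub>R (q' - p')) = l * dist p' q'"
    "dist p' (p' + k *\<^sub>R (r' - p')) = k * dist p' r'"
    using assms by (auto simp: dist_norm norm_minus_commute)
  then have "dist p' (p' + l *\<^sub>R (q' - p')) = dist p x" "dist p' (p' + k *\<^sub>R (r' - p')) = dist p y"
    using assms d by simp_all
  then have "dist x y \<le> dist (p' + l *\<^sub>R (q' - p')) (p' + k *\<^sub>R (r' - p'))"
    using CAT0 unfolding CAT0_space_def by (elim conjE allE impE) (use assms(1-4) * d in blast)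
  then show ?thesis using that d by blast
qed

text \<open>The vertex \<open>z\<close> is a point of the side from \<open>p\<close> to
  \<open>z\<close> with parameter 1, so the comparison of points on two sides also compares a point
  with the opposite vertex, where Stewart's identity computes the Euclidean distance.\<close>

lemma stewart_inequality:
  fixes p q z :: 'm
  assumes S: "geodesic_segment p q S" "x \<in> S" "dist p x = l * dist p q" and l: "0 \<le> l" "l \<le> 1"
  shows "(dist x z)\<^sup>2 \<le> (1 - l) * (dist p z)\<^sup>2 + l * (dist q z)\<^sup>2 - l * (1 - l) * (dist p q)\<^sup>2"
proof -
  obtain T where T: "geodesic_segment p z T" using geodesic_exists .
  obtain p' q' r' :: "real^2" where d: "dist p' q' = dist p q" "dist p' r' = dist p z"
    "dist q' r' = dist q z"
    "dist x z \<le> dist (p' + l *\<^sub>R (q' - p')) (p' + 1 *\<^sub>R (r' - p'))"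
    using comparison_parameters[OF S(1) T S(2) geodesic_segment_ends(2)[OF T] S(3) _ l, of 1]
    by auto
  then have "(dist x z)\<^sup>2 \<le> (dist (p' + l *\<^sub>R (q' - p')) r')\<^sup>2"
    by (intro power_mono) auto
  then show ?thesis by (simp only: euclidean_stewart d)
qed

lemma thales_inequality:
  fixes p q r :: 'm
  assumes "geodesic_segment p q S" "geodesic_segment p r T" "x \<in> S" "y \<in> T"
    and "dist p x = l * dist p q" "dist p y = l * dist p r" "0 \<le> l" "l \<le> 1"
  shows "dist x y \<le> l * dist q r"
proof -
  obtain p' q' r' :: "real^2" where d: "dist q' r' = dist q r"
    and "dist x y \<le> dist (p' + l *\<^sub>R (q' - p')) (p' + l *\<^sub>R (r' - p'))"
    using comparison_parameters[OF assms(1-6) assms(7,8) assms(7,8)] by blast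
  note this(2)
  also have "\<dots> = norm (l *\<^sub>R (q' - r'))" by (simp add: dist_norm algebra_simps)
  also have "\<dots> = l * dist q r" using assms d by (simp add: dist_norm)
  finally show ?thesis .
qed

text \<open>Both \<open>y\<close> and \<open>q\<close> are compared with the midpoint of the
  diagonal from \<open>x\<close> to \<open>p\<close>. The estimate is quadratic on purpose: it will
  bound a difference of squared distances to two asymptotic rays by a constant.\<close>

lemma quadrilateral_inequality:
  fixes x y p q :: 'm
  shows "(dist x p)\<^sup>2 + (dist y q)\<^sup>2 \<le> (dist x y)\<^sup>2 + (dist y p)\<^sup>2 + (dist p q)\<^sup>2 + (dist q x)\<^sup>2"
proof -
  obtain S where S: "geodesic_segment x p S" using geodesic_exists .
  obtain m where m: "m \<in> S" "dist x m = (1/2) * dist x p"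
    using geodesic_segment_point[OF S, of "1/2"] by auto
  have *: "(dist m z)\<^sup>2 \<le> (dist x z)\<^sup>2 / 2 + (dist p z)\<^sup>2 / 2 - (dist x p)\<^sup>2 / 4" for z
    using stewart_inequality[OF S m, of z] by simp
  have "dist y q \<le> dist m y + dist m q" by (metis dist_commute dist_triangle)
  then have "(dist y q)\<^sup>2 \<le> (dist m y + dist m q)\<^sup>2" by (intro power_mono) auto
  also have "\<dots> \<le> 2 * (dist m y)\<^sup>2 + 2 * (dist m q)\<^sup>2"
    using zero_le_power2[of "dist m y - dist m q"] by (simp add: power2_eq_square algebra_simps)
  finally show ?thesis using *[of y] *[of q] by (simp add: dist_commute)
qed

end

section \<open>Busemann functions\<close>

lemma geodesic_ray_dist:
  "geodesic_ray \<gamma> \<Longrightarrow> 0 \<le> s \<Longrightarrow> 0 \<le> t \<Longrightarrow> dist (\<gamma> s) (\<gamma> t) = \<bar>s - t\<bar>"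
  by (simp add: geodesic_ray_def)

lemma geodesic_ray_segment:
  assumes "geodesic_ray \<gamma>" "T \<ge> 0"
  shows "geodesic_segment (\<gamma> 0) (\<gamma> T) (\<gamma> ` {0..T})"
proof -
  have "dist (\<gamma> 0) (\<gamma> T) = T" using assms by (simp add: geodesic_ray_dist)
  then show ?thesis using assms unfolding geodesic_segment_def
    by (auto intro!: exI[of _ \<gamma>] simp: geodesic_ray_dist)
qed

lemma busemann_mono:
  assumes "geodesic_ray \<gamma>" "0 \<le> s" "s \<le> t"
  shows "s - dist x (\<gamma> s) \<le> t - dist x (\<gamma> t)"
  using dist_triangle[of x "\<gamma> t" "\<gamma> s"] geodesic_ray_dist[OF assms(1), of s t] assms by auto

lemma busemann_bound:
  assumes "geodesic_ray \<gamma>" "0 \<le> t"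
  shows "t - dist x (\<gamma> t) \<le> dist x (\<gamma> 0)"
  using dist_triangle2[of "\<gamma> 0" "\<gamma> t" x] geodesic_ray_dist[OF assms(1), of 0 t] assms
  by (auto simp: dist_commute)

text \<open>The expression is nondecreasing in t and bounded, so it converges to its supremum; this
  gives \<open>Lim\<close> in the definition its meaning.\<close>

lemma tendsto_busemann:
  assumes "geodesic_ray \<gamma>"
  shows "((\<lambda>t. t - dist x (\<gamma> t)) \<longlongrightarrow> busemann \<gamma> x) at_top"
proof -
  let ?f = "\<lambda>t. t - dist x (\<gamma> t)"
  define L where "L = Sup (?f ` {0..})"
  have bdd: "bdd_above (?f ` {0..})" using busemann_bound[OF assms] by (intro bdd_aboveI2) auto
  have "(?f \<longlongrightarrow> L) at_top"
  proof (rule order_tendstoI)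
    fix a assume "a < L"
    then obtain s where s: "s \<ge> 0" "a < ?f s"
      using less_cSup_iff[of "?f ` {0..}" a] bdd unfolding L_def by auto
    show "\<forall>\<^sub>F t in at_top. a < ?f t"
      using eventually_ge_at_top[of s]
      by eventually_elim (use busemann_mono[OF assms s(1)] s(2) in \<open>force intro: less_le_trans\<close>)
  next
    fix a assume "L < a"
    show "\<forall>\<^sub>F t in at_top. ?f t < a"
      using eventually_ge_at_top[of 0]
    proof eventually_elim
      case (elim t)
      have "?f t \<le> L" unfolding L_def using elim by (intro cSup_upper bdd) auto
      then show ?case using \<open>L < a\<close> by simp
    qed
  qed
  then show ?thesis using tendsto_Lim[of at_top ?f L] by (simp add: busemann_def)
qed

lemma busemann_ge:
  assumes "geodesic_ray \<gamma>" "0 \<le> t"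
  shows "t - dist x (\<gamma> t) \<le> busemann \<gamma> x"
proof (rule tendsto_lowerbound[OF tendsto_busemann[OF assms(1)]])
  show "\<forall>\<^sub>F s in at_top. t - dist x (\<gamma> t) \<le> s - dist x (\<gamma> s)"
    using eventually_ge_at_top[of t] by eventually_elim (use busemann_mono assms in blast)
qed simp

lemma busemann_lipschitz:
  assumes "geodesic_ray \<gamma>"
  shows "\<bar>busemann \<gamma> x - busemann \<gamma> y\<bar> \<le> dist x y"
proof -
  have *: "busemann \<gamma> x - busemann \<gamma> y \<le> dist x y" for x y
  proof (rule tendsto_upperbound[OF tendsto_diff[OF tendsto_busemann tendsto_busemann]])
    show "\<forall>\<^sub>F t in at_top. t - dist x (\<gamma> t) - (t - dist y (\<gamma> t)) \<le> dist x y"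
    proof (intro always_eventually allI)
      show "t - dist x (\<gamma> t) - (t - dist y (\<gamma> t)) \<le> dist x y" for t
        using dist_triangle[of y "\<gamma> t" x] by (simp add: dist_commute)
    qed
  qed (use assms in auto)
  show ?thesis using *[of x y] *[of y x] by (simp add: dist_commute abs_le_iff)
qed

context proper_CAT0
begin

text \<open>With \<open>busemann_ge\<close> this is a rate of convergence that is the same for all
  rays from a given point. Stewart's inequality at \<gamma> t in the triangle \<gamma> 0, \<gamma>
  T, y gives a bound that does not involve T.\<close>

lemma busemann_le:
  fixes \<gamma> :: "real \<Rightarrow> 'm"
  assumes \<gamma>: "geodesic_ray \<gamma>" and t: "t > 0" "2 * dist (\<gamma> 0) y \<le> t"
  shows "busemann \<gamma> y \<le> t - dist y (\<gamma> t) + (dist (\<gamma> 0) y)\<^sup>2 / t"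
proof (rule tendsto_upperbound[OF tendsto_busemann[OF \<gamma>]])
  define u where "u = dist (\<gamma> 0) y"
  show "\<forall>\<^sub>F T in at_top. T - dist y (\<gamma> T) \<le> t - dist y (\<gamma> t) + (dist (\<gamma> 0) y)\<^sup>2 / t"
    using eventually_ge_at_top[of t]
  proof eventually_elim
    case (elim T)
    define l where "l = t / T"
    have l: "0 \<le> l" "l \<le> 1" "l * T = t" using elim t by (auto simp: l_def)
    have dT: "dist (\<gamma> 0) (\<gamma> T) = T" "dist (\<gamma> 0) (\<gamma> t) = t"
      using \<gamma> t elim by (auto simp: geodesic_ray_dist)
    define a where "a = T - dist y (\<gamma> T)"
    have a: "a \<le> u" "- u \<le> a"
      using dist_triangle[of "\<gamma> 0" "\<gamma> T" y] dist_triangle[of y "\<gamma> T" "\<gamma> 0"] dT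
      by (auto simp: a_def u_def dist_commute)
    have a2: "a\<^sup>2 \<le> u\<^sup>2" using a by (intro power2_le_iff_abs_le[THEN iffD2]) (auto simp: u_def)
    have "(dist (\<gamma> t) y)\<^sup>2 \<le> (1 - l) * u\<^sup>2 + l * (T - a)\<^sup>2 - l * (1 - l) * T\<^sup>2"
      using stewart_inequality[OF geodesic_ray_segment[OF \<gamma>, of T], of "\<gamma> t" l y] dT l elim t
      by (simp add: u_def a_def dist_commute)
    also have "\<dots> = (t - a)\<^sup>2 + (1 - l) * (u\<^sup>2 - a\<^sup>2)"
      unfolding l(3)[symmetric] by (simp add: power2_eq_square algebra_simps)
    also have "\<dots> \<le> (t - a)\<^sup>2 + u\<^sup>2"
      using mult_left_le_one_le[of "u\<^sup>2 - a\<^sup>2" "1 - l"] l a2 zero_le_power2[of a] by linarith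
    also have "\<dots> \<le> (t - a + u\<^sup>2 / t)\<^sup>2"
    proof -
      \<comment> \<open>Because t is at least twice the distance u, the cross term of the square
        already dominates u^2.\<close>
      have "t \<le> 2 * (t - a)" using a t by (simp add: u_def)
      then have "u\<^sup>2 / t * t \<le> u\<^sup>2 / t * (2 * (t - a))" using t by (intro mult_left_mono) auto
      then have "u\<^sup>2 \<le> 2 * (t - a) * (u\<^sup>2 / t)" using t by (simp add: mult.commute)
      then show ?thesis unfolding power2_sum using zero_le_power2[of "u\<^sup>2 / t"] by linarith
    qed
    finally have "dist (\<gamma> t) y \<le> t - a + u\<^sup>2 / t"
      by (rule power2_le_imp_le) (use a t in \<open>auto simp: u_def intro!: add_nonneg_nonneg\<close>)
    then show ?case by (simp add: a_def u_def dist_commute)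
  qed
qed simp

end

lemma geodesic_segment_commute:
  assumes "geodesic_segment p q S"
  shows "geodesic_segment q p S"
proof -
  obtain c :: "real \<Rightarrow> 'a" where c: "c 0 = p" "c (dist p q) = q" "S = c ` {0..dist p q}"
    "\<forall>s\<in>{0..dist p q}. \<forall>t\<in>{0..dist p q}. dist (c s) (c t) = \<bar>s - t\<bar>"
    using assms unfolding geodesic_segment_def by blast
  let ?c = "\<lambda>t. c (dist p q - t)"
  have "?c ` {0..dist q p} = c ` ((-) (dist p q) ` {0..dist p q})"
    by (simp only: image_image dist_commute[of q p])
  also have "\<dots> = S" using c(3) by (simp add: image_diff_atLeastAtMost)
  finally show ?thesis
    using c unfolding geodesic_segment_def by (intro exI[of _ ?c]) (auto simp: dist_commute)
qed

context proper_CAT0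
begin

lemma busemann_base:
  fixes \<gamma> :: "real \<Rightarrow> 'm"
  assumes "geodesic_ray \<gamma>"
  shows "busemann \<gamma> (\<gamma> 0) = 0"
  using busemann_ge[OF assms, of 0 "\<gamma> 0"] busemann_le[OF assms, of 1 "\<gamma> 0"]
  by (simp add: geodesic_ray_dist[OF assms])

text \<open>The difference of the squared distances from y and x to \<gamma> t, divided by t, tends
  to twice the difference of the Busemann values. By \<open>quadrilateral_inequality\<close>,
  replacing the ray by an asymptotic one changes the numerator by at most the constant
  \<open>K\<close>, which disappears after division by t.\<close>

lemma busemann_diff_le_asymptotic:
  fixes \<gamma> :: "real \<Rightarrow> 'm"
  assumes \<gamma>: "geodesic_ray \<gamma>" "geodesic_ray \<gamma>'" and C: "\<And>t. t \<ge> 0 \<Longrightarrow> dist (\<gamma> t) (\<gamma>' t) \<le> C"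
  shows "busemann \<gamma> x - busemann \<gamma> y \<le> busemann \<gamma>' x - busemann \<gamma>' y"
proof -
  define f where "f \<gamma> x t = t - dist x (\<gamma> t)" for \<gamma> :: "real \<Rightarrow> 'm" and x t
  have f: "(f \<gamma> x \<longlongrightarrow> busemann \<gamma> x) at_top" if "geodesic_ray \<gamma>" for \<gamma> x
    unfolding f_def by (rule tendsto_busemann[OF that])
  define K where "K = (dist x y)\<^sup>2 + C\<^sup>2"
  define g where "g \<gamma> t = (f \<gamma> x t - f \<gamma> y t) * (2 - (f \<gamma> x t + f \<gamma> y t) * inverse t)" for \<gamma> t
  have inv: "((\<lambda>t::real. inverse t) \<longlongrightarrow> 0) at_top"
    by (rule tendsto_inverse_0_at_top[OF filterlim_ident])
  have g: "(g \<gamma> \<longlongrightarrow> (busemann \<gamma> x - busemann \<gamma> y) * (2 - (busemann \<gamma> x + busemann \<gamma> y) * 0)) at_top"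
    if "geodesic_ray \<gamma>" for \<gamma>
    unfolding g_def by (intro tendsto_intros f inv that)
  have gK: "((\<lambda>t. g \<gamma>' t + K * inverse t) \<longlongrightarrow>
    (busemann \<gamma>' x - busemann \<gamma>' y) * (2 - (busemann \<gamma>' x + busemann \<gamma>' y) * 0) + K * 0) at_top"
    by (intro tendsto_intros g inv \<gamma>)
  have "\<forall>\<^sub>F t in at_top. g \<gamma> t \<le> g \<gamma>' t + K * inverse t"
    using eventually_gt_at_top[of 0]
  proof eventually_elim
    case (elim t)
    have gt: "g \<gamma> t = ((dist y (\<gamma> t))\<^sup>2 - (dist x (\<gamma> t))\<^sup>2) * inverse t" for \<gamma>
    proof -
      have "t - f \<gamma> z t = dist z (\<gamma> t)" for z by (simp add: f_def)
      moreover have "((t - b)\<^sup>2 - (t - a)\<^sup>2) * i = (a - b) * (2 * (t * i) - (a + b) * i)"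
        for a b i :: real by (simp add: power2_eq_square algebra_simps)
      ultimately have "((dist y (\<gamma> t))\<^sup>2 - (dist x (\<gamma> t))\<^sup>2) * inverse t
        = (f \<gamma> x t - f \<gamma> y t) * (2 * (t * inverse t) - (f \<gamma> x t + f \<gamma> y t) * inverse t)" by metis
      also have "\<dots> = g \<gamma> t" using elim by (simp add: g_def)
      finally show ?thesis by simp
    qed
    have "(dist (\<gamma> t) (\<gamma>' t))\<^sup>2 \<le> C\<^sup>2" using C[of t] elim by (intro power_mono) auto
    then have "(dist y (\<gamma> t))\<^sup>2 - (dist x (\<gamma> t))\<^sup>2 \<le> (dist y (\<gamma>' t))\<^sup>2 - (dist x (\<gamma>' t))\<^sup>2 + K"
      using quadrilateral_inequality[of y "\<gamma> t" x "\<gamma>' t"] by (simp add: K_def dist_commute)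
    then show ?case unfolding gt distrib_right[symmetric] using elim by (intro mult_right_mono) auto
  qed
  from tendsto_le[OF _ gK g[OF \<gamma>(1)] this] show ?thesis by simp
qed

lemma busemann_diff_asymptotic:
  fixes \<gamma> :: "real \<Rightarrow> 'm"
  assumes "(\<gamma>, \<gamma>') \<in> asymptotic_rel"
  shows "busemann \<gamma> x - busemann \<gamma> y = busemann \<gamma>' x - busemann \<gamma>' y"
proof -
  obtain C where "geodesic_ray \<gamma>" "geodesic_ray \<gamma>'" "\<And>t. t \<ge> 0 \<Longrightarrow> dist (\<gamma> t) (\<gamma>' t) \<le> C"
    using assms unfolding asymptotic_rel_def by blast
  then show ?thesis
    using busemann_diff_le_asymptotic[of \<gamma> \<gamma>' C x y] busemann_diff_le_asymptotic[of \<gamma>' \<gamma> C x y]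
    by (simp add: dist_commute)
qed

end

section \<open>Compactness of the space of rays and continuity of Busemann functions\<close>

text \<open>Rays live in an uncountable product, where compactness does not provide convergent
  subsequences; cluster points of filters take their place.\<close>

lemma closed_cluster_point:
  assumes "closed S" "\<forall>\<^sub>F x in F. x \<in> S" "inf (nhds x) F \<noteq> bot"
  shows "x \<in> S"
proof (rule ccontr)
  assume "x \<notin> S"
  then have "\<forall>\<^sub>F y in nhds x. y \<notin> S"
    using assms(1) unfolding eventually_nhds by (intro exI[of _ "- S"]) auto
  then have "\<forall>\<^sub>F y in inf (nhds x) F. y \<notin> S \<and> y \<in> S"
    using assms(2) unfolding eventually_inf by (intro exI[of _ "\<lambda>y. y \<notin> S"] exI[of _ "\<lambda>y. y \<in> S"]) auto
  then show False using assms(3) by simp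
qed

text \<open>Freezing the values at negative parameters, which carry no information, makes this a
  compact set in the product topology.\<close>

definition based_rays :: "'m::metric_space \<Rightarrow> (real \<Rightarrow> 'm) set" where
  "based_rays b = {\<gamma>. geodesic_ray \<gamma> \<and> (\<forall>t\<le>0. \<gamma> t = b)}"

lemma continuous_on_eval: "continuous_on A (\<lambda>c. c i)"
  by (rule continuous_on_subset[OF continuous_on_product_coordinates subset_UNIV])

lemma closed_dist_eval:
  "closed {c :: 'i \<Rightarrow> 'm::metric_space. dist (c s) (c t) = a}"
  "closed {c :: 'i \<Rightarrow> 'm::metric_space. dist (c s) x \<le> a}"
  by (rule closed_Collect_eq closed_Collect_le continuous_on_dist continuous_on_eval
      continuous_on_const)+

lemma closed_based_rays: "closed (based_rays (b :: 'm::metric_space))"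
proof -
  have "based_rays b = (\<Inter>s\<in>{0..}. \<Inter>t\<in>{0..}. {c. dist (c s) (c t) = \<bar>s - t\<bar>})
      \<inter> (\<Inter>t\<in>{..0}. {c. dist (c t) b \<le> 0})"
    by (auto simp: based_rays_def geodesic_ray_def)
  also have "closed \<dots>" by (intro closed_Int closed_INT ballI closed_dist_eval)
  finally show ?thesis .
qed

context proper_CAT0
begin

text \<open>A pointwise bound by a closed ball at each parameter, of radius 0 at negative ones, is
  all that Tychonoff's theorem requires; no continuity of the paths enters.\<close>

lemma compact_slow_paths: "compact {c :: real \<Rightarrow> 'm. \<forall>t. dist (c t) b \<le> max t 0}"
proof -
  have "compactin (product_topology (\<lambda>_. euclidean) UNIV) (\<Pi>\<^sub>E t\<in>UNIV. cball b (max t 0))"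
    by (subst compactin_PiE) (auto simp: proper)
  moreover have "(\<Pi>\<^sub>E t\<in>UNIV. cball b (max t 0)) = {c. \<forall>t. dist (c t) b \<le> max t 0}"
    by (auto simp: PiE_def Pi_def dist_commute)
  ultimately show ?thesis by (simp add: euclidean_product_topology)
qed

lemma compact_based_rays: "compact (based_rays (b :: 'm))"
proof -
  have "based_rays b \<subseteq> {c. \<forall>t. dist (c t) b \<le> max t 0}"
  proof clarify
    fix \<gamma> t assume \<gamma>: "\<gamma> \<in> based_rays b"
    show "dist (\<gamma> t) b \<le> max t 0"
    proof (cases "t \<le> 0")
      case False
      then show ?thesis using \<gamma> geodesic_ray_dist[of \<gamma> t 0] by (auto simp: based_rays_def)
    qed (use \<gamma> in \<open>auto simp: based_rays_def\<close>)
  qed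
  then show ?thesis
    using compact_Int_closed[OF compact_slow_paths[of b] closed_based_rays[of b]] by (simp add: Int_absorb1)
qed

text \<open>The ray is a cluster point of the segments from \<open>b\<close> to \<gamma> T as T
  tends to infinity. Seen from the common vertex \<gamma> T, each such segment stays close to the
  given ray, with a bound independent of T.\<close>

lemma asymptotic_based_ray:
  fixes \<gamma> :: "real \<Rightarrow> 'm"
  assumes \<gamma>: "geodesic_ray \<gamma>"
  obtains c where "c \<in> based_rays b" "(\<gamma>, c) \<in> asymptotic_rel"
proof -
  define D where "D T = dist b (\<gamma> T)" for T
  define u where "u = dist b (\<gamma> 0)"
  have "\<exists>c. c 0 = b \<and> c (D T) = \<gamma> T \<and>
      (\<forall>s\<in>{0..D T}. \<forall>t\<in>{0..D T}. dist (c s) (c t) = \<bar>s - t\<bar>)" for T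
    using geodesic_exists[of b "\<gamma> T"] unfolding geodesic_segment_def D_def by metis
  then obtain c where c: "\<And>T. c T 0 = b" "\<And>T. c T (D T) = \<gamma> T"
    "\<And>T s t. s \<in> {0..D T} \<Longrightarrow> t \<in> {0..D T} \<Longrightarrow> dist (c T s) (c T t) = \<bar>s - t\<bar>"
    by metis
  \<comment> \<open>Outside the parameter range of the segment the value is reset to
    \<open>b\<close>, so that the pointwise bound of \<open>compact_slow_paths\<close> holds
    everywhere.\<close>
  define c' where "c' T t = (if 0 \<le> t \<and> t \<le> D T then c T t else b)" for T t
  let ?F = "filtermap c' at_top"
  have slow: "dist (c' T t) b \<le> max t 0" for T t
    using c(3)[of t T 0] c(1)[of T] by (auto simp: c'_def D_def)
  obtain r where r: "inf (nhds r) ?F \<noteq> bot"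
    using compact_slow_paths[of b, unfolded compact_filter, rule_format, of ?F] slow
    by (auto simp: eventually_filtermap filtermap_bot_iff)
  have DT: "T - u \<le> D T" "D T \<le> T + u" if "T \<ge> 0" for T
    using dist_triangle[of "\<gamma> 0" "\<gamma> T" b] dist_triangle[of b "\<gamma> T" "\<gamma> 0"]
      geodesic_ray_dist[OF \<gamma>, of 0 T] that by (auto simp: D_def u_def dist_commute)
  have ev: "\<forall>\<^sub>F T in at_top. T > 0 \<and> s < D T" for s
    using eventually_gt_at_top[of "max 0 (s + u)"]
  proof eventually_elim
    case (elim T)
    then show ?case using DT(1)[of T] by linarith
  qed
  have ray: "dist (r s) (r t) = \<bar>s - t\<bar>" if "s \<ge> 0" "t \<ge> 0" for s t
  proof -
    have "\<forall>\<^sub>F T in at_top. dist (c' T s) (c' T t) = \<bar>s - t\<bar>"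
      using ev[of s] ev[of t] by eventually_elim (use that c in \<open>auto simp: c'_def\<close>)
    then show ?thesis
      using closed_cluster_point[OF closed_dist_eval(1) _ r] by (auto simp: eventually_filtermap)
  qed
  have base: "r t = b" if "t \<le> 0" for t
    using closed_cluster_point[OF closed_dist_eval(2)[of t b 0] _ r] slow[of _ t] that
    by (auto simp: eventually_filtermap max_def)
  have "dist (r s) (\<gamma> s) \<le> 2 * u" if s: "s \<ge> 0" for s
  proof -
    have "\<forall>\<^sub>F T in at_top. dist (c' T s) (\<gamma> s) \<le> 2 * u"
      using ev[of s]
    proof eventually_elim
      case (elim T)
      then have T: "T > 0" "s < D T" by auto
      \<comment> \<open>The fraction is measured from the vertex \<gamma> T, as
        \<open>thales_inequality\<close> demands; the corresponding point on the ray then has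
        parameter T - l T, and not s.\<close>
      define l where "l = 1 - s / D T"
      have l: "0 \<le> l" "l \<le> 1" "l * D T = D T - s"
        using T s by (auto simp: l_def left_diff_distrib)
      have Tl: "0 \<le> T - l * T" "T - l * T \<le> T" using l T by (auto simp: mult_left_le_one_le)
      have seg: "geodesic_segment (\<gamma> T) b (c T ` {0..D T})"
        by (rule geodesic_segment_commute) (use c in \<open>auto simp: geodesic_segment_def D_def intro!: exI[of _ "c T"]\<close>)
      have "dist (c T s) (\<gamma> (T - l * T)) \<le> l * dist b (\<gamma> 0)"
      proof (rule thales_inequality[OF seg geodesic_segment_commute[OF geodesic_ray_segment[OF \<gamma>, of T]]])
        show "dist (\<gamma> T) (c T s) = l * dist (\<gamma> T) b"
          using c(2)[of T] c(3)[of "D T" T s] l s T by (auto simp: D_def dist_commute)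
        show "dist (\<gamma> T) (\<gamma> (T - l * T)) = l * dist (\<gamma> T) (\<gamma> 0)"
          using Tl T l by (auto simp: geodesic_ray_dist[OF \<gamma>])
      qed (use s T Tl l in auto)
      also have "\<dots> \<le> u" using l by (simp add: u_def mult_left_le_one_le)
      finally have 1: "dist (c T s) (\<gamma> (T - l * T)) \<le> u" .
      \<comment> \<open>The two parameters differ by at most \<open>u\<close>, because the two sides
        at \<gamma> T differ in length by at most \<open>u\<close>. This is the second half of the
        bound 2u.\<close>
      have "T - l * T - s = (s / D T) * (T - D T)" using T s
        by (simp add: l_def left_diff_distrib right_diff_distrib)
      then have "\<bar>T - l * T - s\<bar> = (s / D T) * \<bar>T - D T\<bar>" using s T by (simp add: abs_mult)
      also have "\<dots> \<le> 1 * u" using DT[of T] T s by (intro mult_mono) auto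
      finally have "dist (\<gamma> (T - l * T)) (\<gamma> s) \<le> u" using Tl s by (simp add: geodesic_ray_dist[OF \<gamma>])
      then have "dist (c T s) (\<gamma> s) \<le> 2 * u"
        using 1 dist_triangle[of "c T s" "\<gamma> s" "\<gamma> (T - l * T)"] by simp
      then show ?case using s T by (simp add: c'_def)
    qed
    then show ?thesis
      using closed_cluster_point[OF closed_dist_eval(2)[of s "\<gamma> s" "2 * u"] _ r]
      by (auto simp: eventually_filtermap)
  qed
  then have "(\<gamma>, r) \<in> asymptotic_rel"
    using \<gamma> ray unfolding asymptotic_rel_def geodesic_ray_def
    by (auto intro!: exI[of _ "2 * u"] simp: dist_commute)
  moreover have "r \<in> based_rays b" using ray base by (auto simp: based_rays_def geodesic_ray_def)
  ultimately show ?thesis using that by blast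
qed

text \<open>Each approximation evaluates the ray at one parameter and is therefore continuous; by
  \<open>busemann_le\<close> the convergence is uniform over the rays from \<open>b\<close>.\<close>

lemma continuous_on_busemann:
  "continuous_on (based_rays (b :: 'm)) (\<lambda>\<gamma>. busemann \<gamma> p)"
proof (rule uniform_limit_theorem)
  show "\<forall>\<^sub>F t in at_top. continuous_on (based_rays b) (\<lambda>\<gamma>. t - dist p (\<gamma> t))"
    by (intro always_eventually allI continuous_intros continuous_on_eval)
  show "uniform_limit (based_rays b) (\<lambda>t \<gamma>. t - dist p (\<gamma> t)) (\<lambda>\<gamma>. busemann \<gamma> p) at_top"
  proof (rule uniform_limitI)
    fix e :: real assume e: "e > 0"
    define u where "u = dist b p"
    show "\<forall>\<^sub>F t in at_top. \<forall>\<gamma>\<in>based_rays b. dist (t - dist p (\<gamma> t)) (busemann \<gamma> p) < e"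
      using eventually_gt_at_top[of "max 0 (max (2 * u) (u\<^sup>2 / e))"]
    proof eventually_elim
      case (elim t)
      then have t: "t > 0" "2 * u \<le> t" "u\<^sup>2 / t < e" using e by (auto simp: field_simps)
      show ?case
      proof
        fix \<gamma> assume "\<gamma> \<in> based_rays b"
        then have \<gamma>: "geodesic_ray \<gamma>" "\<gamma> 0 = b" by (auto simp: based_rays_def)
        show "dist (t - dist p (\<gamma> t)) (busemann \<gamma> p) < e"
          using busemann_ge[OF \<gamma>(1), of t p] busemann_le[OF \<gamma>(1), of t p] t \<gamma>(2)
          by (auto simp: dist_real_def u_def)
      qed
    qed
  qed
qed simp

text \<open>The constant \<kappa> absorbs the passage from an arbitrary ray to an asymptotic one
  issuing from \<open>b\<close>. The finite set of test points may depend on the reference ray,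
  since each reference ray only has to control its own neighbourhood.\<close>

lemma finite_busemann_cover:
  fixes P :: "(real \<Rightarrow> 'm) \<Rightarrow> 'm set"
  assumes P: "\<And>\<gamma>. geodesic_ray \<gamma> \<Longrightarrow> finite (P \<gamma>)" and e: "e > 0"
  obtains \<Gamma> where "finite \<Gamma>" "\<And>\<gamma>. \<gamma> \<in> \<Gamma> \<Longrightarrow> geodesic_ray \<gamma>"
    "\<And>\<gamma>. geodesic_ray \<gamma> \<Longrightarrow>
      \<exists>\<gamma>0\<in>\<Gamma>. \<exists>\<kappa>. \<forall>p\<in>P \<gamma>0. \<bar>busemann \<gamma> p - busemann \<gamma>0 p - \<kappa>\<bar> < e"
proof -
  \<comment> \<open>Any base point serves.\<close>
  define b :: 'm where "b = undefined"
  have "\<exists>A. open A \<and> \<gamma>0 \<in> A \<and>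
    (\<forall>\<gamma>\<in>A \<inter> based_rays b. \<forall>p\<in>P \<gamma>0. \<bar>busemann \<gamma> p - busemann \<gamma>0 p\<bar> < e)"
    if \<gamma>0: "\<gamma>0 \<in> based_rays b" for \<gamma>0
  proof -
    have "\<forall>\<^sub>F \<gamma> in at \<gamma>0 within based_rays b. \<bar>busemann \<gamma> p - busemann \<gamma>0 p\<bar> < e" for p
      using continuous_on_busemann[of b p] \<gamma>0 e unfolding continuous_on_def tendsto_iff dist_real_def
      by blast
    then have "\<forall>\<^sub>F \<gamma> in at \<gamma>0 within based_rays b. \<forall>p\<in>P \<gamma>0. \<bar>busemann \<gamma> p - busemann \<gamma>0 p\<bar> < e"
      using P \<gamma>0 by (intro eventually_ball_finite) (auto simp: based_rays_def)
    then obtain A where A: "open A" "\<gamma>0 \<in> A" "\<forall>\<gamma>\<in>A. \<gamma> \<noteq> \<gamma>0 \<longrightarrow> \<gamma> \<in> based_rays b \<longrightarrow>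
        (\<forall>p\<in>P \<gamma>0. \<bar>busemann \<gamma> p - busemann \<gamma>0 p\<bar> < e)"
      unfolding eventually_at_topological by blast
    then have "\<forall>\<gamma>\<in>A \<inter> based_rays b. \<forall>p\<in>P \<gamma>0. \<bar>busemann \<gamma> p - busemann \<gamma>0 p\<bar> < e"
      using e by fastforce
    then show ?thesis using A by blast
  qed
  then obtain A where A: "\<And>\<gamma>0. \<gamma>0 \<in> based_rays b \<Longrightarrow> open (A \<gamma>0) \<and> \<gamma>0 \<in> A \<gamma>0 \<and>
    (\<forall>\<gamma>\<in>A \<gamma>0 \<inter> based_rays b. \<forall>p\<in>P \<gamma>0. \<bar>busemann \<gamma> p - busemann \<gamma>0 p\<bar> < e)"
    by metis
  obtain \<Gamma> where \<Gamma>: "\<Gamma> \<subseteq> based_rays b" "finite \<Gamma>" "based_rays b \<subseteq> (\<Union>\<gamma>0\<in>\<Gamma>. A \<gamma>0)"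
    using compactE_image[OF compact_based_rays, of "based_rays b" A b] A by blast
  show ?thesis
  proof
    fix \<gamma> :: "real \<Rightarrow> 'm" assume "geodesic_ray \<gamma>"
    then obtain c where c: "c \<in> based_rays b" "(\<gamma>, c) \<in> asymptotic_rel"
      using asymptotic_based_ray by blast
    then obtain \<gamma>0 where \<gamma>0: "\<gamma>0 \<in> \<Gamma>" "c \<in> A \<gamma>0" using \<Gamma> by blast
    have "\<bar>busemann \<gamma> p - busemann \<gamma>0 p - (busemann \<gamma> b - busemann c b)\<bar> < e"
      if "p \<in> P \<gamma>0" for p
    proof -
      have "\<bar>busemann c p - busemann \<gamma>0 p\<bar> < e" using A[of \<gamma>0] \<gamma>0 c \<Gamma> that by blast
      then show ?thesis
        using busemann_diff_asymptotic[OF c(2), of p b] unfolding abs_less_iff by linarith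
    qed
    then show "\<exists>\<gamma>0\<in>\<Gamma>. \<exists>\<kappa>. \<forall>p\<in>P \<gamma>0. \<bar>busemann \<gamma> p - busemann \<gamma>0 p - \<kappa>\<bar> < e"
      using \<gamma>0 by blast
  qed (use \<Gamma> in \<open>auto simp: based_rays_def\<close>)
qed

end

section \<open>Angles, the Tits metric and differences of Busemann functions\<close>

lemma cos_ge_one_minus_square: "1 - x\<^sup>2 / 2 \<le> cos (x :: real)"
proof -
  have "\<bar>sin (x / 2)\<bar> \<le> \<bar>x / 2\<bar>" by (rule abs_sin_x_le_abs_x)
  then have "(sin (x / 2))\<^sup>2 \<le> (x / 2)\<^sup>2" by (rule abs_le_square_iff[THEN iffD1])
  then show ?thesis using cos_double_sin[of "x / 2"] by (simp add: power2_eq_square)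
qed

text \<open>On the diagonal t = t' the comparison triangle is isosceles with legs t, and
  \<open>z\<close> is the cosine of its apex angle; 1 - cos \<epsilon> \<le> \<epsilon>^2 / 2 bounds
  the base by \<epsilon> t.\<close>

lemma alexandrov_angle_less_imp_dist_le:
  assumes c: "geodesic_ray c" "geodesic_ray c'" "c 0 = c' 0"
    and angle: "alexandrov_angle c c' < ereal \<epsilon>" and "\<epsilon> > 0"
  shows "\<forall>\<^sub>F t in at_right 0. dist (c t) (c' t) \<le> \<epsilon> * t"
proof -
  have "\<forall>\<^sub>F (t, t') in at_right 0 \<times>\<^sub>F at_right 0. comparison_angle (c 0) (c t) (c' t') < \<epsilon>"
    using Limsup_lessD[OF angle[unfolded alexandrov_angle_def]] by (simp add: case_prod_unfold)
  then obtain P Q where PQ: "eventually P (at_right (0::real))" "eventually Q (at_right (0::real))"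
    "\<And>t t'. P t \<Longrightarrow> Q t' \<Longrightarrow> comparison_angle (c 0) (c t) (c' t') < \<epsilon>"
    unfolding eventually_prod_filter by auto
  show ?thesis
    using PQ(1,2) eventually_at_right_less[of 0]
  proof eventually_elim
    case (elim t)
    define d where "d = dist (c t) (c' t)"
    define z where "z = 1 - d\<^sup>2 / (2 * t\<^sup>2)"
    have t: "t > 0" "dist (c 0) (c t) = t" "dist (c 0) (c' t) = t"
      using elim geodesic_ray_dist[OF c(1), of 0 t] geodesic_ray_dist[OF c(2), of 0 t] c(3) by auto
    have d: "0 \<le> d" "d \<le> 2 * t"
      using dist_triangle2[of "c t" "c' t" "c 0"] t by (auto simp: d_def dist_commute)
    then have "d\<^sup>2 \<le> (2 * t)\<^sup>2" by (intro power_mono) auto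
    then have z: "-1 \<le> z" "z \<le> 1" using t by (auto simp: z_def field_simps)
    have "(t\<^sup>2 + t\<^sup>2 - d\<^sup>2) / (2 * t * t) = z"
      using t by (simp add: z_def field_simps power2_eq_square)
    then have "arccos z < \<epsilon>"
      using PQ(3)[OF elim(1,2)] t by (simp add: comparison_angle_def d_def)
    then have "(arccos z)\<^sup>2 \<le> \<epsilon>\<^sup>2" using arccos_lbound[OF z] by (intro power_mono) auto
    then have "1 - \<epsilon>\<^sup>2 / 2 \<le> z" using cos_ge_one_minus_square[of "arccos z"] z by simp
    then have "d\<^sup>2 \<le> (\<epsilon> * t)\<^sup>2" using t by (simp add: z_def field_simps)
    then show ?case unfolding d_def[symmetric]
      by (rule power2_le_imp_le) (use t \<open>\<epsilon> > 0\<close> in auto)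
  qed
qed

text \<open>The estimate is additive over adjacent intervals, so bisection spreads it from small
  intervals around each point to the whole interval.\<close>

lemma local_lipschitz_imp_diff_le:
  fixes f :: "real \<Rightarrow> real"
  assumes local: "\<And>s. 0 \<le> s \<Longrightarrow> s \<le> L \<Longrightarrow>
      \<exists>r>0. \<forall>t\<in>{0..L}. \<bar>s - t\<bar> < r \<longrightarrow> \<bar>f t - f s\<bar> \<le> A * \<bar>s - t\<bar>"
    and "0 \<le> L"
  shows "\<bar>f L - f 0\<bar> \<le> A * L"
proof -
  have "0 \<le> (0::real) \<longrightarrow> L \<le> L \<longrightarrow> \<bar>f L - f 0\<bar> \<le> A * (L - 0)"
  proof (rule Bolzano[of 0 L "\<lambda>a b. 0 \<le> a \<longrightarrow> b \<le> L \<longrightarrow> \<bar>f b - f a\<bar> \<le> A * (b - a)"])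
    fix a b c :: real
    assume "0 \<le> a \<longrightarrow> b \<le> L \<longrightarrow> \<bar>f b - f a\<bar> \<le> A * (b - a)" "a \<le> b"
      "0 \<le> b \<longrightarrow> c \<le> L \<longrightarrow> \<bar>f c - f b\<bar> \<le> A * (c - b)" "b \<le> c"
    then show "0 \<le> a \<longrightarrow> c \<le> L \<longrightarrow> \<bar>f c - f a\<bar> \<le> A * (c - a)"
      by (auto simp: right_diff_distrib)
  next
    fix x assume x: "0 \<le> x" "x \<le> L"
    then obtain r where r: "r > 0" "\<forall>t\<in>{0..L}. \<bar>x - t\<bar> < r \<longrightarrow> \<bar>f t - f x\<bar> \<le> A * \<bar>x - t\<bar>"
      using local[of x] by auto
    show "\<exists>d>0. \<forall>a b. a \<le> x \<and> x \<le> b \<and> b - a < d \<longrightarrow>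
        0 \<le> a \<longrightarrow> b \<le> L \<longrightarrow> \<bar>f b - f a\<bar> \<le> A * (b - a)"
    proof (intro exI[of _ r] conjI allI impI r(1))
      fix a b assume ab: "a \<le> x \<and> x \<le> b \<and> b - a < r" "0 \<le> a" "b \<le> L"
      then have "\<bar>f a - f x\<bar> \<le> A * (x - a)" "\<bar>f b - f x\<bar> \<le> A * (b - x)"
        using r(2)[rule_format, of a] r(2)[rule_format, of b] x by auto
      then show "\<bar>f b - f a\<bar> \<le> A * (b - a)" by (auto simp: right_diff_distrib)
    qed
  qed (use \<open>0 \<le> L\<close> in auto)
  then show ?thesis by simp
qed

lemma equiv_asymptotic_rel:
  "equiv {\<gamma> :: real \<Rightarrow> 'm::metric_space. geodesic_ray \<gamma>} asymptotic_rel"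
proof (rule equivI)
  show "asymptotic_rel \<subseteq> {\<gamma> :: real \<Rightarrow> 'm. geodesic_ray \<gamma>} \<times> {\<gamma>. geodesic_ray \<gamma>}"
    by (auto simp: asymptotic_rel_def)
  show "refl_on {\<gamma> :: real \<Rightarrow> 'm. geodesic_ray \<gamma>} asymptotic_rel"
    by (auto simp: refl_on_def asymptotic_rel_def intro: exI[of _ 0])
  show "sym (asymptotic_rel :: ((real \<Rightarrow> 'm) \<times> _) set)"
    by (auto simp: sym_def asymptotic_rel_def dist_commute)
  show "trans (asymptotic_rel :: ((real \<Rightarrow> 'm) \<times> _) set)"
  proof (rule transI)
    fix x y z :: "real \<Rightarrow> 'm" assume "(x, y) \<in> asymptotic_rel" "(y, z) \<in> asymptotic_rel"
    then obtain C D where *: "geodesic_ray x" "geodesic_ray z" "\<forall>t\<ge>0. dist (x t) (y t) \<le> C"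
      "\<forall>t\<ge>0. dist (y t) (z t) \<le> D"
      unfolding asymptotic_rel_def by blast
    then have "dist (x t) (z t) \<le> C + D" if "t \<ge> 0" for t
      using that dist_triangle[of "x t" "z t" "y t"] by force
    then show "(x, z) \<in> asymptotic_rel" using * unfolding asymptotic_rel_def by blast
  qed
qed

lemma ideal_boundaryD:
  assumes "\<xi> \<in> ideal_boundary"
  shows "\<xi> \<noteq> {}" and "\<gamma> \<in> \<xi> \<Longrightarrow> geodesic_ray \<gamma>"
    and "\<gamma> \<in> \<xi> \<Longrightarrow> \<gamma>' \<in> \<xi> \<longleftrightarrow> (\<gamma>, \<gamma>') \<in> asymptotic_rel"
proof -
  note q = assms[unfolded ideal_boundary_def]
  show "\<xi> \<noteq> {}" using in_quotient_imp_non_empty[OF equiv_asymptotic_rel q] .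
  show "geodesic_ray \<gamma>" if "\<gamma> \<in> \<xi>"
    using in_quotient_imp_subset[OF equiv_asymptotic_rel q] that by blast
  show "\<gamma>' \<in> \<xi> \<longleftrightarrow> (\<gamma>, \<gamma>') \<in> asymptotic_rel" if "\<gamma> \<in> \<xi>"
    using in_quotient_imp_closed[OF equiv_asymptotic_rel q that]
      in_quotient_imp_in_rel[OF equiv_asymptotic_rel q, of \<gamma> \<gamma>'] that by blast
qed

lemma ideal_boundary_class:
  assumes "geodesic_ray \<gamma>"
  obtains \<xi> where "\<xi> \<in> ideal_boundary" "\<gamma> \<in> \<xi>"
proof
  show "asymptotic_rel `` {\<gamma>} \<in> ideal_boundary"
    using assms by (auto simp: ideal_boundary_def intro: quotientI)
  show "\<gamma> \<in> asymptotic_rel `` {\<gamma>}"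
    using assms by (auto simp: asymptotic_rel_def intro: exI[of _ 0])
qed

text \<open>The subdivision consisting of the two ends 0 and 1 is one of those over which the length
  is a supremum. Hence a small Tits distance may be used through the angle alone.\<close>

lemma angular_metric_le_tits_metric:
  "angular_metric \<xi> \<eta> \<le> tits_metric \<xi> \<eta>"
  unfolding tits_metric_def
proof (rule Inf_greatest, clarify)
  fix c :: "real \<Rightarrow> (real \<Rightarrow> 'a) set"
  have "angular_metric (c 0) (c 1)
    = (\<Sum>i < length [0, 1::real] - 1. angular_metric (c ([0, 1] ! i)) (c ([0, 1] ! Suc i)))" by simp
  also have "\<dots> \<le> angular_length c" unfolding angular_length_def by (rule SUP_upper) auto
  finally show "angular_metric (c 0) (c 1) \<le> angular_length c" .
qed

context proper_CAT0
begin

text \<open>For y at distance u from x, the rays from x are inspected at time t = K u. Replacing a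
  Busemann value by its approximation at t costs u^2 / t = u / K, and the points of the two rays at
  time t are at most t / K^2 = u / K apart; this scale balances the two errors. Their sum 2 u / K is
  rounded up to 3 u / K.\<close>

lemma busemann_diff_local:
  fixes \<xi> \<eta> :: "(real \<Rightarrow> 'm) set"
  assumes \<xi>: "\<xi> \<in> ideal_boundary" "\<gamma> \<in> \<xi>" and \<eta>: "\<eta> \<in> ideal_boundary" "\<gamma>' \<in> \<eta>"
    and K: "K \<ge> 2" and angle: "angular_metric \<xi> \<eta> < ereal (1 / K\<^sup>2)"
  shows "\<exists>r>0. \<forall>y. dist x y < r \<longrightarrow>
    \<bar>(busemann \<gamma> y - busemann \<gamma>' y) - (busemann \<gamma> x - busemann \<gamma>' x)\<bar> \<le> 3 / K * dist x y"
proof -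
  obtain c where c: "c \<in> based_rays x" "(\<gamma>, c) \<in> asymptotic_rel"
    using asymptotic_based_ray[of \<gamma> x] ideal_boundaryD[OF \<xi>(1)] \<xi>(2) by blast
  obtain c' where c': "c' \<in> based_rays x" "(\<gamma>', c') \<in> asymptotic_rel"
    using asymptotic_based_ray[of \<gamma>' x] ideal_boundaryD[OF \<eta>(1)] \<eta>(2) by blast
  have in_class: "c \<in> \<xi>" "c' \<in> \<eta>"
    using ideal_boundaryD(3)[OF \<xi>] ideal_boundaryD(3)[OF \<eta>] c c' by auto
  have rays: "geodesic_ray c" "geodesic_ray c'" "c 0 = x" "c' 0 = x"
    using c c' by (auto simp: based_rays_def)
  have "alexandrov_angle c c' \<le> angular_metric \<xi> \<eta>"
    unfolding angular_metric_def using in_class rays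
    by (intro Sup_upper CollectI exI[of _ c] exI[of _ c']) auto
  then have "alexandrov_angle c c' < ereal (1 / K\<^sup>2)" using angle by (rule le_less_trans)
  then have "\<forall>\<^sub>F t in at_right 0. dist (c t) (c' t) \<le> 1 / K\<^sup>2 * t"
    using K by (intro alexandrov_angle_less_imp_dist_le rays) (auto simp: rays)
  then obtain r where r: "r > 0" "\<And>t. 0 < t \<Longrightarrow> t < r \<Longrightarrow> dist (c t) (c' t) \<le> 1 / K\<^sup>2 * t"
    unfolding eventually_at_right_field by auto
  show ?thesis
  \<comment> \<open>With u < r / K the time K u stays below \<open>r\<close>, where the angle
    estimate is valid.\<close>
  proof (intro exI[of _ "r / K"] conjI allI impI)
    fix y assume y: "dist x y < r / K"
    define u where "u = dist x y"
    show "\<bar>(busemann \<gamma> y - busemann \<gamma>' y) - (busemann \<gamma> x - busemann \<gamma>' x)\<bar> \<le> 3 / K * dist x y"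
    proof (cases "u = 0")
      case False
      then have u: "u > 0" by (simp add: u_def)
      define t where "t = K * u"
      have t: "0 < t" "t < r" "2 * u \<le> t"
        using u K y by (auto simp: t_def u_def field_simps)
      have ut: "u\<^sup>2 / t = u / K" "1 / K\<^sup>2 * t = u / K"
        using u K by (auto simp: t_def power2_eq_square)
      have *: "t - dist y (c t) \<le> busemann c y" "busemann c y \<le> t - dist y (c t) + u / K"
        if "geodesic_ray c" "c 0 = x" for c
        using busemann_ge[OF that(1), of t y] busemann_le[OF that(1), of t y] that t
        by (auto simp: u_def[symmetric] ut)
      have "dist (c t) (c' t) \<le> u / K" using r(2)[OF t(1,2)] ut by simp
      then have "dist y (c t) \<le> dist y (c' t) + u / K" "dist y (c' t) \<le> dist y (c t) + u / K"
        using dist_triangle[of y "c t" "c' t"] dist_triangle[of y "c' t" "c t"]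
        by (auto simp: dist_commute)
      then have "\<bar>busemann c y - busemann c' y\<bar> \<le> 2 * (u / K)"
        using *[OF rays(1,3)] *[OF rays(2,4)] by linarith
      also have "\<dots> \<le> 3 * (u / K)" using u K by (intro mult_right_mono) auto
      finally have "\<bar>busemann c y - busemann c' y\<bar> \<le> 3 / K * u" by simp
      moreover have "busemann c x = 0" "busemann c' x = 0"
        using busemann_base[OF rays(1)] busemann_base[OF rays(2)] rays by auto
      moreover note busemann_diff_asymptotic[OF c(2), of x y]
        busemann_diff_asymptotic[OF c'(2), of x y]
      ultimately show ?thesis by (simp add: u_def)
    qed (simp add: u_def)
  qed (use r K in auto)
qed

text \<open>The angular metric is a supremum over all vertices, so the local estimate holds with the
  same \<open>K\<close> at every point of a geodesic from \<open>p\<close> to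
  \<open>q\<close>.\<close>

lemma busemann_diff_le_angle:
  fixes \<xi> \<eta> :: "(real \<Rightarrow> 'm) set"
  assumes "\<xi> \<in> ideal_boundary" "\<gamma> \<in> \<xi>" "\<eta> \<in> ideal_boundary" "\<gamma>' \<in> \<eta>"
    and K: "K \<ge> 2" and "angular_metric \<xi> \<eta> < ereal (1 / K\<^sup>2)"
  shows "\<bar>(busemann \<gamma> q - busemann \<gamma>' q) - (busemann \<gamma> p - busemann \<gamma>' p)\<bar> \<le> 3 / K * dist p q"
proof -
  define D where "D y = busemann \<gamma> y - busemann \<gamma>' y" for y
  obtain c :: "real \<Rightarrow> 'm" where c: "c 0 = p" "c (dist p q) = q"
    "\<forall>s\<in>{0..dist p q}. \<forall>t\<in>{0..dist p q}. dist (c s) (c t) = \<bar>s - t\<bar>"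
    using geodesic_exists[of p q] unfolding geodesic_segment_def by metis
  have "\<bar>D (c (dist p q)) - D (c 0)\<bar> \<le> 3 / K * dist p q"
  proof (rule local_lipschitz_imp_diff_le)
    fix s assume s: "0 \<le> s" "s \<le> dist p q"
    obtain r where r: "r > 0" "\<And>y. dist (c s) y < r \<Longrightarrow> \<bar>D y - D (c s)\<bar> \<le> 3 / K * dist (c s) y"
      using busemann_diff_local[OF assms, of "c s"] unfolding D_def by blast
    show "\<exists>r>0. \<forall>t\<in>{0..dist p q}. \<bar>s - t\<bar> < r \<longrightarrow> \<bar>D (c t) - D (c s)\<bar> \<le> 3 / K * \<bar>s - t\<bar>"
    proof (intro exI[of _ r] conjI ballI impI r(1))
      fix t assume t: "t \<in> {0..dist p q}" "\<bar>s - t\<bar> < r"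
      have "dist (c s) (c t) = \<bar>s - t\<bar>" using c(3) s t by simp
      then show "\<bar>D (c t) - D (c s)\<bar> \<le> 3 / K * \<bar>s - t\<bar>" using r(2)[of "c t"] t by simp
    qed
  qed simp
  then show ?thesis using c by (simp add: D_def)
qed

end

section \<open>Neighbourhoods of an action\<close>

lemma topspace_Isom_topology:
  "topspace Isom_topology = carrier (Isom_group :: ('m::metric_space \<Rightarrow> 'm) monoid)"
proof -
  have "continuous_map euclidean euclidean f" if "f \<in> carrier Isom_group" for f :: "'m \<Rightarrow> 'm"
  proof -
    have "continuous_on UNIV f"
      using that by (auto simp: Isom_group_def continuous_on_iff)
    then show ?thesis by simp
  qed
  then have "carrier Isom_group \<subseteq> {f :: 'm \<Rightarrow> 'm. continuous_map euclidean euclidean f \<and> f ` {} \<subseteq> UNIV}"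
    by auto
  also have "\<dots> \<subseteq> topspace (compact_open_topology euclidean euclidean)"
    unfolding compact_open_topology_def
    by (rule openin_subset, rule topology_generated_by_Basis, rule CollectI,
        rule exI[of _ "{}"], rule exI[of _ UNIV]) simp
  finally show ?thesis by (auto simp: Isom_topology_def)
qed

lemma openin_Isom_ball:
  "openin Isom_topology {f \<in> carrier (Isom_group :: ('m::metric_space \<Rightarrow> 'm) monoid). dist (f p) q < r}"
proof -
  let ?W = "{f :: 'm \<Rightarrow> 'm. continuous_map euclidean euclidean f \<and> f ` {p} \<subseteq> ball q r}"
  have "openin (compact_open_topology euclidean euclidean) ?W"
    unfolding compact_open_topology_def
    by (rule topology_generated_by_Basis, rule CollectI, rule exI[of _ "{p}"], rule exI[of _ "ball q r"]) simp
  moreover have "{f \<in> carrier Isom_group. dist (f p) q < r} = ?W \<inter> carrier Isom_group"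
    by (auto simp: Isom_group_def continuous_on_iff dist_commute)
  ultimately show ?thesis unfolding Isom_topology_def openin_subtopology by blast
qed

lemma openin_Hom_ball:
  assumes "g \<in> carrier G"
  shows "openin (Hom_topology G)
    {\<rho> \<in> hom G (Isom_group :: ('m::metric_space \<Rightarrow> 'm) monoid). dist (\<rho> g p) q < r}"
proof -
  let ?U = "{f \<in> carrier (Isom_group :: ('m \<Rightarrow> 'm) monoid). dist (f p) q < r}"
  let ?W = "{\<rho>. continuous_map (discrete_topology (carrier G)) Isom_topology \<rho> \<and> \<rho> ` {g} \<subseteq> ?U}"
  have "openin (compact_open_topology (discrete_topology (carrier G)) Isom_topology) ?W"
    unfolding compact_open_topology_def
    by (rule topology_generated_by_Basis, rule CollectI, rule exI[of _ "{g}"], rule exI[of _ ?U])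
      (use assms openin_Isom_ball in \<open>auto simp: finite_imp_compactin\<close>)
  moreover have "{\<rho> \<in> hom G Isom_group. dist (\<rho> g p) q < r} = ?W \<inter> hom G Isom_group"
    using assms by (auto simp: topspace_Isom_topology hom_def)
  ultimately show ?thesis unfolding Hom_topology_def openin_subtopology by blast
qed

text \<open>Finite sets are compact, so prescribing an action approximately at finitely many pairs
  is an open condition; these are the only neighbourhoods that will be used.\<close>

lemma openin_Hom_near:
  fixes \<rho> :: "'g \<Rightarrow> 'm::metric_space \<Rightarrow> 'm"
  assumes "finite T" "T \<subseteq> carrier G \<times> UNIV"
  shows "openin (Hom_topology G)
    {\<rho>' \<in> hom G Isom_group. \<forall>(g, p)\<in>T. dist (\<rho>' g p) (\<rho> g p) < r}"
  using assms
proof (induction T)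
  case empty
  \<comment> \<open>With empty K the subbasic set is the set of all continuous maps, which shows
    that all homomorphisms lie in the topological space.\<close>
  have "hom G Isom_group \<subseteq> {f. continuous_map (discrete_topology (carrier G))
      (Isom_topology :: ('m \<Rightarrow> 'm) topology) f \<and> f ` {} \<subseteq> {}}"
    by (auto simp: topspace_Isom_topology hom_def)
  also have "\<dots> \<subseteq> topspace
      (compact_open_topology (discrete_topology (carrier G)) Isom_topology)"
    unfolding compact_open_topology_def
    by (rule openin_subset, rule topology_generated_by_Basis, rule CollectI,
        rule exI[of _ "{}"], rule exI[of _ "{}"]) simp
  finally have "hom G Isom_group \<subseteq> topspace
      (compact_open_topology (discrete_topology (carrier G)) (Isom_topology :: ('m \<Rightarrow> 'm) topology))" .
  then have "topspace (Hom_topology G) = hom G (Isom_group :: ('m \<Rightarrow> 'm) monoid)"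
    by (auto simp: Hom_topology_def)
  then have "openin (Hom_topology G) (hom G (Isom_group :: ('m \<Rightarrow> 'm) monoid))"
    by (metis openin_topspace)
  then show ?case by simp
next
  case (insert a T)
  obtain g p where a: "a = (g, p)" by force
  have "{\<rho>' \<in> hom G Isom_group. \<forall>(g, p)\<in>insert a T. dist (\<rho>' g p) (\<rho> g p) < r}
    = {\<rho>' \<in> hom G Isom_group. dist (\<rho>' g p) (\<rho> g p) < r}
      \<inter> {\<rho>' \<in> hom G Isom_group. \<forall>(g, p)\<in>T. dist (\<rho>' g p) (\<rho> g p) < r}"
    by (auto simp: a)
  then show ?case using insert openin_Hom_ball[of g G p "\<rho> g p" r] by (auto simp: a)
qed

section \<open>Chains over a group\<close>

lemma frag_extend_frag_extend:
  "frag_extend f (frag_extend g c) = frag_extend (\<lambda>y. frag_extend f (g y)) c"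
  using subset_UNIV by (induction c rule: frag_induction) (auto simp: frag_extend_diff)

lemma free_module_iff: "c \<in> free_module G S \<longleftrightarrow> Poly_Mapping.keys c \<subseteq> carrier G \<times> S"
  by (simp add: free_module_def)

lemma free_module_zero [simp]: "0 \<in> free_module G S"
  by (simp add: free_module_iff)

lemma free_module_diff: "a \<in> free_module G S \<Longrightarrow> b \<in> free_module G S \<Longrightarrow> a - b \<in> free_module G S"
  unfolding free_module_iff using keys_diff[of a b] by blast

lemma free_module_add: "a \<in> free_module G S \<Longrightarrow> b \<in> free_module G S \<Longrightarrow> a + b \<in> free_module G S"
  unfolding free_module_iff using Poly_Mapping.keys_add[of a b] by blast

lemma free_module_sum: "(\<And>i. i \<in> I \<Longrightarrow> f i \<in> free_module G S) \<Longrightarrow> sum f I \<in> free_module G S"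
  by (induction I rule: infinite_finite_induct) (auto intro: free_module_add)

lemma free_module_mono: "S \<subseteq> T \<Longrightarrow> c \<in> free_module G S \<Longrightarrow> c \<in> free_module G T"
  by (auto simp: free_module_iff)

lemma free_module_frag_of [simp]: "frag_of y \<in> free_module G S \<longleftrightarrow> y \<in> carrier G \<times> S"
  by (simp add: free_module_iff)

lemma free_module_keys: "c \<in> free_module G S \<Longrightarrow> y \<in> Poly_Mapping.keys c \<Longrightarrow> y \<in> carrier G \<times> S"
  by (auto simp: free_module_iff)

lemma free_module_frag_extend:
  assumes "c \<in> free_module G S" "\<And>y. y \<in> carrier G \<times> S \<Longrightarrow> f y \<in> free_module G T"
  shows "frag_extend f c \<in> free_module G T"
  using assms keys_frag_extend[of f c] unfolding free_module_iff by fast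

lemma free_module_induct [consumes 1, case_names zero one diff]:
  assumes "c \<in> free_module G S" and "P 0" and "\<And>y. y \<in> carrier G \<times> S \<Longrightarrow> P (frag_of y)"
    and "\<And>a b. a \<in> free_module G S \<Longrightarrow> b \<in> free_module G S \<Longrightarrow> P a \<Longrightarrow> P b \<Longrightarrow> P (a - b)"
  shows "P c"
proof -
  have "c \<in> free_module G S \<and> P c"
    using assms(1)[unfolded free_module_iff]
    by (induction c rule: frag_induction) (use assms(2-) free_module_diff in auto)
  then show ?thesis ..
qed

lemma additive_on_zero:
  assumes "additive_on B f" "0 \<in> B"
  shows "f 0 = 0"
  using assms unfolding additive_on_def by (metis add_cancel_right_right)

lemma additive_on_diff:
  assumes "additive_on B f" "a \<in> B" "b \<in> B" "a - b \<in> B"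
  shows "f (a - b) = f a - f b"
proof -
  have "f (a - b) + f b = f (a - b + b)" using assms unfolding additive_on_def by metis
  then show ?thesis by (simp add: eq_diff_eq)
qed

lemma additive_on_frag_extend:
  assumes "additive_on (free_module G S) f" "c \<in> free_module G S"
  shows "f c = frag_extend (\<lambda>y. f (frag_of y)) c"
  using assms(2)
proof (induction c rule: free_module_induct)
  case zero
  then show ?case using additive_on_zero[OF assms(1)] by simp
next
  case (diff a b)
  then show ?case
    using additive_on_diff[OF assms(1) diff(1,2) free_module_diff[OF diff(1,2)]]
    by (simp add: frag_extend_diff)
qed simp

lemma funpow_frag_extend:
  fixes f :: "'y \<Rightarrow> 'y \<Rightarrow>\<^sub>0 int"
  shows "(frag_extend f ^^ N) c = frag_extend (\<lambda>y. (frag_extend f ^^ N) (frag_of y)) c"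
proof (induction N arbitrary: c)
  case 0
  show ?case by (simp add: frag_expansion[symmetric])
next
  case (Suc N)
  show ?case by (simp add: frag_extend_frag_extend Suc.IH[of c])
qed

section \<open>Heights of chains with respect to a weight on cells\<close>

text \<open>This stands for a valuation of at least \<open>s\<close>. The zero chain is high at
  every level, in accordance with its infinite valuation.\<close>

definition high :: "('y \<Rightarrow> real) \<Rightarrow> real \<Rightarrow> ('y \<Rightarrow>\<^sub>0 int) \<Rightarrow> bool" where
  "high w s c \<longleftrightarrow> (\<forall>y\<in>Poly_Mapping.keys c. s \<le> w y)"

lemma high_zero [simp]: "high w s 0"
  by (simp add: high_def)

lemma high_frag_of [simp]: "high w s (frag_of y) \<longleftrightarrow> s \<le> w y"
  by (simp add: high_def)

lemma high_mono: "high w s c \<Longrightarrow> t \<le> s \<Longrightarrow> high w t c"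
  by (force simp: high_def)

lemma high_diff: "high w s a \<Longrightarrow> high w s b \<Longrightarrow> high w s (a - b)"
  unfolding high_def using keys_diff[of a b] by blast

lemma high_add: "high w s a \<Longrightarrow> high w s b \<Longrightarrow> high w s (a + b)"
  unfolding high_def using Poly_Mapping.keys_add[of a b] by blast

lemma high_sum: "(\<And>i. i \<in> I \<Longrightarrow> high w s (f i)) \<Longrightarrow> high w s (sum f I)"
  by (induction I rule: infinite_finite_induct) (auto intro: high_add)

text \<open>The number \<delta> may be negative: positive values describe pushing maps, negative
  ones the loss of height under a homotopy.\<close>

lemma high_frag_extend:
  assumes "high w s c" "\<And>y. y \<in> Poly_Mapping.keys c \<Longrightarrow> high w (w y + \<delta>) (f y)"
  shows "high w (s + \<delta>) (frag_extend f c)"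
  unfolding high_def
proof
  fix y assume "y \<in> Poly_Mapping.keys (frag_extend f c)"
  then obtain x where x: "x \<in> Poly_Mapping.keys c" "y \<in> Poly_Mapping.keys (f x)"
    using keys_frag_extend[of f c] by blast
  then show "s + \<delta> \<le> w y" using assms unfolding high_def by fastforce
qed

lemma high_funpow:
  assumes "high w s c" "c \<in> free_module G S"
    and "\<And>y. y \<in> carrier G \<times> S \<Longrightarrow> f y \<in> free_module G S \<and> high w (w y + 1) (f y)"
  shows "(frag_extend f ^^ N) c \<in> free_module G S \<and> high w (s + real N) ((frag_extend f ^^ N) c)"
proof (induction N)
  case (Suc N)
  let ?z = "(frag_extend f ^^ N) c"
  have "high w (s + real N + 1) (frag_extend f ?z)"
    using Suc assms(3) by (intro high_frag_extend) (auto dest: free_module_keys)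
  moreover have "frag_extend f ?z \<in> free_module G S"
    using Suc assms(3) by (intro free_module_frag_extend) auto
  ultimately show ?case by (simp add: ac_simps)
qed (use assms in auto)

lemma high_exists: "\<exists>s. high w s c"
  by (rule exI[of _ "Min (insert 0 (w ` Poly_Mapping.keys c))"]) (auto simp: high_def)

section \<open>Maps with values in prescribed finite sets\<close>

text \<open>For finite \<open>C x\<close> this is finitariness, read off on a basis: the value at gx
  is a g-translate from a set that depends on x only. The map itself need not be
  equivariant.\<close>

definition value_map ::
  "('g, 'b) monoid_scheme \<Rightarrow> 'x set \<Rightarrow> ('x \<Rightarrow> ('g, 'x) chain set) \<Rightarrow> ('g \<times> 'x \<Rightarrow> ('g, 'x) chain) \<Rightarrow> bool" where
  "value_map G S C f \<longleftrightarrow> (\<forall>g\<in>carrier G. \<forall>x\<in>S. f (g, x) \<in> translate G g ` C x)"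

text \<open>Collecting the values over all maps at once allows later choices to be made before a
  particular map is given. The set is finite because only the cells in the support of
  \<open>z\<close> matter.\<close>

definition attainable ::
  "('g, 'b) monoid_scheme \<Rightarrow> 'x set \<Rightarrow> ('x \<Rightarrow> ('g, 'x) chain set) \<Rightarrow> ('g, 'x) chain \<Rightarrow> ('g, 'x) chain set" where
  "attainable G S C z = {frag_extend f z | f. value_map G S C f}"

lemma finite_attainable:
  assumes "z \<in> free_module G S" "\<And>x. x \<in> S \<Longrightarrow> finite (C x)"
  shows "finite (attainable G S C z)"
proof (rule finite_subset)
  let ?P = "PiE (Poly_Mapping.keys z) (\<lambda>(g, x). translate G g ` C x)"
  show "attainable G S C z \<subseteq> (\<lambda>f. frag_extend f z) ` ?P"
  proof
    fix u assume "u \<in> attainable G S C z"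
    then obtain f where f: "u = frag_extend f z" "value_map G S C f" unfolding attainable_def by blast
    have "restrict f (Poly_Mapping.keys z) \<in> ?P"
      using f(2) assms(1) by (fastforce simp: value_map_def free_module_iff)
    moreover have "u = frag_extend (restrict f (Poly_Mapping.keys z)) z"
      unfolding f(1) by (rule frag_extend_eq) simp
    ultimately show "u \<in> (\<lambda>f. frag_extend f z) ` ?P" by blast
  qed
  have "finite ?P"
    using assms by (intro finite_PiE) (auto simp: free_module_iff)
  then show "finite ((\<lambda>f. frag_extend f z) ` ?P)" by simp
qed

text \<open>Different maps may be used at successive steps. This contains the iterates of each
  single map and makes finiteness a direct induction.\<close>

primrec iterated_attainable ::
  "('g, 'b) monoid_scheme \<Rightarrow> 'x set \<Rightarrow> ('x \<Rightarrow> ('g, 'x) chain set) \<Rightarrow> nat \<Rightarrow> ('g, 'x) chain \<Rightarrow> ('g, 'x) chain set" where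
  "iterated_attainable G S C 0 z = {z}"
| "iterated_attainable G S C (Suc j) z = (\<Union>z'\<in>iterated_attainable G S C j z. attainable G S C z')"

lemma funpow_in_iterated_attainable:
  "value_map G S C f \<Longrightarrow> (frag_extend f ^^ j) z \<in> iterated_attainable G S C j z"
  by (induction j) (auto simp: attainable_def)

section \<open>Moving weights and maps by a group element\<close>

text \<open>For the heights with respect to a ray this gives the heights with respect to the ray
  moved by g^-1.\<close>

definition shift_weight :: "('g, 'b) monoid_scheme \<Rightarrow> 'g \<Rightarrow> ('g \<times> 'x \<Rightarrow> real) \<Rightarrow> 'g \<times> 'x \<Rightarrow> real" where
  "shift_weight G g w = (\<lambda>(h, x). w (g \<otimes>\<^bsub>G\<^esub> h, x))"

text \<open>The conjugate of \<open>f\<close> by \<open>g\<close>. It brings the behaviour of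
  \<open>f\<close> at the cell gx back to the cell x.\<close>

definition shift_map ::
  "('g, 'b) monoid_scheme \<Rightarrow> 'g \<Rightarrow> ('g \<times> 'x \<Rightarrow> ('g, 'x) chain) \<Rightarrow> 'g \<times> 'x \<Rightarrow> ('g, 'x) chain" where
  "shift_map G g f = (\<lambda>(h, x). translate G (inv\<^bsub>G\<^esub> g) (f (g \<otimes>\<^bsub>G\<^esub> h, x)))"

lemma translate_zero [simp]: "translate G g 0 = 0"
  by (simp add: translate_def)

lemma translate_frag_of [simp]: "translate G g (frag_of (h, x)) = frag_of (g \<otimes>\<^bsub>G\<^esub> h, x)"
  by (simp add: translate_def)

lemma translate_diff: "translate G g (a - b) = translate G g a - translate G g b"
  by (simp add: translate_def frag_extend_diff)

lemma keys_translate: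
  "Poly_Mapping.keys (translate G g c) \<subseteq> (\<lambda>(h, x). (g \<otimes>\<^bsub>G\<^esub> h, x)) ` Poly_Mapping.keys c"
  unfolding translate_def using keys_frag_extend[of _ c] by (force split: prod.splits)

lemma high_translate:
  assumes "high (shift_weight G g w) s c"
  shows "high w s (translate G g c)"
  unfolding high_def
proof
  fix y assume "y \<in> Poly_Mapping.keys (translate G g c)"
  then obtain h x where "(h, x) \<in> Poly_Mapping.keys c" "y = (g \<otimes>\<^bsub>G\<^esub> h, x)"
    using keys_translate[of G g c] by fast
  then show "s \<le> w y" using assms by (force simp: high_def shift_weight_def)
qed

context group
begin

lemma translate_in_free_module:
  "g \<in> carrier G \<Longrightarrow> c \<in> free_module G S \<Longrightarrow> translate G g c \<in> free_module G S"
  unfolding translate_def by (rule free_module_frag_extend) auto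

lemma translate_mult:
  assumes "g \<in> carrier G" "h \<in> carrier G" "c \<in> free_module G S"
  shows "translate G (g \<otimes> h) c = translate G g (translate G h c)"
  using assms(3)
  by (induction c rule: free_module_induct) (use assms in \<open>auto simp: translate_diff m_assoc\<close>)

lemma translate_one: "c \<in> free_module G S \<Longrightarrow> translate G \<one> c = c"
  by (induction c rule: free_module_induct) (auto simp: translate_diff)

lemma translate_inv:
  assumes "g \<in> carrier G" "c \<in> free_module G S"
  shows "translate G g (translate G (inv g) c) = c" "translate G (inv g) (translate G g c) = c"
  using assms by (simp_all add: translate_mult[symmetric] translate_one)

lemma translate_frag_extend:
  "translate G g (frag_extend f c) = frag_extend (\<lambda>y. translate G g (f y)) c"
  by (simp add: translate_def frag_extend_frag_extend)

lemma frag_extend_shift_map: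
  "frag_extend (shift_map G g f) c = translate G (inv g) (frag_extend f (translate G g c))"
  by (simp add: translate_frag_extend translate_def[of G g] shift_map_def frag_extend_frag_extend
      case_prod_unfold)

lemma funpow_shift_map:
  assumes g: "g \<in> carrier G" and c: "c \<in> free_module G S"
    and f: "\<And>y. y \<in> carrier G \<times> S \<Longrightarrow> f y \<in> free_module G S"
  shows "(frag_extend (shift_map G g f) ^^ N) c
    = translate G (inv g) ((frag_extend f ^^ N) (translate G g c))"
proof (induction N)
  case 0
  then show ?case using g c by (simp add: translate_inv)
next
  case (Suc N)
  have "(frag_extend f ^^ N) (translate G g c) \<in> free_module G S" for N
    by (induction N) (use g c f in \<open>auto intro: translate_in_free_module free_module_frag_extend\<close>)
  then have "translate G g (translate G (inv g) ((frag_extend f ^^ N) (translate G g c)))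
      = (frag_extend f ^^ N) (translate G g c)"
    using g translate_inv(1) by blast
  moreover have "(frag_extend (shift_map G g f) ^^ Suc N) c
      = frag_extend (shift_map G g f) ((frag_extend (shift_map G g f) ^^ N) c)" by simp
  ultimately show ?case unfolding Suc frag_extend_shift_map by simp
qed

text \<open>The sets \<open>C x\<close> do not depend on the group element, and g^-1 undoes the
  additional translation by g; so a conjugate map takes its values in the same sets.\<close>

lemma value_map_shift:
  assumes "value_map G S C f" "g \<in> carrier G" "\<And>x. x \<in> S \<Longrightarrow> C x \<subseteq> free_module G T"
  shows "value_map G S C (shift_map G g f)"
  unfolding value_map_def
proof (intro ballI)
  fix h x assume hx: "h \<in> carrier G" "x \<in> S"
  then obtain c where c: "c \<in> C x" "f (g \<otimes> h, x) = translate G (g \<otimes> h) c"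
    using assms(1,2) unfolding value_map_def by blast
  then have "shift_map G g f (h, x) = translate G h c"
    using hx assms(2) assms(3)[of x]
    by (auto simp: shift_map_def translate_mult[symmetric] m_assoc[symmetric])
  then show "shift_map G g f (h, x) \<in> translate G h ` C x" using c by blast
qed

lemma value_map_in_free_module:
  assumes "value_map G S C f" "y \<in> carrier G \<times> S" "\<And>x. x \<in> S \<Longrightarrow> C x \<subseteq> free_module G T"
  shows "f y \<in> free_module G T"
  using assms unfolding value_map_def by (force intro: translate_in_free_module)

lemma iterated_attainable_in_free_module:
  assumes "z \<in> free_module G S" "\<And>x. x \<in> S \<Longrightarrow> C x \<subseteq> free_module G S"
  shows "iterated_attainable G S C j z \<subseteq> free_module G S"
proof (induction j)
  case (Suc j)
  have "attainable G S C z' \<subseteq> free_module G S" if "z' \<in> free_module G S" for z'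
  proof
    fix u assume "u \<in> attainable G S C z'"
    then obtain f where f: "u = frag_extend f z'" "value_map G S C f" unfolding attainable_def by blast
    show "u \<in> free_module G S"
      unfolding f(1)
      by (rule free_module_frag_extend[OF that value_map_in_free_module[OF f(2)]]) (use assms(2) in auto)
  qed
  then show ?case using Suc by auto
qed (use assms in auto)

lemma finite_iterated_attainable:
  assumes "z \<in> free_module G S" "\<And>x. x \<in> S \<Longrightarrow> finite (C x)" "\<And>x. x \<in> S \<Longrightarrow> C x \<subseteq> free_module G S"
  shows "finite (iterated_attainable G S C j z)"
proof (induction j)
  case (Suc j)
  have "iterated_attainable G S C j z \<subseteq> free_module G S"
    by (intro iterated_attainable_in_free_module assms)
  moreover have "finite (attainable G S C z')" if "z' \<in> free_module G S" for z'
    using that assms(2) by (rule finite_attainable)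
  ultimately show ?case using Suc by auto
qed simp

end

section \<open>Chain maps and homotopies\<close>

locale based_resolution = group G
  for G (structure) +
  fixes act :: "'g \<Rightarrow> 'a::ab_group_add \<Rightarrow> 'a"
    and F :: "('g, 'x, 'a) resolution"
  assumes resolution: "based_free_resolution G act F"
begin

abbreviation "Ch \<equiv> chains_deg G F"
abbreviation "Tot \<equiv> all_chains G F"

text \<open>The bound is strict, so that inductions start from an empty basis; the n-skeleton is the
  case \<open>Suc n\<close>.\<close>

definition below :: "nat \<Rightarrow> 'x set" where
  "below m = (\<Union>k<m. gens F k)"

lemma Ch_subset_Tot: "Ch k \<subseteq> Tot"
  by (auto simp: chains_deg_def all_chains_def intro: free_module_mono)

lemma Ch_subset_below: "k < m \<Longrightarrow> Ch k \<subseteq> free_module G (below m)"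
  unfolding chains_deg_def below_def by (auto intro!: free_module_mono[of "gens F k"])

lemma below_subset_Tot: "free_module G (below m) \<subseteq> Tot"
  by (auto simp: below_def all_chains_def intro!: free_module_mono[of "\<Union>k<m. gens F k"])

lemma skeleton_eq: "skeleton G F n = free_module G (below (Suc n))"
  by (simp add: skeleton_def below_def lessThan_Suc_atMost)

lemma gens_not_below: "x \<in> gens F m \<Longrightarrow> x \<notin> below m"
proof
  assume x: "x \<in> gens F m" "x \<in> below m"
  then obtain k where k: "k < m" "x \<in> gens F k" by (auto simp: below_def)
  have "disjoint_family (gens F)" using resolution by (simp add: based_free_resolution_def)
  then have "gens F k \<inter> gens F m = {}" using k(1) by (auto simp: disjoint_family_on_def)
  then show False using x k by blast
qed

lemma below_mono: "j \<le> m \<Longrightarrow> below j \<subseteq> below m"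
  unfolding below_def by (intro UN_mono) auto

lemma below_Suc: "below (Suc m) = below m \<union> gens F m"
  by (auto simp: below_def less_Suc_eq)

lemma bd_additive: "additive_on Tot (bd F)"
  and bd_equivariant: "g \<in> carrier G \<Longrightarrow> c \<in> Tot \<Longrightarrow> bd F (translate G g c) = translate G g (bd F c)"
  and bd_Ch_0: "c \<in> Ch 0 \<Longrightarrow> bd F c = 0"
  and aug_additive: "additive_on (Ch 0) (aug F)"
  and aug_equivariant: "g \<in> carrier G \<Longrightarrow> c \<in> Ch 0 \<Longrightarrow> aug F (translate G g c) = act g (aug F c)"
  and aug_surj: "aug F ` Ch 0 = UNIV"
  and bd_image: "bd F ` Ch (Suc k) = cycles G F k"
  using resolution by (simp_all add: based_free_resolution_def equivariant_on_def)

lemma bd_in_cycles: "c \<in> Ch (Suc k) \<Longrightarrow> bd F c \<in> cycles G F k"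
  using bd_image by blast

lemma cycles_Ch: "z \<in> cycles G F k \<Longrightarrow> z \<in> Ch k"
  by (simp add: cycles_def)

lemma bd_cycle: "z \<in> cycles G F k \<Longrightarrow> bd F z = 0"
  by (cases "k = 0") (auto simp: cycles_def bd_Ch_0)

lemma cycleI: "z \<in> Ch k \<Longrightarrow> bd F z = 0 \<Longrightarrow> (k = 0 \<Longrightarrow> aug F z = 0) \<Longrightarrow> z \<in> cycles G F k"
  by (auto simp: cycles_def)

lemma bd_below:
  assumes "c \<in> Ch k"
  shows "bd F c \<in> free_module G (below k)"
proof (cases k)
  case 0
  then show ?thesis using assms bd_Ch_0 by simp
next
  case (Suc i)
  then show ?thesis using assms bd_in_cycles cycles_Ch Ch_subset_below[of i k] by blast
qed

lemma Ch_frag_of: "y \<in> carrier G \<times> gens F k \<Longrightarrow> frag_of y \<in> Ch k"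
  by (simp add: chains_deg_def)

lemma Ch_diff: "a \<in> Ch k \<Longrightarrow> b \<in> Ch k \<Longrightarrow> a - b \<in> Ch k"
  by (simp add: chains_deg_def free_module_diff)

lemma Ch_add: "a \<in> Ch k \<Longrightarrow> b \<in> Ch k \<Longrightarrow> a + b \<in> Ch k"
  by (simp add: chains_deg_def free_module_add)

lemma Tot_diff: "a \<in> Tot \<Longrightarrow> b \<in> Tot \<Longrightarrow> a - b \<in> Tot"
  by (simp add: all_chains_def free_module_diff)

lemma bd_diff: "a \<in> Tot \<Longrightarrow> b \<in> Tot \<Longrightarrow> bd F (a - b) = bd F a - bd F b"
  by (rule additive_on_diff[OF bd_additive _ _ Tot_diff])

lemma bd_add: "a \<in> Tot \<Longrightarrow> b \<in> Tot \<Longrightarrow> bd F (a + b) = bd F a + bd F b"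
  using bd_additive by (simp add: additive_on_def)

lemma bd_zero [simp]: "bd F 0 = 0"
  by (rule additive_on_zero[OF bd_additive]) (simp add: all_chains_def)

lemma bd_sum: "(\<And>i. i \<in> I \<Longrightarrow> f i \<in> Tot) \<Longrightarrow> bd F (sum f I) = (\<Sum>i\<in>I. bd F (f i))"
proof (induction I rule: infinite_finite_induct)
  case (insert x I)
  then have "sum f I \<in> Tot" unfolding all_chains_def by (intro free_module_sum) auto
  then show ?case using insert by (simp add: bd_add)
qed auto

lemma aug_diff: "a \<in> Ch 0 \<Longrightarrow> b \<in> Ch 0 \<Longrightarrow> aug F (a - b) = aug F a - aug F b"
  by (rule additive_on_diff[OF aug_additive _ _ Ch_diff])

lemma translate_Ch: "g \<in> carrier G \<Longrightarrow> c \<in> Ch k \<Longrightarrow> translate G g c \<in> Ch k"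
  unfolding chains_deg_def by (rule translate_in_free_module)

lemma bd_frag_extend:
  assumes "c \<in> free_module G S" "\<And>y. y \<in> carrier G \<times> S \<Longrightarrow> f y \<in> Tot"
  shows "bd F (frag_extend f c) = frag_extend (\<lambda>y. bd F (f y)) c"
  using assms(1)
proof (induction c rule: free_module_induct)
  case (diff a b)
  have "frag_extend f c \<in> Tot" if "c \<in> free_module G S" for c
    using free_module_frag_extend[OF that] assms(2) unfolding all_chains_def by blast
  then show ?case using diff by (simp add: frag_extend_diff bd_diff)
qed auto

lemma bd_expansion: "c \<in> Tot \<Longrightarrow> bd F c = frag_extend (\<lambda>y. bd F (frag_of y)) c"
  unfolding all_chains_def by (rule additive_on_frag_extend[OF bd_additive[unfolded all_chains_def]])

definition chain_map_below :: "nat \<Rightarrow> ('g \<times> 'x \<Rightarrow> ('g, 'x) chain) \<Rightarrow> bool" where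
  "chain_map_below m f \<longleftrightarrow> (\<forall>j<m. \<forall>y\<in>carrier G \<times> gens F j. f y \<in> Ch j \<and>
     bd F (f y) = frag_extend f (bd F (frag_of y)) \<and>
     (j = 0 \<longrightarrow> aug F (f y) = aug F (frag_of y)))"

lemma chain_map_below_mono: "chain_map_below m f \<Longrightarrow> k \<le> m \<Longrightarrow> chain_map_below k f"
  unfolding chain_map_below_def by (meson less_le_trans)

text \<open>The homotopy runs from the identity to \<open>f\<close>. On a cycle the term with the
  boundary vanishes, and the boundaries of its values on successive iterates of a cycle form a
  telescoping sum.\<close>

definition homotopy_below ::
  "nat \<Rightarrow> ('g \<times> 'x \<Rightarrow> ('g, 'x) chain) \<Rightarrow> ('g \<times> 'x \<Rightarrow> ('g, 'x) chain) \<Rightarrow> bool" where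
  "homotopy_below m f e \<longleftrightarrow> (\<forall>j<m. \<forall>y\<in>carrier G \<times> gens F j. e y \<in> Ch (Suc j) \<and>
     bd F (e y) = f y - frag_of y - frag_extend e (bd F (frag_of y)))"

lemma chain_map_below_chain:
  assumes f: "chain_map_below m f" and j: "j < m" and c: "c \<in> Ch j"
  shows "frag_extend f c \<in> Ch j" "bd F (frag_extend f c) = frag_extend f (bd F c)"
    "j = 0 \<Longrightarrow> aug F (frag_extend f c) = aug F c"
proof -
  have f': "\<And>y. y \<in> carrier G \<times> gens F j \<Longrightarrow> f y \<in> Ch j \<and> bd F (f y) = frag_extend f (bd F (frag_of y))"
    using f j unfolding chain_map_below_def by blast
  have *: "frag_extend f c \<in> Ch j" if "c \<in> Ch j" for c
    using that f' unfolding chains_deg_def by (blast intro: free_module_frag_extend)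
  then show "frag_extend f c \<in> Ch j" using c .
  have "bd F (frag_extend f c) = frag_extend (\<lambda>y. bd F (f y)) c"
    using c f' Ch_subset_Tot unfolding chains_deg_def by (intro bd_frag_extend) auto
  also have "\<dots> = frag_extend (\<lambda>y. frag_extend f (bd F (frag_of y))) c"
    using c f' unfolding chains_deg_def by (intro frag_extend_eq) (auto dest: free_module_keys)
  also have "\<dots> = frag_extend f (bd F c)"
    using bd_expansion[of c] c Ch_subset_Tot by (metis frag_extend_frag_extend subsetD)
  finally show "bd F (frag_extend f c) = frag_extend f (bd F c)" .
  show "aug F (frag_extend f c) = aug F c" if "j = 0"
    using c unfolding chains_deg_def
  proof (induction c rule: free_module_induct)
    case (one y)
    then show ?case using f j that by (auto simp: chain_map_below_def)
  next
    case (diff a b)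
    then show ?case using * that by (simp add: frag_extend_diff aug_diff chains_deg_def)
  qed auto
qed

lemma chain_map_below_funpow:
  assumes f: "chain_map_below m f" and j: "j < m" and c: "c \<in> Ch j"
  shows "(frag_extend f ^^ N) c \<in> Ch j \<and> bd F ((frag_extend f ^^ N) c) = (frag_extend f ^^ N) (bd F c)
    \<and> (j = 0 \<longrightarrow> aug F ((frag_extend f ^^ N) c) = aug F c)"
  by (induction N) (use c chain_map_below_chain[OF f j] in auto)

lemma homotopy_below_chain:
  assumes e: "homotopy_below m f e" and j: "j < m" and c: "c \<in> Ch j"
  shows "frag_extend e c \<in> Ch (Suc j)"
    "bd F (frag_extend e c) = frag_extend f c - c - frag_extend e (bd F c)"
proof -
  have e': "\<And>y. y \<in> carrier G \<times> gens F j \<Longrightarrow> e y \<in> Ch (Suc j)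
      \<and> bd F (e y) = f y - frag_of y - frag_extend e (bd F (frag_of y))"
    using e j unfolding homotopy_below_def by blast
  have *: "frag_extend e c \<in> Ch (Suc j)" if "c \<in> Ch j" for c
    using that e' unfolding chains_deg_def by (blast intro: free_module_frag_extend)
  then show "frag_extend e c \<in> Ch (Suc j)" using c .
  show "bd F (frag_extend e c) = frag_extend f c - c - frag_extend e (bd F c)"
    using c unfolding chains_deg_def
  proof (induction c rule: free_module_induct)
    case (diff a b)
    then have "a \<in> Ch j" "b \<in> Ch j" by (simp_all add: chains_deg_def)
    then show ?case
      using diff *[of a] *[of b] Ch_subset_Tot by (auto simp: frag_extend_diff bd_diff subset_iff)
  qed (use e' in auto)
qed

lemma value_map_below_shift:
  assumes "value_map G (below m) C f" "g \<in> carrier G" "\<And>x. x \<in> below m \<Longrightarrow> C x \<subseteq> Tot"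
  shows "value_map G (below m) C (shift_map G g f)"
  using assms unfolding all_chains_def by (rule value_map_shift)

lemma chain_map_below_shift:
  assumes f: "chain_map_below m f" and g: "g \<in> carrier G"
  shows "chain_map_below m (shift_map G g f)"
  unfolding chain_map_below_def
proof (intro allI impI ballI)
  fix j y assume j: "j < m" and y: "y \<in> carrier G \<times> gens F j"
  obtain h x where y': "y = (h, x)" "h \<in> carrier G" "x \<in> gens F j" using y by blast
  have fy: "f (g \<otimes> h, x) \<in> Ch j" "bd F (f (g \<otimes> h, x)) = frag_extend f (bd F (frag_of (g \<otimes> h, x)))"
    "j = 0 \<Longrightarrow> aug F (f (g \<otimes> h, x)) = aug F (frag_of (g \<otimes> h, x))"
    using f j g y' unfolding chain_map_below_def by auto
  have yA: "frag_of y \<in> Ch j" using y by (rule Ch_frag_of)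
  have tr: "frag_of (g \<otimes> h, x) = translate G g (frag_of y)" by (simp add: y')
  have bdt: "bd F (translate G g (frag_of y)) = translate G g (bd F (frag_of y))"
    using g yA Ch_subset_Tot by (blast intro: bd_equivariant)
  have "translate G (inv g) (translate G g (frag_of y)) = frag_of y"
    using yA g translate_inv(2) unfolding chains_deg_def by blast
  then have "aug F (frag_of y) = act (inv g) (aug F (translate G g (frag_of y)))" if "j = 0"
    using aug_equivariant[of "inv g" "translate G g (frag_of y)"] g yA translate_Ch[of g "frag_of y" j] that by simp
  then have "j = 0 \<Longrightarrow> aug F (shift_map G g f y) = aug F (frag_of y)"
    using fy g by (simp add: shift_map_def y' aug_equivariant)
  moreover have "shift_map G g f y \<in> Ch j" using fy g by (simp add: shift_map_def y' translate_Ch)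
  moreover have "bd F (shift_map G g f y) = frag_extend (shift_map G g f) (bd F (frag_of y))"
  proof -
    have "bd F (shift_map G g f y) = translate G (inv g) (bd F (f (g \<otimes> h, x)))"
      using bd_equivariant[of "inv g" "f (g \<otimes> h, x)"] g fy Ch_subset_Tot[of j]
      by (auto simp: shift_map_def y')
    then show ?thesis unfolding fy(2) tr bdt frag_extend_shift_map .
  qed
  ultimately show "shift_map G g f y \<in> Ch j \<and>
      bd F (shift_map G g f y) = frag_extend (shift_map G g f) (bd F (frag_of y)) \<and>
      (j = 0 \<longrightarrow> aug F (shift_map G g f y) = aug F (frag_of y))" by blast
qed

text \<open>Conjugation fixes the identity, so the conjugate homotopy again starts there and ends at
  the conjugate chain map.\<close>

lemma homotopy_below_shift:
  assumes e: "homotopy_below m f e" and f: "chain_map_below m f" and g: "g \<in> carrier G"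
  shows "homotopy_below m (shift_map G g f) (shift_map G g e)"
  unfolding homotopy_below_def
proof (intro allI impI ballI)
  fix j y assume j: "j < m" and y: "y \<in> carrier G \<times> gens F j"
  obtain h x where y': "y = (h, x)" "h \<in> carrier G" "x \<in> gens F j" using y by blast
  have ey: "e (g \<otimes> h, x) \<in> Ch (Suc j)"
    "bd F (e (g \<otimes> h, x)) = f (g \<otimes> h, x) - frag_of (g \<otimes> h, x) - frag_extend e (bd F (frag_of (g \<otimes> h, x)))"
    using e j g y' unfolding homotopy_below_def by auto
  have yA: "frag_of y \<in> Ch j" using y by (rule Ch_frag_of)
  have tr: "frag_of (g \<otimes> h, x) = translate G g (frag_of y)" by (simp add: y')
  have bdt: "bd F (translate G g (frag_of y)) = translate G g (bd F (frag_of y))"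
    using g yA Ch_subset_Tot by (blast intro: bd_equivariant)
  have inv: "translate G (inv g) (translate G g (frag_of y)) = frag_of y"
    using yA g translate_inv(2) unfolding chains_deg_def by blast
  have "bd F (shift_map G g e y) = translate G (inv g) (bd F (e (g \<otimes> h, x)))"
    using bd_equivariant[of "inv g" "e (g \<otimes> h, x)"] g ey Ch_subset_Tot[of "Suc j"]
    by (auto simp: shift_map_def y')
  also have "\<dots> = shift_map G g f y - frag_of y - frag_extend (shift_map G g e) (bd F (frag_of y))"
    unfolding ey(2) translate_diff tr inv bdt frag_extend_shift_map by (simp add: shift_map_def y')
  finally show "shift_map G g e y \<in> Ch (Suc j) \<and> bd F (shift_map G g e y)
      = shift_map G g f y - frag_of y - frag_extend (shift_map G g e) (bd F (frag_of y))"
    using ey g by (simp add: shift_map_def y' translate_Ch)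
qed

text \<open>The usual obstruction to extending a homotopy by one degree: its boundary cancels by the
  homotopy formula for the boundary of the cell. In degree 0 the cycle condition is that
  \<open>f\<close> respects the augmentation.\<close>

lemma homotopy_obstruction:
  assumes f: "chain_map_below (Suc m) f" and e: "homotopy_below m f e"
    and y: "y \<in> carrier G \<times> gens F m"
  shows "f y - frag_of y - frag_extend e (bd F (frag_of y)) \<in> cycles G F m"
proof (cases m)
  case 0
  have "f y \<in> Ch 0" "aug F (f y) = aug F (frag_of y)" "frag_of y \<in> Ch 0"
    using f y 0 Ch_frag_of unfolding chain_map_below_def by blast+
  then show ?thesis using 0 by (intro cycleI) (auto simp: bd_Ch_0 aug_diff Ch_diff)
next
  case (Suc i)
  let ?b = "bd F (frag_of y)"
  have yA: "frag_of y \<in> Ch m" using y by (rule Ch_frag_of)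
  then have b: "?b \<in> cycles G F i" using bd_in_cycles Suc by simp
  have fy: "f y \<in> Ch m" "bd F (f y) = frag_extend f ?b"
    using f y unfolding chain_map_below_def by blast+
  have eb: "frag_extend e ?b \<in> Ch m" "bd F (frag_extend e ?b) = frag_extend f ?b - ?b"
    using homotopy_below_chain[OF e, of i ?b] b Suc by (auto simp: cycles_Ch bd_cycle)
  have "f y \<in> Tot" "frag_of y \<in> Tot" "frag_extend e ?b \<in> Tot"
    using fy yA eb Ch_subset_Tot by blast+
  then have "bd F (f y - frag_of y - frag_extend e ?b) = 0"
    using fy eb by (simp add: bd_diff Tot_diff)
  then show ?thesis using fy yA eb Suc by (intro cycleI) (auto intro: Ch_diff)
qed

text \<open>The choices for a homotopy in degree \<open>m\<close> are made at the basis elements and transported by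
  the group; a basis element sees only finitely many possible cycles to be filled.\<close>

lemma homotopy_exists:
  assumes C: "\<And>x. x \<in> below m \<Longrightarrow> finite (C x) \<and> C x \<subseteq> Tot"
  shows "\<exists>D. (\<forall>x\<in>below m. finite (D x) \<and> D x \<subseteq> Tot) \<and>
    (\<forall>f. value_map G (below m) C f \<and> chain_map_below m f \<longrightarrow>
      (\<exists>e. value_map G (below m) D e \<and> homotopy_below m f e))"
  using C
proof (induction m)
  case 0
  show ?case by (auto simp: below_def value_map_def homotopy_below_def)
next
  case (Suc m)
  then obtain D where D: "\<And>x. x \<in> below m \<Longrightarrow> finite (D x) \<and> D x \<subseteq> Tot"
    and De: "\<And>f. value_map G (below m) C f \<Longrightarrow> chain_map_below m f \<Longrightarrow>
      \<exists>e. value_map G (below m) D e \<and> homotopy_below m f e"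
    unfolding below_Suc by (metis Un_iff)
  \<comment> \<open>The filling depends on the cycle alone, not on the map \<open>f\<close>;
    therefore the sets \<open>D' x\<close> serve all maps simultaneously.\<close>
  define fill where "fill u = (SOME c. c \<in> Ch (Suc m) \<and> bd F c = u)" for u
  have fill: "fill u \<in> Ch (Suc m)" "bd F (fill u) = u" if "u \<in> cycles G F m" for u
  proof -
    have "\<exists>c. c \<in> Ch (Suc m) \<and> bd F c = u" using that unfolding bd_image[symmetric] by blast
    from someI_ex[OF this] show "fill u \<in> Ch (Suc m)" "bd F (fill u) = u"
      unfolding fill_def by auto
  qed
  \<comment> \<open>All cycles that can arise as obstruction at the basis cell x, for any admissible
    map and any homotopy already chosen below degree m.\<close>
  define U where "U x = (\<lambda>(c, b). c - frag_of (\<one>, x) - b) `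
      (C x \<times> attainable G (below m) D (bd F (frag_of (\<one>, x)))) \<inter> cycles G F m" for x
  define D' where "D' x = (if x \<in> below m then D x else fill ` U x)" for x
  have finU: "finite (U x)" if "x \<in> gens F m" for x
    unfolding U_def using Suc.prems[of x] that D bd_below[OF Ch_frag_of, of "(\<one>, x)" m]
    by (auto simp: below_Suc intro!: finite_attainable)
  show ?case
  proof (intro exI[of _ D'] conjI ballI allI impI)
    fix x assume x: "x \<in> below (Suc m)"
    show "finite (D' x)" using x finU D by (auto simp: D'_def below_Suc)
    have "fill ` U x \<subseteq> Tot" using fill(1) Ch_subset_Tot by (auto simp: U_def)
    then show "D' x \<subseteq> Tot" using x D by (auto simp: D'_def)
  next
    fix f assume f: "value_map G (below (Suc m)) C f \<and> chain_map_below (Suc m) f"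
    have fm: "value_map G (below m) C f" "chain_map_below m f"
      using f chain_map_below_mono[of "Suc m" f m] by (auto simp: value_map_def below_Suc)
    then obtain e where e: "value_map G (below m) D e" "homotopy_below m f e" using De by blast
    \<comment> \<open>The obstruction at gx, brought back to x.\<close>
    define u where "u g x = translate G (inv g)
        (f (g, x) - frag_of (g, x) - frag_extend e (bd F (frag_of (g, x))))" for g x
    define e' where "e' y = (if snd y \<in> below m then e y
        else translate G (fst y) (fill (u (fst y) (snd y))))" for y
    have u: "u g x \<in> U x" and gu: "translate G g (u g x)
        = f (g, x) - frag_of (g, x) - frag_extend e (bd F (frag_of (g, x)))"
      if g: "g \<in> carrier G" and x: "x \<in> gens F m" for g x
    proof -
      let ?b = "bd F (frag_of (\<one>, x))"
      have xA: "frag_of (\<one>, x) \<in> Ch m" using x by (intro Ch_frag_of) auto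
      have gx: "translate G g (frag_of (\<one>, x)) = frag_of (g, x)" using g by simp
      have bg: "bd F (frag_of (g, x)) = translate G g ?b"
        using bd_equivariant[OF g, of "frag_of (\<one>, x)"] xA Ch_subset_Tot gx by auto
      have cyc: "f (g, x) - frag_of (g, x) - frag_extend e (bd F (frag_of (g, x))) \<in> cycles G F m"
        using homotopy_obstruction[of m f e "(g, x)"] f e g x by simp
      \<comment> \<open>The obstruction brought back to x is the obstruction of the conjugate data
        at x. These satisfy the same conditions, so it lies in \<open>U x\<close>.\<close>
      have shift: "value_map G (below (Suc m)) C (shift_map G g f)" "value_map G (below m) D (shift_map G g e)"
        "chain_map_below (Suc m) (shift_map G g f)" "homotopy_below m (shift_map G g f) (shift_map G g e)"
        by (rule value_map_below_shift chain_map_below_shift homotopy_below_shift;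
            use f fm e g Suc.prems D in auto)+
      have "u g x = shift_map G g f (\<one>, x) - frag_of (\<one>, x) - frag_extend (shift_map G g e) ?b"
        using g translate_inv(2)[OF g, of "frag_of (\<one>, x)" UNIV]
        by (simp add: u_def translate_diff frag_extend_shift_map bg shift_map_def[of G g f])
      moreover have "shift_map G g f (\<one>, x) \<in> translate G \<one> ` C x"
        using shift(1) x unfolding value_map_def by (auto simp: below_Suc)
      then have "shift_map G g f (\<one>, x) \<in> C x"
        using translate_one Suc.prems[of x] x unfolding all_chains_def below_Suc by fastforce
      moreover have "frag_extend (shift_map G g e) ?b \<in> attainable G (below m) D ?b"
        using shift(2) unfolding attainable_def by blast
      moreover have "u g x \<in> cycles G F m"
        using homotopy_obstruction[OF shift(3,4), of "(\<one>, x)"] x calculation(1) by simp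
      ultimately show "u g x \<in> U x" unfolding U_def by force
      show "translate G g (u g x) = f (g, x) - frag_of (g, x) - frag_extend e (bd F (frag_of (g, x)))"
        unfolding u_def using translate_inv(1)[OF g] cycles_Ch[OF cyc] unfolding chains_deg_def by blast
    qed
    \<comment> \<open>The boundary of a cell of degree m involves lower cells only, where the old
      and the new homotopy agree.\<close>
    have ext: "frag_extend e' c = frag_extend e c" if "c \<in> free_module G (below m)" for c
      using that by (intro frag_extend_eq) (auto simp: e'_def free_module_iff)
    have "value_map G (below (Suc m)) D' e'"
      unfolding value_map_def
    proof (intro ballI)
      fix g x assume g: "g \<in> carrier G" and x: "x \<in> below (Suc m)"
      show "e' (g, x) \<in> translate G g ` D' x"
      proof (cases "x \<in> below m")
        case True
        then show ?thesis using e(1) g by (auto simp: e'_def D'_def value_map_def)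
      next
        case False
        then show ?thesis using u[OF g, of x] x by (auto simp: e'_def D'_def below_Suc)
      qed
    qed
    moreover have "homotopy_below (Suc m) f e'"
      unfolding homotopy_below_def
    proof (intro allI impI ballI)
      fix j y assume j: "j < Suc m" and y: "y \<in> carrier G \<times> gens F j"
      obtain g x where y': "y = (g, x)" "g \<in> carrier G" "x \<in> gens F j" using y by blast
      have "below j \<subseteq> below m" using j by (simp add: below_mono)
      then have eb: "frag_extend e' (bd F (frag_of y)) = frag_extend e (bd F (frag_of y))"
        using bd_below[OF Ch_frag_of[OF y]] free_module_mono ext by blast
      show "e' y \<in> Ch (Suc j) \<and> bd F (e' y) = f y - frag_of y - frag_extend e' (bd F (frag_of y))"
      proof (cases "j < m")
        case True
        then have "x \<in> below m" using y' by (auto simp: below_def)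
        then have "e' y = e y" by (simp add: e'_def y')
        then show ?thesis using e(2) True y eb unfolding homotopy_below_def by metis
      next
        case False
        then have jm: "j = m" using j by simp
        then have "x \<notin> below m" using gens_not_below y' by blast
        then have e'y: "e' y = translate G g (fill (u g x))" by (simp add: e'_def y')
        have "u g x \<in> U x" using u y' jm by blast
        then have f': "fill (u g x) \<in> Ch (Suc m)" "bd F (fill (u g x)) = u g x"
          using fill by (auto simp: U_def)
        then have "bd F (e' y) = translate G g (u g x)"
          unfolding e'y using bd_equivariant[OF y'(2)] Ch_subset_Tot by force
        then show ?thesis using gu[of g x] y' jm f' eb e'y by (auto simp: translate_Ch)
      qed
    qed
    ultimately show "\<exists>e. value_map G (below (Suc m)) D' e \<and> homotopy_below (Suc m) f e" by blast
  qed
qed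

end

section \<open>Uniform pushing\<close>

lemma filterlim_at_top_exists_ge:
  fixes f :: "real \<Rightarrow> real"
  assumes "filterlim f at_top at_top"
  shows "\<exists>s. t \<le> f s"
proof -
  have "\<forall>\<^sub>F s in at_top. t \<le> f s" using assms by (simp add: filterlim_at_top)
  then show ?thesis using eventually_happens trivial_limit_at_top_linorder by blast
qed

text \<open>The weights of \<open>V0\<close> are the heights of the cells with respect to the rays, for the given
  action. The members of \<open>nb\<close> are the families of heights for all the actions in a
  neighbourhood of the given one.\<close>

locale weighted_resolution = based_resolution G act F
  for G (structure) and act :: "'g \<Rightarrow> 'a::ab_group_add \<Rightarrow> 'a" and F :: "('g, 'x, 'a) resolution" +
  fixes n :: nat
    and V0 :: "('g \<times> 'x \<Rightarrow> real) set"
    and nb :: "('g \<times> 'x \<Rightarrow> real) set set"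
  assumes finite_gens: "k \<le> n \<Longrightarrow> finite (gens F k)"
    and nb_shift: "\<V> \<in> nb \<Longrightarrow> w \<in> \<V> \<Longrightarrow> g \<in> carrier G \<Longrightarrow> shift_weight G g w \<in> \<V>"
    and nb_directed: "\<V> \<in> nb \<Longrightarrow> \<W> \<in> nb \<Longrightarrow> \<exists>\<U>\<in>nb. \<U> \<subseteq> \<V> \<inter> \<W>"
    and approximation: "(\<And>w. w \<in> V0 \<Longrightarrow> finite (S w) \<and> S w \<subseteq> carrier G \<times> (\<Union>k. gens F k)) \<Longrightarrow>
      \<exists>\<V>\<in>nb. \<exists>\<Gamma>\<subseteq>V0. finite \<Gamma> \<and>
        (\<forall>w\<in>\<V>. \<exists>w0\<in>\<Gamma>. \<exists>\<kappa>. \<forall>y\<in>S w0. \<bar>w y - w0 y - \<kappa>\<bar> \<le> 1)"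
    and controlled: "w \<in> V0 \<Longrightarrow> \<exists>\<Lambda>. filterlim (\<lambda>s. s - \<Lambda> s) at_top at_top \<and>
      (\<forall>s. (\<forall>a. \<exists>c\<in>chains_deg G F 0. aug F c = a \<and> high w (s - \<Lambda> s) c) \<and>
        (\<forall>i<n. \<forall>z\<in>cycles G F i. high w s z \<longrightarrow>
          (\<exists>c\<in>chains_deg G F (Suc i). bd F c = z \<and> high w (s - \<Lambda> s) c)))"
begin

lemma finite_below: "m \<le> Suc n \<Longrightarrow> finite (below m)"
  using finite_gens by (auto simp: below_def)

lemma weight_shift_id: "shift_weight G g w (\<one>, x) = w (g, x)" if "g \<in> carrier G"
  using that by (simp add: shift_weight_def)

text \<open>Finitely many reference weights have bounded variation on the finite set
  \<open>S\<close>, and the additive constant \<kappa> cancels in differences.\<close>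

lemma bounded_variation:
  assumes "finite S" "S \<subseteq> carrier G \<times> (\<Union>k. gens F k)"
  shows "\<exists>\<V>\<in>nb. \<exists>r. \<forall>w\<in>\<V>. \<forall>y\<in>S. \<forall>y'\<in>S. w y' - r \<le> w y"
proof -
  obtain \<V> \<Gamma> where V: "\<V> \<in> nb" "\<Gamma> \<subseteq> V0" "finite \<Gamma>"
    "\<And>w. w \<in> \<V> \<Longrightarrow> \<exists>w0\<in>\<Gamma>. \<exists>\<kappa>. \<forall>y\<in>S. \<bar>w y - w0 y - \<kappa>\<bar> \<le> 1"
    using approximation[of "\<lambda>_. S"] assms by blast
  define B where "B = (\<lambda>(w0, y, y'). w0 y' - w0 y) ` (\<Gamma> \<times> S \<times> S)"
  have "finite B" using V assms by (simp add: B_def)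
  show ?thesis
  \<comment> \<open>The summand 2 is the approximation error 1 at each of the two cells; inserting 0
    makes the maximum meaningful if there is nothing to compare.\<close>
  proof (intro bexI[OF _ V(1)] exI[of _ "Max (insert 0 B) + 2"] ballI)
    fix w y y' assume w: "w \<in> \<V>" and y: "y \<in> S" "y' \<in> S"
    then obtain w0 \<kappa> where w0: "w0 \<in> \<Gamma>" "\<bar>w y - w0 y - \<kappa>\<bar> \<le> 1" "\<bar>w y' - w0 y' - \<kappa>\<bar> \<le> 1"
      using V(4) by blast
    have "w0 y' - w0 y \<in> B" unfolding B_def using w0 y by force
    then have "w0 y' - w0 y \<le> Max (insert 0 B)" using \<open>finite B\<close> by simp
    then show "w y' - (Max (insert 0 B) + 2) \<le> w y" using w0 by linarith
  qed
qed

text \<open>A cell and the supports of its finitely many possible values form a finite set, on which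
  the weights of a whole neighbourhood vary by a bounded amount. The bound at the basis cells
  suffices, because neighbourhoods are closed under shifts.\<close>

lemma bounded_displacement:
  assumes "finite X" "X \<subseteq> (\<Union>k. gens F k)" "\<And>x. x \<in> X \<Longrightarrow> finite (D x) \<and> D x \<subseteq> Tot"
  shows "\<exists>\<V>\<in>nb. \<exists>r. \<forall>w\<in>\<V>. \<forall>x\<in>X. \<forall>c\<in>D x. high w (w (\<one>, x) - r) c"
proof -
  define S where "S = (\<Union>x\<in>X. insert (\<one>, x) (\<Union>c\<in>D x. Poly_Mapping.keys c))"
  have "finite S" using assms by (auto simp: S_def)
  moreover have "S \<subseteq> carrier G \<times> (\<Union>k. gens F k)"
    unfolding S_def
  proof (intro UN_least insert_subsetI)
    fix x c assume "x \<in> X" "c \<in> D x"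
    then have "c \<in> Tot" using assms(3) by blast
    then show "Poly_Mapping.keys c \<subseteq> carrier G \<times> (\<Union>k. gens F k)"
      by (simp add: all_chains_def free_module_iff)
  qed (use assms(2) in blast)
  ultimately obtain \<V> r where V: "\<V> \<in> nb"
    and r: "\<And>w y y'. w \<in> \<V> \<Longrightarrow> y \<in> S \<Longrightarrow> y' \<in> S \<Longrightarrow> w y' - r \<le> w y"
    using bounded_variation[of S] by blast
  have "w (\<one>, x) - r \<le> w y"
    if "w \<in> \<V>" "x \<in> X" "c \<in> D x" "y \<in> Poly_Mapping.keys c" for w x c y
    by (rule r[OF that(1)]) (use that in \<open>auto simp: S_def\<close>)
  then show ?thesis unfolding high_def using V by blast
qed

lemma displacement_value_map:
  assumes D: "\<And>x c. x \<in> X \<Longrightarrow> c \<in> D x \<Longrightarrow> high w' (w' (\<one>, x) + r) c"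
    and w': "w' = shift_weight G g w" and e: "value_map G X D e" and g: "g \<in> carrier G" "x \<in> X"
  shows "high w (w (g, x) + r) (e (g, x))"
proof -
  obtain c where c: "c \<in> D x" "e (g, x) = translate G g c" using e g by (auto simp: value_map_def)
  then show ?thesis using D[OF g(2) c(1)] high_translate g(1) unfolding w' by (simp add: weight_shift_id)
qed

text \<open>With the gain per application fixed at 1, N iterations gain N.\<close>

definition pushing :: "nat \<Rightarrow> ('g \<times> 'x \<Rightarrow> real) \<Rightarrow> ('g \<times> 'x \<Rightarrow> ('g, 'x) chain) \<Rightarrow> bool" where
  "pushing m w f \<longleftrightarrow> (\<forall>y\<in>carrier G \<times> below m. high w (w y + 1) (f y))"

lemma pushing_shift:
  assumes f: "pushing m w f" and g: "g \<in> carrier G"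
    and fm: "\<And>y. y \<in> carrier G \<times> below m \<Longrightarrow> f y \<in> Tot"
  shows "pushing m (shift_weight G g w) (shift_map G g f)"
  unfolding pushing_def
proof
  fix y assume y: "y \<in> carrier G \<times> below m"
  obtain h x where y': "y = (h, x)" "h \<in> carrier G" "x \<in> below m" using y by blast
  have "high w (w (g \<otimes> h, x) + 1) (f (g \<otimes> h, x))" using f g y' by (auto simp: pushing_def)
  moreover have "f (g \<otimes> h, x) \<in> Tot" using fm g y' by auto
  \<comment> \<open>Shifting forth and back recovers the weight on genuine cells only, hence the
    appeal to the support of the chain.\<close>
  then have "high (shift_weight G (inv g) (shift_weight G g w)) s (f (g \<otimes> h, x))
      \<longleftrightarrow> high w s (f (g \<otimes> h, x))" for s
    using g unfolding high_def all_chains_def free_module_iff shift_weight_def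
    by (intro ball_cong) (auto simp: m_assoc[symmetric])
  ultimately show "high (shift_weight G g w) (shift_weight G g w y + 1) (shift_map G g f y)"
    unfolding y' shift_map_def by (simp add: high_translate) (simp add: shift_weight_def high_translate)
qed

text \<open>In degree 0 an element can be lifted at any desired height, since s - \<Lambda> s is
  unbounded. The finitely many reference weights contribute one lift each.\<close>

lemma bounded_push_at_generators_0:
  shows "\<exists>\<V>\<in>nb. \<exists>C. (\<forall>x\<in>gens F 0. finite (C x) \<and> C x \<subseteq> Ch 0) \<and>
    (\<forall>w\<in>\<V>. \<forall>x\<in>gens F 0. \<exists>c\<in>C x. aug F c = aug F (frag_of (\<one>, x)) \<and> high w (w (\<one>, x) + 1) c)"
proof -
  \<comment> \<open>The surplus 3 consists of the desired push by 1 and the approximation error 1 at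
    each of the two cells compared.\<close>
  have "\<exists>p. \<forall>x\<in>gens F 0. p x \<in> Ch 0 \<and> aug F (p x) = aug F (frag_of (\<one>, x)) \<and>
      high w (w (\<one>, x) + 3) (p x)" if w: "w \<in> V0" for w
  proof -
    obtain \<Lambda> where "filterlim (\<lambda>s. s - \<Lambda> s) at_top at_top"
      and L: "\<And>s a. \<exists>c\<in>Ch 0. aug F c = a \<and> high w (s - \<Lambda> s) c"
      using controlled[OF w] by blast
    then have "\<exists>s. t \<le> s - \<Lambda> s" for t
      using filterlim_at_top_exists_ge by blast
    then have "\<exists>c. c \<in> Ch 0 \<and> aug F c = a \<and> high w t c" for a t
      using L high_mono by meson
    then show ?thesis by (intro bchoice ballI)
  qed
  then obtain p where p: "\<And>w x. w \<in> V0 \<Longrightarrow> x \<in> gens F 0 \<Longrightarrow> p w x \<in> Ch 0 \<and>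
      aug F (p w x) = aug F (frag_of (\<one>, x)) \<and> high w (w (\<one>, x) + 3) (p w x)"
    by metis
  define S where "S w = (\<Union>x\<in>gens F 0. insert (\<one>, x) (Poly_Mapping.keys (p w x)))" for w
  have "finite (S w) \<and> S w \<subseteq> carrier G \<times> (\<Union>k. gens F k)" if "w \<in> V0" for w
  proof
    show "finite (S w)" using finite_gens[of 0] by (simp add: S_def)
    have "Poly_Mapping.keys (p w x) \<subseteq> carrier G \<times> gens F 0" if "x \<in> gens F 0" for x
      using p[OF \<open>w \<in> V0\<close> that] by (simp add: chains_deg_def free_module_iff)
    then show "S w \<subseteq> carrier G \<times> (\<Union>k. gens F k)" unfolding S_def by auto
  qed
  then obtain \<V> \<Gamma> where V: "\<V> \<in> nb" "\<Gamma> \<subseteq> V0" "finite \<Gamma>"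
    "\<And>w. w \<in> \<V> \<Longrightarrow> \<exists>w0\<in>\<Gamma>. \<exists>\<kappa>. \<forall>y\<in>S w0. \<bar>w y - w0 y - \<kappa>\<bar> \<le> 1"
    using approximation[of S] by blast
  show ?thesis
  proof (intro bexI[OF _ V(1)] exI[of _ "\<lambda>x. (\<lambda>w. p w x) ` \<Gamma>"] conjI ballI)
    fix w x assume w: "w \<in> \<V>" and x: "x \<in> gens F 0"
    obtain w0 \<kappa> where w0: "w0 \<in> \<Gamma>" "\<And>y. y \<in> S w0 \<Longrightarrow> \<bar>w y - w0 y - \<kappa>\<bar> \<le> 1" using V(4)[OF w] by blast
    have "w (\<one>, x) + 1 \<le> w y" if y: "y \<in> Poly_Mapping.keys (p w0 x)" for y
    proof -
      have "y \<in> S w0" "(\<one>, x) \<in> S w0" using y x by (auto simp: S_def)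
      moreover have "w0 (\<one>, x) + 3 \<le> w0 y" using p[of w0 x] x y w0(1) V(2) by (auto simp: high_def)
      ultimately show ?thesis using w0(2)[of y] w0(2)[of "(\<one>, x)"] by linarith
    qed
    then show "\<exists>c\<in>(\<lambda>w. p w x) ` \<Gamma>. aug F c = aug F (frag_of (\<one>, x)) \<and> high w (w (\<one>, x) + 1) c"
      using w0(1) p[of w0 x] x V(2) by (intro bexI[of _ "p w0 x"] imageI) (auto simp: high_def)
  qed (use V p in auto)
qed

text \<open>Here \<open>B x\<close> stands for the support of the boundary of x. The numbers s and t
  bound the boundaries from below and the cells from above; N pushes lift a boundary so far that its
  filling lies above all cells, whatever the lag. The 2 is reserved for passing between a weight and
  its reference weight, the 3 for a push by 1 after the same loss.\<close>

lemma push_threshold: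
  assumes w: "w \<in> V0" and X: "finite X" "\<And>x. x \<in> X \<Longrightarrow> finite (B x)" and i: "i < n"
  shows "\<exists>s t N. real N \<ge> R \<and> (\<forall>x\<in>X. w (\<one>, x) \<le> t \<and> (\<forall>y\<in>B x. s \<le> w y)) \<and>
    (\<forall>z\<in>cycles G F i. high w (s + real N - 2) z \<longrightarrow>
      (\<exists>c\<in>Ch (Suc i). bd F c = z \<and> high w (t + 3) c))"
proof -
  obtain \<Lambda> where lim: "filterlim (\<lambda>s. s - \<Lambda> s) at_top at_top"
    and L: "\<And>s z. z \<in> cycles G F i \<Longrightarrow> high w s z \<Longrightarrow>
      \<exists>c\<in>Ch (Suc i). bd F c = z \<and> high w (s - \<Lambda> s) c"
    using controlled[OF w] i by blast
  define t where "t = Max (insert 0 ((\<lambda>x. w (\<one>, x)) ` X))"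
  define s where "s = Min (insert 0 (w ` (\<Union>x\<in>X. B x)))"
  obtain s1 where s1: "t + 3 \<le> s1 - \<Lambda> s1" using filterlim_at_top_exists_ge[OF lim] by blast
  \<comment> \<open>The pushed boundary, at height s + N - 2, has to reach the level
    \<open>s1\<close> at which fillings are high enough.\<close>
  obtain N :: nat where N: "real N \<ge> max R (s1 - s + 2)" using real_arch_simple by blast
  have "\<exists>c\<in>Ch (Suc i). bd F c = z \<and> high w (t + 3) c"
    if "z \<in> cycles G F i" "high w (s + real N - 2) z" for z
  proof -
    have "high w s1 z" using that(2) N by (auto intro: high_mono)
    then show ?thesis using L[OF that(1)] high_mono[OF _ s1] by blast
  qed
  moreover have "w (\<one>, x) \<le> t" "\<forall>y\<in>B x. s \<le> w y" if "x \<in> X" for x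
  proof -
    show "w (\<one>, x) \<le> t" using that X by (simp add: t_def)
    have "finite (w ` (\<Union>x\<in>X. B x))" using X by blast
    moreover have "w y \<in> w ` (\<Union>x\<in>X. B x)" if "y \<in> B x" for y using that \<open>x \<in> X\<close> by blast
    ultimately show "\<forall>y\<in>B x. s \<le> w y" unfolding s_def by simp
  qed
  ultimately show ?thesis using N by (intro exI[of _ s] exI[of _ t] exI[of _ N]) auto
qed

end

lemma funpow_frag_extend_zero [simp]:
  fixes f :: "'y \<Rightarrow> 'y \<Rightarrow>\<^sub>0 int"
  shows "(frag_extend f ^^ j) 0 = 0"
  by (induction j) auto

context weighted_resolution
begin

lemma Ch_keys: "c \<in> Ch k \<Longrightarrow> Poly_Mapping.keys c \<subseteq> carrier G \<times> gens F k"
  by (simp add: chains_deg_def free_module_iff)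

lemma displacement_homotopy:
  assumes D: "\<And>w x c. w \<in> \<V> \<Longrightarrow> x \<in> X \<Longrightarrow> c \<in> D x \<Longrightarrow> high w (w (\<one>, x) - r) c"
    and V: "\<V> \<in> nb" "w \<in> \<V>" and e: "value_map G X D e"
    and c: "c \<in> free_module G X" "high w s c"
  shows "high w (s - r) (frag_extend e c)"
proof -
  have "high w (w y + - r) (e y)" if keys: "y \<in> Poly_Mapping.keys c" for y
  proof -
    obtain g x where y: "y = (g, x)" "g \<in> carrier G" "x \<in> X" using free_module_keys[OF c(1) keys] by blast
    have "high (shift_weight G g w) (shift_weight G g w (\<one>, x) + - r) c" if "x \<in> X" "c \<in> D x" for x c
      using D[OF nb_shift[OF V y(2)] that] by simp
    then show ?thesis unfolding y(1) using displacement_value_map[OF _ refl e y(2,3)] by blast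
  qed
  then show ?thesis using high_frag_extend[OF c(2), of "- r" e] by simp
qed

text \<open>For a given weight the filling becomes a function \<open>p\<close> of the cycle,
  selected without reference to the map that produces the cycle.\<close>

lemma threshold_fillings:
  assumes w: "w \<in> V0" and i: "i < n"
  shows "\<exists>s t N p. R \<le> real N \<and>
    (\<forall>x\<in>gens F (Suc i). w (\<one>, x) \<le> t \<and> high w s (bd F (frag_of (\<one>, x)))) \<and>
    (\<forall>z. p z \<in> Ch (Suc i) \<and> (z \<in> cycles G F i \<and> high w (s + real N - 2) z \<longrightarrow>
      bd F (p z) = z \<and> high w (t + 3) (p z)))"
proof -
  have "finite (gens F (Suc i))" using finite_gens[of "Suc i"] i by simp
  then obtain s t N where N: "R \<le> real N"
    "\<forall>x\<in>gens F (Suc i). w (\<one>, x) \<le> t \<and> high w s (bd F (frag_of (\<one>, x)))"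
    and z: "\<And>z. z \<in> cycles G F i \<Longrightarrow> high w (s + real N - 2) z \<Longrightarrow>
      \<exists>c\<in>Ch (Suc i). bd F c = z \<and> high w (t + 3) c"
    using push_threshold[OF w, of "gens F (Suc i)" "\<lambda>x. Poly_Mapping.keys (bd F (frag_of (\<one>, x)))" i R] i
    unfolding high_def by auto
  have "\<forall>z. \<exists>c. c \<in> Ch (Suc i) \<and> (z \<in> cycles G F i \<and> high w (s + real N - 2) z \<longrightarrow>
      bd F c = z \<and> high w (t + 3) c)"
  proof
    fix z
    \<comment> \<open>Default value where the threshold is not met, so that \<open>p\<close> always
      yields chains of the right degree.\<close>
    have "0 \<in> Ch (Suc i)" by (simp add: chains_deg_def)
    then show "\<exists>c. c \<in> Ch (Suc i) \<and> (z \<in> cycles G F i \<and> high w (s + real N - 2) z \<longrightarrow>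
      bd F c = z \<and> high w (t + 3) c)"
      using z[of z] by blast
  qed
  then obtain p where "\<forall>z. p z \<in> Ch (Suc i) \<and> (z \<in> cycles G F i \<and> high w (s + real N - 2) z \<longrightarrow>
      bd F (p z) = z \<and> high w (t + 3) (p z))"
    by metis
  then show ?thesis using N by blast
qed

text \<open>The number of pushes needed to fill the boundary of a basis element near the weight \<open>w0\<close>
  is \<open>N w0\<close>. By compactness finitely many \<open>w0\<close> suffice, but the neighbourhoods depend on the
  numbers \<open>N w0\<close>, so these cannot be increased afterwards. Instead the homotopy fills the
  difference between \<open>N w0\<close> pushes and the common number \<open>K\<close> of pushes.\<close>

lemma bounded_push_at_generators_Suc:
  assumes i: "i < n" and m: "m = Suc i"
    and C: "\<And>x. x \<in> below m \<Longrightarrow> finite (C x) \<and> C x \<subseteq> free_module G (below m)"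
  shows "\<exists>\<V>\<in>nb. \<exists>N\<ge>1. \<exists>C'. (\<forall>x\<in>gens F m. finite (C' x) \<and> C' x \<subseteq> Ch m) \<and>
    (\<forall>w\<in>\<V>. \<forall>f. value_map G (below m) C f \<and> chain_map_below m f \<and> pushing m w f \<longrightarrow>
      (\<forall>x\<in>gens F m. \<exists>c\<in>C' x. bd F c = (frag_extend f ^^ N) (bd F (frag_of (\<one>, x))) \<and>
        high w (w (\<one>, x) + 1) c))"
proof -
  define b where "b x = bd F (frag_of (\<one>, x))" for x
  have b: "b x \<in> cycles G F i" "b x \<in> free_module G (below m)" if "x \<in> gens F m" for x
  proof -
    have "frag_of (\<one>, x) \<in> Ch (Suc i)" using that m by (intro Ch_frag_of) auto
    then show "b x \<in> cycles G F i" unfolding b_def by (rule bd_in_cycles)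
    then show "b x \<in> free_module G (below m)" using cycles_Ch Ch_subset_below[of i m] m by blast
  qed
  have fin: "finite (gens F m)" "finite (below m)" using finite_gens finite_below i m by auto
  have sub: "below m \<subseteq> (\<Union>k. gens F k)" by (auto simp: below_def)
  have CT: "\<And>x. x \<in> below m \<Longrightarrow> finite (C x) \<and> C x \<subseteq> Tot" using C below_subset_Tot by blast
  obtain D where D: "\<And>x. x \<in> below m \<Longrightarrow> finite (D x) \<and> D x \<subseteq> Tot"
    and De: "\<And>f. value_map G (below m) C f \<Longrightarrow> chain_map_below m f \<Longrightarrow>
      \<exists>e. value_map G (below m) D e \<and> homotopy_below m f e"
    using homotopy_exists[of m C, OF CT] by blast
  obtain \<V>1 r1 where V1: "\<V>1 \<in> nb"
    "\<And>w x c. w \<in> \<V>1 \<Longrightarrow> x \<in> below m \<Longrightarrow> c \<in> D x \<Longrightarrow> high w (w (\<one>, x) - r1) c"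
    using bounded_displacement[where D = D, OF fin(2) sub D] by blast
  have "finite {b x} \<and> {b x} \<subseteq> Tot" if "x \<in> gens F m" for x
    using b(2)[OF that] below_subset_Tot by auto
  then obtain \<V>2 r2 where V2: "\<V>2 \<in> nb"
    "\<And>w x. w \<in> \<V>2 \<Longrightarrow> x \<in> gens F m \<Longrightarrow> high w (w (\<one>, x) - r2) (b x)"
    using bounded_displacement[OF fin(1), of "\<lambda>x. {b x}"] by blast
  \<comment> \<open>From the cell to its boundary the height drops by at most \<open>r2\<close>,
    under the homotopy by at most \<open>r1\<close>; after at least R pushes a gain of 1
    remains.\<close>
  define R where "R = r1 + r2 + 1"
  define Q where "Q w s t N p \<longleftrightarrow> R \<le> real N \<and>
    (\<forall>x\<in>gens F m. w (\<one>, x) \<le> t \<and> high w s (b x)) \<and>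
    (\<forall>z. p z \<in> Ch m \<and> (z \<in> cycles G F i \<and> high w (s + real N - 2) z \<longrightarrow>
      bd F (p z) = z \<and> high w (t + 3) (p z)))" for w s t N p
  have "\<forall>w\<in>V0. \<exists>s t N p. Q w s t N p"
    using threshold_fillings[OF _ i, of _ R] unfolding Q_def b_def m by blast
  then obtain s t N p where Q: "\<And>w. w \<in> V0 \<Longrightarrow> Q w (s w) (t w) (N w) (p w)" by metis
  define Z where "Z j x = iterated_attainable G (below m) C j (b x)" for j x
  have Z: "finite (Z j x)" "Z j x \<subseteq> free_module G (below m)" if "x \<in> gens F m" for j x
    unfolding Z_def using C b(2)[OF that]
    by (intro finite_iterated_attainable iterated_attainable_in_free_module; blast)+
  \<comment> \<open>The reference weight has to be compared on every cycle that N w pushes can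
    produce, and on the fillings of these cycles. This is how the neighbourhood comes to depend on
    \<open>N w\<close>.\<close>
  define S where "S w = (\<Union>x\<in>gens F m. insert (\<one>, x) (Poly_Mapping.keys (b x) \<union>
    (\<Union>z\<in>Z (N w) x. Poly_Mapping.keys z \<union> Poly_Mapping.keys (p w z))))" for w
  have "finite (S w) \<and> S w \<subseteq> carrier G \<times> (\<Union>k. gens F k)" if w: "w \<in> V0" for w
  proof
    show "finite (S w)" using fin Z by (simp add: S_def)
    have "Poly_Mapping.keys (b x) \<subseteq> carrier G \<times> (\<Union>k. gens F k)" if "x \<in> gens F m" for x
      using b(2)[OF that] sub by (auto simp: free_module_iff)
    moreover have "Poly_Mapping.keys z \<subseteq> carrier G \<times> (\<Union>k. gens F k)"
      if "x \<in> gens F m" "z \<in> Z j x" for x z j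
      using Z(2)[OF that(1)] that(2) sub unfolding free_module_iff free_module_def by blast
    moreover have "Poly_Mapping.keys (p w z) \<subseteq> carrier G \<times> (\<Union>k. gens F k)" for z
      using Q[OF w] Ch_keys[of "p w z" m] unfolding Q_def by blast
    ultimately show "S w \<subseteq> carrier G \<times> (\<Union>k. gens F k)"
      unfolding S_def by (intro UN_least insert_subsetI Un_least) auto
  qed
  then obtain \<V>3 \<Gamma> where V3: "\<V>3 \<in> nb" "\<Gamma> \<subseteq> V0" "finite \<Gamma>"
    "\<And>w. w \<in> \<V>3 \<Longrightarrow> \<exists>w0\<in>\<Gamma>. \<exists>\<kappa>. \<forall>y\<in>S w0. \<bar>w y - w0 y - \<kappa>\<bar> \<le> 1"
    using approximation[of S] by blast
  obtain \<V>4 where V4: "\<V>4 \<in> nb" "\<V>4 \<subseteq> \<V>1 \<inter> \<V>2" using nb_directed[OF V1(1) V2(1)] by blast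
  obtain \<V> where V: "\<V> \<in> nb" "\<V> \<subseteq> \<V>4 \<inter> \<V>3" using nb_directed[OF V4(1) V3(1)] by blast
  define K where "K = Max (insert 1 (N ` \<Gamma>))"
  have K: "N w0 \<le> K" if "w0 \<in> \<Gamma>" for w0 using V3(3) that by (simp add: K_def)
  have K1: "1 \<le> K" using V3(3) by (simp add: K_def)
  define U where "U x = (\<Union>j<K. \<Union>z\<in>Z j x. attainable G (below m) D z)" for x
  define P where "P x w0 = Z (N w0) x \<times> ({N w0..<K} \<rightarrow>\<^sub>E U x)" for x w0
  \<comment> \<open>A value is a filling after \<open>N w0\<close> pushes plus one homotopy term for
    each missing push up to \<open>K\<close>. Both ingredients range over finite sets.\<close>
  define C' where "C' x = (\<Union>w0\<in>\<Gamma>. (\<lambda>(z, u). p w0 z + sum u {N w0..<K}) ` P x w0) \<inter> Ch m" for x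
  show ?thesis
  proof (intro bexI[OF _ V(1)] exI[of _ K] exI[of _ C'] conjI ballI allI impI K1)
    fix x assume x: "x \<in> gens F m"
    have "finite (U x)" using Z[OF x] D unfolding U_def by (auto intro!: finite_attainable)
    then show "finite (C' x)"
      unfolding C'_def P_def using V3(3) Z(1)[OF x]
      by (intro finite_Int disjI1 finite_UN_I finite_imageI finite_cartesian_product finite_PiE) auto
    show "C' x \<subseteq> Ch m" by (auto simp: C'_def)
  next
    fix w f x assume w: "w \<in> \<V>"
      and f: "value_map G (below m) C f \<and> chain_map_below m f \<and> pushing m w f"
      and x: "x \<in> gens F m"
    obtain e where e: "value_map G (below m) D e" "homotopy_below m f e" using De f by blast
    let ?\<Phi> = "\<lambda>j. (frag_extend f ^^ j) (b x)"
    have wV: "w \<in> \<V>1" "w \<in> \<V>2" "w \<in> \<V>3" using w V V4 by auto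
    obtain w0 \<kappa> where w0: "w0 \<in> \<Gamma>" and close: "\<And>y. y \<in> S w0 \<Longrightarrow> \<bar>w y - w0 y - \<kappa>\<bar> \<le> 1"
      using V3(4)[OF wV(3)] by blast
    have Q0: "Q w0 (s w0) (t w0) (N w0) (p w0)" using Q w0 V3(2) by blast
    have fpush: "f y \<in> free_module G (below m) \<and> high w (w y + 1) (f y)"
      if "y \<in> carrier G \<times> below m" for y
      using f that value_map_in_free_module[of "below m" C f y "below m"] C by (auto simp: pushing_def)
    have \<Phi>high: "high w (a + real j) (?\<Phi> j)" if "high w a (b x)" for a j
      using high_funpow[OF that b(2)[OF x] fpush, of j] by blast
    have \<Phi>cyc: "?\<Phi> j \<in> cycles G F i" for j
      using chain_map_below_funpow[of m f i "b x" j] f b(1)[OF x] m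
      by (auto intro!: cycleI simp: bd_cycle cycles_Ch) (simp add: cycles_def)
    have \<Phi>fm: "?\<Phi> j \<in> free_module G (below m)" for j
      using cycles_Ch[OF \<Phi>cyc] Ch_subset_below[of i m] m by blast
    have \<Phi>Z: "?\<Phi> j \<in> Z j x" for j
      unfolding Z_def using f by (blast intro: funpow_in_iterated_attainable)
    have E: "frag_extend e (?\<Phi> j) \<in> Ch m" "bd F (frag_extend e (?\<Phi> j)) = ?\<Phi> (Suc j) - ?\<Phi> j" for j
      using homotopy_below_chain[OF e(2), of i "?\<Phi> j"] \<Phi>cyc[of j] m by (auto simp: cycles_Ch bd_cycle)
    let ?z = "?\<Phi> (N w0)"
    let ?u = "restrict (\<lambda>j. frag_extend e (?\<Phi> j)) {N w0..<K}"
    let ?s = "\<Sum>j\<in>{N w0..<K}. frag_extend e (?\<Phi> j)"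
    have zS: "Poly_Mapping.keys ?z \<subseteq> S w0" "Poly_Mapping.keys (p w0 ?z) \<subseteq> S w0"
      "Poly_Mapping.keys (b x) \<subseteq> S w0" "(\<one>, x) \<in> S w0"
      using x \<Phi>Z[of "N w0"] unfolding S_def by blast+
    \<comment> \<open>The bound on the boundary is carried from \<open>w0\<close> to
      \<open>w\<close>, the pushes are made with respect to \<open>w\<close>, and the result is
      carried back to \<open>w0\<close>; each passage costs 1.\<close>
    have "high w (s w0 + \<kappa> - 1) (b x)"
      unfolding high_def
    proof
      fix y assume y: "y \<in> Poly_Mapping.keys (b x)"
      then have "s w0 \<le> w0 y" using Q0 x by (auto simp: Q_def high_def)
      then show "s w0 + \<kappa> - 1 \<le> w y" using close[of y] zS(3) y unfolding abs_le_iff by fastforce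
    qed
    from \<Phi>high[OF this, of "N w0"] have hz: "high w (s w0 + \<kappa> - 1 + real (N w0)) ?z" .
    have "high w0 (s w0 + real (N w0) - 2) ?z"
      unfolding high_def
    proof
      fix y assume y: "y \<in> Poly_Mapping.keys ?z"
      then have "s w0 + \<kappa> - 1 + real (N w0) \<le> w y" using hz by (simp add: high_def)
      moreover have "\<bar>w y - w0 y - \<kappa>\<bar> \<le> 1" using close zS(1) y by blast
      ultimately show "s w0 + real (N w0) - 2 \<le> w0 y" by linarith
    qed
    then have pz: "p w0 ?z \<in> Ch m" "bd F (p w0 ?z) = ?z" "high w0 (t w0 + 3) (p w0 ?z)"
      using Q0 \<Phi>cyc unfolding Q_def by blast+
    have hp: "high w (w (\<one>, x) + 1) (p w0 ?z)"
      unfolding high_def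
    proof
      fix y assume y: "y \<in> Poly_Mapping.keys (p w0 ?z)"
      have "t w0 + 3 \<le> w0 y" using pz(3) y by (simp add: high_def)
      moreover have "w0 (\<one>, x) \<le> t w0" using Q0 x by (simp add: Q_def)
      moreover have "\<bar>w y - w0 y - \<kappa>\<bar> \<le> 1" "\<bar>w (\<one>, x) - w0 (\<one>, x) - \<kappa>\<bar> \<le> 1"
        using close zS y by blast+
      ultimately show "w (\<one>, x) + 1 \<le> w y" by linarith
    qed
    have hs: "high w (w (\<one>, x) + 1) ?s"
    proof (rule high_sum)
      fix j assume j: "j \<in> {N w0..<K}"
      have "high w (w (\<one>, x) - r2 + real j - r1) (frag_extend e (?\<Phi> j))"
        using displacement_homotopy[OF V1(2) V1(1) wV(1) e(1) \<Phi>fm \<Phi>high[OF V2(2)[OF wV(2) x], of j]] by blast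
      moreover have "R \<le> real j" using Q0 j by (simp add: Q_def)
      ultimately show "high w (w (\<one>, x) + 1) (frag_extend e (?\<Phi> j))"
        unfolding R_def by (auto elim!: high_mono)
    qed
    have sCh: "?s \<in> Ch m" using E(1) unfolding chains_deg_def by (intro free_module_sum) blast
    have "bd F ?s = (\<Sum>j\<in>{N w0..<K}. bd F (frag_extend e (?\<Phi> j)))"
      using E(1) Ch_subset_Tot by (intro bd_sum) blast
    \<comment> \<open>The telescoping sum supplies the difference between K pushes and those already
      filled by \<open>p\<close>.\<close>
    also have "\<dots> = ?\<Phi> K - ?z" unfolding E(2) using K[OF w0] by (rule sum_Suc_diff')
    finally have bds: "bd F ?s = ?\<Phi> K - ?z" .
    have "p w0 ?z \<in> Tot" "?s \<in> Tot" using pz sCh Ch_subset_Tot by blast+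
    then have bdc: "bd F (p w0 ?z + ?s) = ?\<Phi> K" using pz(2) bds by (simp add: bd_add)
    have "frag_extend e (?\<Phi> j) \<in> U x" if "j \<in> {N w0..<K}" for j
      unfolding U_def attainable_def using that \<Phi>Z[of j] e(1) by auto
    then have "?u \<in> {N w0..<K} \<rightarrow>\<^sub>E U x" by auto
    then have "(?z, ?u) \<in> P x w0" using \<Phi>Z unfolding P_def by blast
    moreover have "sum ?u {N w0..<K} = ?s" by (rule sum.cong) auto
    ultimately have "p w0 ?z + ?s \<in> (\<lambda>(z, u). p w0 z + sum u {N w0..<K}) ` P x w0" by force
    moreover have "p w0 ?z + ?s \<in> Ch m" using pz(1) sCh by (rule Ch_add)
    ultimately have "p w0 ?z + ?s \<in> C' x" unfolding C'_def using w0 by blast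
    then show "\<exists>c\<in>C' x. bd F c = (frag_extend f ^^ K) (bd F (frag_of (\<one>, x))) \<and>
        high w (w (\<one>, x) + 1) c"
      using bdc high_add[OF hp hs] unfolding b_def by blast
  qed
qed


text \<open>The degree 0 case joins in with N = 1, as the boundary of a 0-cell vanishes.\<close>

lemma bounded_push_at_generators:
  assumes m: "m \<le> n"
    and C: "\<forall>x\<in>below m. finite (C x) \<and> C x \<subseteq> free_module G (below m)"
  shows "\<exists>\<V>\<in>nb. \<exists>N\<ge>1. \<exists>C'. (\<forall>x\<in>gens F m. finite (C' x) \<and> C' x \<subseteq> Ch m) \<and>
    (\<forall>w\<in>\<V>. \<forall>f. value_map G (below m) C f \<and> chain_map_below m f \<and> pushing m w f \<longrightarrow>
      (\<forall>x\<in>gens F m. \<exists>c\<in>C' x. bd F c = (frag_extend f ^^ N) (bd F (frag_of (\<one>, x))) \<and>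
        (m = 0 \<longrightarrow> aug F c = aug F (frag_of (\<one>, x))) \<and> high w (w (\<one>, x) + 1) c))"
proof (cases m)
  case 0
  obtain \<V> C' where V: "\<V> \<in> nb" and C': "\<forall>x\<in>gens F 0. finite (C' x) \<and> C' x \<subseteq> Ch 0"
    and push: "\<And>w x. w \<in> \<V> \<Longrightarrow> x \<in> gens F 0 \<Longrightarrow>
      \<exists>c\<in>C' x. aug F c = aug F (frag_of (\<one>, x)) \<and> high w (w (\<one>, x) + 1) c"
    using bounded_push_at_generators_0 by blast
  have "\<exists>c\<in>C' x. bd F c = (frag_extend f ^^ 1) (bd F (frag_of (\<one>, x))) \<and>
      aug F c = aug F (frag_of (\<one>, x)) \<and> high w (w (\<one>, x) + 1) c"
    if wx: "w \<in> \<V>" "x \<in> gens F 0" for w x f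
  proof -
    have "bd F (frag_of (\<one>, x)) = 0" using wx by (intro bd_Ch_0 Ch_frag_of) simp
    moreover obtain c where "c \<in> C' x" "aug F c = aug F (frag_of (\<one>, x))" "high w (w (\<one>, x) + 1) c"
      using push[OF wx] by blast
    moreover have "bd F c = 0" using \<open>c \<in> C' x\<close> C' wx by (intro bd_Ch_0) blast
    ultimately show ?thesis by (intro bexI[of _ c]) simp_all
  qed
  then have "\<forall>w\<in>\<V>. \<forall>f. value_map G (below 0) C f \<and> chain_map_below 0 f \<and> pushing 0 w f \<longrightarrow>
      (\<forall>x\<in>gens F 0. \<exists>c\<in>C' x. bd F c = (frag_extend f ^^ 1) (bd F (frag_of (\<one>, x))) \<and>
        ((0::nat) = 0 \<longrightarrow> aug F c = aug F (frag_of (\<one>, x))) \<and> high w (w (\<one>, x) + 1) c)"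
    by blast
  with V C' show ?thesis unfolding 0 by (intro bexI[OF _ V] exI[of _ 1] exI[of _ C'] conjI order_refl)
next
  case (Suc i)
  then have "i < n" using m by simp
  then have "\<exists>\<V>\<in>nb. \<exists>N\<ge>1. \<exists>C'. (\<forall>x\<in>gens F m. finite (C' x) \<and> C' x \<subseteq> Ch m) \<and>
    (\<forall>w\<in>\<V>. \<forall>f. value_map G (below m) C f \<and> chain_map_below m f \<and> pushing m w f \<longrightarrow>
      (\<forall>x\<in>gens F m. \<exists>c\<in>C' x. bd F c = (frag_extend f ^^ N) (bd F (frag_of (\<one>, x))) \<and>
        high w (w (\<one>, x) + 1) c))"
    using Suc bspec[OF C] by (rule bounded_push_at_generators_Suc)
  then show ?thesis using Suc by simp
qed

text \<open>On lower cells \<open>f\<close> is replaced by its N-th power, so that a chain bounding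
  the N-fold push of the boundary of x becomes a legitimate value at x.\<close>

lemma uniform_push_step:
  assumes m: "m \<le> n" and V: "\<V> \<in> nb"
    and C': "\<forall>x\<in>below m. finite (C x) \<and> C x \<subseteq> free_module G (below m)"
    and IH: "\<And>w. w \<in> \<V> \<Longrightarrow> \<exists>f. value_map G (below m) C f \<and> chain_map_below m f \<and> pushing m w f"
  shows "\<exists>\<V>\<in>nb. \<exists>C. (\<forall>x\<in>below (Suc m). finite (C x) \<and> C x \<subseteq> free_module G (below (Suc m))) \<and>
    (\<forall>w\<in>\<V>. \<exists>f. value_map G (below (Suc m)) C f \<and> chain_map_below (Suc m) f \<and> pushing (Suc m) w f)"
proof -
  note C = bspec[OF C']
  from bounded_push_at_generators[OF m C'] obtain \<V>1 N C1 where V1: "\<V>1 \<in> nb" and N: "N \<ge> (1::nat)"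
    and C1: "\<forall>x\<in>gens F m. finite (C1 x) \<and> C1 x \<subseteq> Ch m"
    and push: "\<forall>w\<in>\<V>1. \<forall>f. value_map G (below m) C f \<and> chain_map_below m f \<and> pushing m w f \<longrightarrow>
      (\<forall>x\<in>gens F m. \<exists>c\<in>C1 x. bd F c = (frag_extend f ^^ N) (bd F (frag_of (\<one>, x))) \<and>
        (m = 0 \<longrightarrow> aug F c = aug F (frag_of (\<one>, x))) \<and> high w (w (\<one>, x) + 1) c)"
    by (elim bexE exE conjE)
  obtain \<U> where U: "\<U> \<in> nb" "\<U> \<subseteq> \<V> \<inter> \<V>1" using nb_directed[OF V V1] by blast
  have bm: "free_module G (below m) \<subseteq> free_module G (below (Suc m))"
    using free_module_mono[of "below m" "below (Suc m)"] by (auto simp: below_Suc)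
  have CT: "C x \<subseteq> Tot" if "x \<in> below m" for x using C[OF that] below_subset_Tot by blast
  \<comment> \<open>The sets of possible values below degree m grow with the passage to the N-th
    power, but stay finite and independent of the weight.\<close>
  define C2 where "C2 x = (if x \<in> below m then iterated_attainable G (below m) C N (frag_of (\<one>, x))
    else C1 x)" for x
  show ?thesis
  proof (intro bexI[OF _ U(1)] exI[of _ C2] conjI ballI)
    fix x assume x: "x \<in> below (Suc m)"
    show "finite (C2 x)"
    proof (cases "x \<in> below m")
      case True
      then have "finite (iterated_attainable G (below m) C N (frag_of (\<one>, x)))"
        using C by (intro finite_iterated_attainable) auto
      then show ?thesis using True by (simp add: C2_def)
    qed (use x C1 in \<open>auto simp: C2_def below_Suc\<close>)
    show "C2 x \<subseteq> free_module G (below (Suc m))"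
    proof (cases "x \<in> below m")
      case True
      then have "iterated_attainable G (below m) C N (frag_of (\<one>, x)) \<subseteq> free_module G (below m)"
        using C by (intro iterated_attainable_in_free_module) auto
      then show ?thesis using True bm by (simp add: C2_def)
    next
      case False
      then have "C2 x \<subseteq> Ch m" using x C1 by (auto simp: C2_def below_Suc)
      then show ?thesis using Ch_subset_below[of m "Suc m"] by blast
    qed
  next
    fix w assume w: "w \<in> \<U>"
    then obtain f where f: "value_map G (below m) C f" "chain_map_below m f" "pushing m w f"
      using IH U by blast
    have fB: "f y \<in> free_module G (below m)" if "y \<in> carrier G \<times> below m" for y
      using value_map_in_free_module[OF f(1) that] C by blast
    have fpush: "f y \<in> free_module G (below m) \<and> high w (w y + 1) (f y)"
      if "y \<in> carrier G \<times> below m" for y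
      using f(3) that fB by (auto simp: pushing_def)
    let ?\<Phi> = "\<lambda>c. (frag_extend f ^^ N) c"
    have \<Phi>B: "?\<Phi> c \<in> free_module G (below m)" if c: "c \<in> free_module G (below m)" for c
    proof -
      obtain s where "high w s c" using high_exists by blast
      from high_funpow[where f = f and N = N, OF this c fpush] show ?thesis by blast
    qed
    have \<Phi>shift: "translate G g ((frag_extend (shift_map G g f) ^^ N) c) = ?\<Phi> (translate G g c)"
      if "g \<in> carrier G" "c \<in> free_module G (below m)" for g c
    proof -
      have "?\<Phi> (translate G g c) \<in> free_module G (below m)"
        using that by (intro \<Phi>B translate_in_free_module)
      then show ?thesis
        using funpow_shift_map[where f = f and N = N, OF that fB] translate_inv(1)[OF that(1)] by simp
    qed
    \<comment> \<open>The value at gx is selected at x, for the conjugate map and the shifted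
      weight, and then translated by g.\<close>
    define good where "good g x c \<longleftrightarrow> c \<in> C1 x \<and>
        bd F c = (frag_extend (shift_map G g f) ^^ N) (bd F (frag_of (\<one>, x))) \<and>
        (m = 0 \<longrightarrow> aug F c = aug F (frag_of (\<one>, x))) \<and>
        high (shift_weight G g w) (shift_weight G g w (\<one>, x) + 1) c" for g x c
    have "\<exists>c. good g x c"
      if g: "g \<in> carrier G" and x: "x \<in> gens F m" for g x
    proof -
      have "shift_weight G g w \<in> \<V>1" using nb_shift[OF V1 _ g] w U(2) by blast
      moreover have "value_map G (below m) C (shift_map G g f)"
        using value_map_below_shift[OF f(1) g] CT by blast
      moreover have "chain_map_below m (shift_map G g f)" using f(2) g by (rule chain_map_below_shift)
      moreover have "pushing m (shift_weight G g w) (shift_map G g f)"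
        using f(3) g fB below_subset_Tot by (intro pushing_shift) auto
      ultimately show ?thesis using push x unfolding good_def by blast
    qed
    then have ex: "\<exists>c. good g x c" if "g \<in> carrier G" "x \<in> gens F m" for g x
      using that by blast
    define c where "c g x = (SOME c. good g x c)" for g x
    have c: "c g x \<in> C1 x \<and>
        bd F (c g x) = (frag_extend (shift_map G g f) ^^ N) (bd F (frag_of (\<one>, x))) \<and>
        (m = 0 \<longrightarrow> aug F (c g x) = aug F (frag_of (\<one>, x))) \<and>
        high (shift_weight G g w) (shift_weight G g w (\<one>, x) + 1) (c g x)"
      if "g \<in> carrier G" "x \<in> gens F m" for g x
      using someI_ex[OF ex[OF that]] unfolding c_def[symmetric] unfolding good_def .
    define f' where "f' y = (if snd y \<in> below m then ?\<Phi> (frag_of y)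
      else translate G (fst y) (c (fst y) (snd y)))" for y
    have ext: "frag_extend f' z = ?\<Phi> z" if "z \<in> free_module G (below m)" for z
    proof -
      have "frag_extend f' z = frag_extend (\<lambda>y. ?\<Phi> (frag_of y)) z"
        using that by (intro frag_extend_eq) (auto simp: f'_def free_module_iff)
      then show ?thesis using funpow_frag_extend[of N f z] by simp
    qed
    have low: "f' (g, x) = translate G g ((frag_extend (shift_map G g f) ^^ N) (frag_of (\<one>, x)))"
      if "g \<in> carrier G" "x \<in> below m" for g x
      using \<Phi>shift[OF that(1), of "frag_of (\<one>, x)"] that by (simp add: f'_def)
    have top: "f' (g, x) = translate G g (c g x)" if "x \<in> gens F m" for g x
      using gens_not_below[OF that] by (simp add: f'_def)
    have "value_map G (below (Suc m)) C2 f'"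
      unfolding value_map_def
    proof (intro ballI)
      fix g x assume g: "g \<in> carrier G" and x: "x \<in> below (Suc m)"
      show "f' (g, x) \<in> translate G g ` C2 x"
      proof (cases "x \<in> below m")
        case True
        have "value_map G (below m) C (shift_map G g f)"
          using value_map_below_shift[OF f(1) g] CT by blast
        then show ?thesis
          using low[OF g True] True by (auto simp: C2_def intro!: imageI funpow_in_iterated_attainable)
      next
        case False
        then show ?thesis using top c g x by (auto simp: C2_def below_Suc)
      qed
    qed
    moreover have "chain_map_below (Suc m) f'"
      unfolding chain_map_below_def
    proof (intro allI impI ballI)
      fix j y assume j: "j < Suc m" and y: "y \<in> carrier G \<times> gens F j"
      obtain g x where y': "y = (g, x)" "g \<in> carrier G" "x \<in> gens F j" using y by blast
      have yA: "frag_of y \<in> Ch j" using y by (rule Ch_frag_of)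
      have "bd F (frag_of y) \<in> free_module G (below m)"
        using free_module_mono[OF below_mono bd_below[OF yA]] j by simp
      note eb = ext[OF this]
      show "f' y \<in> Ch j \<and> bd F (f' y) = frag_extend f' (bd F (frag_of y)) \<and>
          (j = 0 \<longrightarrow> aug F (f' y) = aug F (frag_of y))"
      proof (cases "j < m")
        case True
        then have "x \<in> below m" using y' by (auto simp: below_def)
        then have "f' y = ?\<Phi> (frag_of y)" by (simp add: f'_def y')
        then show ?thesis using chain_map_below_funpow[OF f(2) True yA, of N] eb by simp
      next
        case False
        then have jm: "j = m" using j by simp
        have x: "x \<in> gens F m" using y' jm by simp
        have xA: "frag_of (\<one>, x) \<in> Ch m" using x by (intro Ch_frag_of) simp
        have yx: "frag_of y = translate G g (frag_of (\<one>, x))" using y' by simp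
        have cA: "c g x \<in> Ch m" using c[OF y'(2) x] bspec[OF C1 x] by blast
        have "bd F (frag_of y) = translate G g (bd F (frag_of (\<one>, x)))"
          unfolding yx using xA Ch_subset_Tot y' by (blast intro: bd_equivariant)
        moreover have "bd F (f' y) = translate G g (bd F (c g x))"
          unfolding y'(1) top[OF x] using cA Ch_subset_Tot y' by (blast intro: bd_equivariant)
        ultimately have "bd F (f' y) = ?\<Phi> (bd F (frag_of y))"
          using c[OF y'(2) x] \<Phi>shift[OF y'(2) bd_below[OF xA]] by simp
        moreover have "aug F (f' y) = aug F (frag_of y)" if "m = 0"
          unfolding yx unfolding y'(1) top[OF x]
          using c[OF y'(2) x] aug_equivariant[OF y'(2), of "c g x"]
            aug_equivariant[OF y'(2), of "frag_of (\<one>, x)"] xA cA that by simp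
        moreover have "f' y \<in> Ch m"
          unfolding y'(1) top[OF x] using cA y' by (intro translate_Ch)
        ultimately show ?thesis using eb jm by auto
      qed
    qed
    moreover have "pushing (Suc m) w f'"
      unfolding pushing_def
    proof
      fix y assume y: "y \<in> carrier G \<times> below (Suc m)"
      then obtain g x where y': "y = (g, x)" "g \<in> carrier G" "x \<in> below (Suc m)" by blast
      show "high w (w y + 1) (f' y)"
      proof (cases "x \<in> below m")
        case True
        \<comment> \<open>N pushes gain N, and N is at least 1, so the power still pushes by
          1.\<close>
        have "high w (w y + real N) (?\<Phi> (frag_of y))"
          using high_funpow[of w "w y" "frag_of y" G "below m" f N, OF _ _ fpush] True y' by auto
        then show ?thesis using N True by (auto simp: f'_def y' elim: high_mono)
      next
        case False
        then have x: "x \<in> gens F m" using y' by (simp add: below_Suc)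
        show ?thesis
          unfolding y'(1) top[OF x] using c[OF y'(2) x] y'(2)
          by (intro high_translate) (simp add: weight_shift_id)
      qed
    qed
    ultimately show "\<exists>f. value_map G (below (Suc m)) C2 f \<and> chain_map_below (Suc m) f \<and>
        pushing (Suc m) w f" by blast
  qed
qed

lemma uniform_push:
  assumes "m \<le> Suc n"
  shows "\<exists>\<V>\<in>nb. \<exists>C. (\<forall>x\<in>below m. finite (C x) \<and> C x \<subseteq> free_module G (below m)) \<and>
    (\<forall>w\<in>\<V>. \<exists>f. value_map G (below m) C f \<and> chain_map_below m f \<and> pushing m w f)"
  using assms
proof (induction m)
  case 0
  \<comment> \<open>With no cells to compare, \<open>approximation\<close> says that there is a
    neighbourhood at all.\<close>
  obtain \<V> where "\<V> \<in> nb" using approximation[of "\<lambda>_. {}"] by blast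
  then show ?case
    by (intro bexI[of _ \<V>]) (auto simp: below_def value_map_def chain_map_below_def pushing_def)
next
  case (Suc m)
  then obtain \<V> C where *: "\<V> \<in> nb" "\<forall>x\<in>below m. finite (C x) \<and> C x \<subseteq> free_module G (below m)"
    "\<forall>w\<in>\<V>. \<exists>f. value_map G (below m) C f \<and> chain_map_below m f \<and> pushing m w f" by auto
  show ?case by (rule uniform_push_step[of m \<V> C]) (use Suc.prems * in auto)
qed

text \<open>The lag becomes a constant: a pushing map never lowers the cycle, so every term of its
  trace under the homotopy loses at most r, however many terms there are.\<close>

theorem uniformly_controlled:
  "\<exists>\<V>\<in>nb. \<forall>w\<in>\<V>. \<exists>r. (\<forall>a s. \<exists>c\<in>Ch 0. aug F c = a \<and> high w s c) \<and>
    (\<forall>i<n. \<forall>s. \<forall>z\<in>cycles G F i. high w s z \<longrightarrow>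
      (\<exists>c\<in>Ch (Suc i). bd F c = z \<and> high w (s - r) c))"
proof -
  obtain \<V>1 C where V1: "\<V>1 \<in> nb"
    and C: "\<And>x. x \<in> below (Suc n) \<Longrightarrow> finite (C x) \<and> C x \<subseteq> free_module G (below (Suc n))"
    and push: "\<And>w. w \<in> \<V>1 \<Longrightarrow> \<exists>f. value_map G (below (Suc n)) C f \<and> chain_map_below (Suc n) f \<and>
      pushing (Suc n) w f"
    using uniform_push[of "Suc n"] by blast
  have CT: "finite (C x) \<and> C x \<subseteq> Tot" if "x \<in> below n" for x
    using C[of x] that below_subset_Tot[of "Suc n"] below_mono[of n "Suc n"] by auto
  obtain D where D: "\<And>x. x \<in> below n \<Longrightarrow> finite (D x) \<and> D x \<subseteq> Tot"
    and De: "\<And>f. value_map G (below n) C f \<Longrightarrow> chain_map_below n f \<Longrightarrow>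
      \<exists>e. value_map G (below n) D e \<and> homotopy_below n f e"
    using homotopy_exists[of n C, OF CT] by blast
  have sub: "below n \<subseteq> (\<Union>k. gens F k)" by (auto simp: below_def)
  have fin: "finite (below n)" by (rule finite_below) simp
  then obtain \<V>2 r where V2: "\<V>2 \<in> nb"
    "\<And>w x c. w \<in> \<V>2 \<Longrightarrow> x \<in> below n \<Longrightarrow> c \<in> D x \<Longrightarrow> high w (w (\<one>, x) - r) c"
    using bounded_displacement[where D = D, OF fin sub D] by blast
  obtain \<U> where U: "\<U> \<in> nb" "\<U> \<subseteq> \<V>1 \<inter> \<V>2" using nb_directed[OF V1 V2(1)] by blast
  show ?thesis
  proof (intro bexI[OF _ U(1)] ballI exI[of _ r] conjI allI impI)
    fix w assume w: "w \<in> \<U>"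
    obtain f where f: "value_map G (below (Suc n)) C f" "chain_map_below (Suc n) f" "pushing (Suc n) w f"
      using push w U by blast
    have fpush: "f y \<in> free_module G (below (Suc n)) \<and> high w (w y + 1) (f y)"
      if "y \<in> carrier G \<times> below (Suc n)" for y
      using f(3) that value_map_in_free_module[OF f(1) that, of "below (Suc n)"] C
      by (auto simp: pushing_def)
    have pushed: "\<exists>N. high w s ((frag_extend f ^^ N) c)" if "c \<in> Ch j" "j \<le> n" for c j s
    proof -
      obtain s0 where s0: "high w s0 c" using high_exists by blast
      obtain N :: nat where "s - s0 \<le> real N" using real_arch_simple by blast
      moreover have "c \<in> free_module G (below (Suc n))" using that Ch_subset_below[of j "Suc n"] by auto
      ultimately have "high w s ((frag_extend f ^^ N) c)"
        using high_funpow[OF s0 _ fpush, of N] by (auto elim!: high_mono)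
      then show ?thesis ..
    qed
    show "\<exists>c\<in>Ch 0. aug F c = a \<and> high w s c" for a s
    proof -
      have "a \<in> aug F ` Ch 0" by (simp add: aug_surj)
      then obtain c where c: "c \<in> Ch 0" "aug F c = a" by blast
      obtain N where "high w s ((frag_extend f ^^ N) c)" using pushed[OF c(1)] by blast
      then show ?thesis using chain_map_below_funpow[OF f(2) _ c(1), of N] c(2) by auto
    qed
    fix i s z assume i: "i < n" and z: "z \<in> cycles G F i" "high w s z"
    have fn: "value_map G (below n) C f" "chain_map_below n f"
      using f(1) chain_map_below_mono[OF f(2), of n] by (auto simp: value_map_def below_Suc)
    obtain e where e: "value_map G (below n) D e" "homotopy_below n f e" using De[OF fn] by blast
    obtain c where c: "c \<in> Ch (Suc i)" "bd F c = z" using z(1) unfolding bd_image[symmetric] by blast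
    \<comment> \<open>The initial filling \<open>c\<close> may be arbitrarily low. The number of
      pushes depends on it, but the final bound does not.\<close>
    obtain N where N: "high w (s - r) ((frag_extend f ^^ N) c)"
      using pushed[OF c(1), of "s - r"] i by auto
    let ?\<Phi> = "\<lambda>j. (frag_extend f ^^ j) z"
    let ?s = "\<Sum>j<N. frag_extend e (?\<Phi> j)"
    have \<Phi>: "?\<Phi> j \<in> Ch i" "bd F (?\<Phi> j) = 0" for j
      using chain_map_below_funpow[OF fn(2) i cycles_Ch[OF z(1)], of j] bd_cycle[OF z(1)] by auto
    have E: "frag_extend e (?\<Phi> j) \<in> Ch (Suc i)"
      "bd F (frag_extend e (?\<Phi> j)) = ?\<Phi> (Suc j) - ?\<Phi> j" for j
      using homotopy_below_chain[OF e(2) i \<Phi>(1)[of j]] \<Phi>(2)[of j] by auto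
    have sCh: "?s \<in> Ch (Suc i)" using E(1) unfolding chains_deg_def by (intro free_module_sum) blast
    have "bd F ?s = (\<Sum>j<N. bd F (frag_extend e (?\<Phi> j)))"
      using E(1) Ch_subset_Tot by (intro bd_sum) blast
    also have "\<dots> = ?\<Phi> N - ?\<Phi> 0" unfolding E(2) by (rule sum_lessThan_telescope)
    finally have bds: "bd F ?s = ?\<Phi> N - z" by simp
    have \<Phi>c: "(frag_extend f ^^ N) c \<in> Ch (Suc i)" "bd F ((frag_extend f ^^ N) c) = ?\<Phi> N"
      using chain_map_below_funpow[OF f(2) _ c(1), of N] i c(2) by auto
    have "(frag_extend f ^^ N) c \<in> Tot" "?s \<in> Tot" using \<Phi>c(1) sCh Ch_subset_Tot by blast+
    then have "bd F ((frag_extend f ^^ N) c - ?s) = z" by (simp add: bd_diff \<Phi>c bds)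
    moreover have "high w (s - r) ?s"
    proof (rule high_sum)
      fix j
      have zB: "?\<Phi> j \<in> free_module G (below n)" "z \<in> free_module G (below (Suc n))"
        using \<Phi>(1)[of j] cycles_Ch[OF z(1)] Ch_subset_below[of i n] Ch_subset_below[of i "Suc n"] i by auto
      have "high w s (?\<Phi> j)"
        using high_funpow[OF z(2) zB(2) fpush, of j] by (auto elim!: high_mono)
      then show "high w (s - r) (frag_extend e (?\<Phi> j))"
        using displacement_homotopy[OF V2(2) V2(1) _ e(1) zB(1)] w U by blast
    qed
    ultimately show "\<exists>c\<in>Ch (Suc i). bd F c = z \<and> high w (s - r) c"
      using \<Phi>c(1) sCh high_diff[OF N] Ch_diff by blast
  qed
qed

end

section \<open>Heights of cells\<close>

lemma Min_image_le:
  fixes f f' :: "'p \<Rightarrow> real"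
  assumes "finite A" "A \<noteq> {}" "finite A'" "\<And>p. p \<in> A \<Longrightarrow> \<exists>p'\<in>A'. f' p' \<le> f p + r"
  shows "Min (f' ` A') \<le> Min (f ` A) + r"
proof -
  have "Min (f ` A) \<in> f ` A" using assms by (intro Min_in) auto
  then obtain p where p: "p \<in> A" "Min (f ` A) = f p" by auto
  obtain p' where p': "p' \<in> A'" "f' p' \<le> f p + r" using assms(4)[OF p(1)] by blast
  have "Min (f' ` A') \<le> f' p'" using assms(3) p'(1) by (intro Min_le) auto
  then show ?thesis using p p' by linarith
qed

lemma hom_Isom_dist:
  assumes "\<rho> \<in> hom G Isom_group" "g \<in> carrier G"
  shows "dist (\<rho> g p) (\<rho> g q) = dist p q"
proof -
  have "\<rho> g \<in> carrier Isom_group" using assms by (auto simp: hom_def)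
  then show ?thesis by (simp add: Isom_group_def)
qed

lemma hom_Isom_mult:
  assumes "\<rho> \<in> hom G Isom_group" "g \<in> carrier G" "h \<in> carrier G"
  shows "\<rho> (g \<otimes>\<^bsub>G\<^esub> h) p = \<rho> g (\<rho> h p)"
  using assms by (simp add: hom_def Isom_group_def)

context group
begin

text \<open>Membership in \<open>hom\<close> provides multiplicativity only; the image of the unit
  is then an idempotent isometry, hence the identity.\<close>

lemma hom_Isom_one:
  assumes "\<rho> \<in> hom G Isom_group"
  shows "\<rho> \<one> p = p"
proof -
  have "dist (\<rho> \<one> (\<rho> \<one> p)) (\<rho> \<one> p) = dist (\<rho> \<one> p) p"
    by (rule hom_Isom_dist[OF assms one_closed])
  moreover have "\<rho> \<one> (\<rho> \<one> p) = \<rho> \<one> p"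
    using hom_Isom_mult[OF assms one_closed one_closed, of p] l_one[OF one_closed] by argo
  ultimately show ?thesis by simp
qed

lemma busemann_translate:
  assumes \<rho>: "\<rho> \<in> hom G Isom_group" and g: "g \<in> carrier G"
  shows "busemann \<gamma> (\<rho> g p) = busemann (\<rho> (inv g) \<circ> \<gamma>) p"
proof -
  have "dist (\<rho> g p) (\<gamma> t) = dist p (\<rho> (inv g) (\<gamma> t))" for t
  proof -
    have "\<rho> g (\<rho> (inv g) (\<gamma> t)) = \<gamma> t"
      using hom_Isom_mult[OF \<rho> g inv_closed[OF g], of "\<gamma> t"] g by (simp add: hom_Isom_one[OF \<rho>])
    then show ?thesis using hom_Isom_dist[OF \<rho> g, of p "\<rho> (inv g) (\<gamma> t)"] by simp
  qed
  then show ?thesis by (simp add: busemann_def)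
qed

end

lemma geodesic_ray_translate:
  assumes "\<rho> \<in> hom G Isom_group" "g \<in> carrier G" "geodesic_ray \<gamma>"
  shows "geodesic_ray (\<rho> g \<circ> \<gamma>)"
  using assms by (simp add: geodesic_ray_def hom_Isom_dist)

text \<open>\<open>pts x\<close> stands for the value of a control map at the basis element \<open>x\<close>.\<close>

definition cell_height ::
  "('x \<Rightarrow> 'm::metric_space set) \<Rightarrow> ('g \<Rightarrow> 'm \<Rightarrow> 'm) \<Rightarrow> (real \<Rightarrow> 'm) \<Rightarrow> 'g \<times> 'x \<Rightarrow> real" where
  "cell_height pts \<rho> \<gamma> = (\<lambda>(g, x). Min (busemann \<gamma> ` \<rho> g ` pts x))"

context based_resolution
begin

lemma control_map_points:
  assumes h: "control_map G F \<rho> h" and x: "x \<in> gens F k"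
  shows "finite (h (frag_of (\<one>, x)))" "h (frag_of (\<one>, x)) \<noteq> {}"
    "g \<in> carrier G \<Longrightarrow> h (frag_of (g, x)) = \<rho> g ` h (frag_of (\<one>, x))"
proof -
  have T: "frag_of (\<one>, x) \<in> Tot" using x by (auto simp: all_chains_def)
  show "finite (h (frag_of (\<one>, x)))" "h (frag_of (\<one>, x)) \<noteq> {}"
    using h x T unfolding control_map_def by blast+
  assume g: "g \<in> carrier G"
  have "h (translate G g (frag_of (\<one>, x))) = \<rho> g ` h (frag_of (\<one>, x))"
    using h g T unfolding control_map_def equivariant_on_def by blast
  then show "h (frag_of (g, x)) = \<rho> g ` h (frag_of (\<one>, x))" using g by simp
qed

lemma cell_height_eq:
  assumes h: "control_map G F \<rho> h" and y: "y \<in> carrier G \<times> (\<Union>k. gens F k)"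
  shows "finite (h (frag_of y))" "h (frag_of y) \<noteq> {}"
    "cell_height (\<lambda>x. h (frag_of (\<one>, x))) \<rho> \<gamma> y = Min (busemann \<gamma> ` h (frag_of y))"
proof -
  obtain g x where gx: "y = (g, x)" by force
  then obtain k where k: "g \<in> carrier G" "x \<in> gens F k" using y by auto
  show "finite (h (frag_of y))" "h (frag_of y) \<noteq> {}"
    "cell_height (\<lambda>x. h (frag_of (\<one>, x))) \<rho> \<gamma> y = Min (busemann \<gamma> ` h (frag_of y))"
    using gx control_map_points(1,2)[OF h k(2)] control_map_points(3)[OF h k(2,1)]
    by (simp_all add: cell_height_def)
qed

lemma valuation_ge_iff_points:
  assumes h: "control_map G F \<rho> h" and c: "c \<in> Tot"
  shows "ereal s \<le> valuation \<gamma> h c \<longleftrightarrow> (\<forall>p\<in>h c. s \<le> busemann \<gamma> p)"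
proof -
  have fin: "finite (h c)" and hc: "h c = (\<Union>y\<in>Poly_Mapping.keys c. h (frag_of y))"
    using h c unfolding control_map_def by blast+
  show ?thesis
  proof (cases "c = 0")
    case True
    then have "h c = {}" using hc by simp
    then show ?thesis using True by (simp add: valuation_def)
  next
    case False
    then obtain y where y: "y \<in> Poly_Mapping.keys c" using keys_eq_empty[of c] by blast
    then have "h (frag_of y) \<noteq> {}"
      using cell_height_eq(2)[OF h] free_module_keys[OF c[unfolded all_chains_def]] by blast
    then have "h c \<noteq> {}" using y unfolding hc by blast
    then show ?thesis using fin False by (simp add: valuation_def)
  qed
qed

text \<open>The bridge from valuations to weights: the value of a control map at a chain is a union
  over the support, so a lower bound can be tested cell by cell.\<close>

lemma valuation_ge_iff:
  assumes h: "control_map G F \<rho> h" and c: "c \<in> Tot"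
  shows "ereal s \<le> valuation \<gamma> h c \<longleftrightarrow> high (cell_height (\<lambda>x. h (frag_of (\<one>, x))) \<rho> \<gamma>) s c"
proof -
  have hc: "h c = (\<Union>y\<in>Poly_Mapping.keys c. h (frag_of y))"
    using h c unfolding control_map_def by blast
  have "(\<forall>p\<in>h (frag_of y). s \<le> busemann \<gamma> p)
      \<longleftrightarrow> s \<le> cell_height (\<lambda>x. h (frag_of (\<one>, x))) \<rho> \<gamma> y" if "y \<in> Poly_Mapping.keys c" for y
    using cell_height_eq[OF h free_module_keys[OF c[unfolded all_chains_def] that]] by simp
  then show ?thesis
    unfolding valuation_ge_iff_points[OF assms] hc high_def by simp
qed

text \<open>The supports of finitely many generators involve finitely many basis elements, and the
  free module on these is a submodule containing the generators, hence everything.\<close>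

lemma finite_gens_of_finitely_generated:
  assumes fg: "finitely_generated G (translate G) (skeleton G F n)" and k: "k \<le> n"
  shows "finite (gens F k)"
proof -
  obtain S where S: "finite S" "S \<subseteq> skeleton G F n"
    and gen: "\<forall>H. S \<subseteq> H \<and> 0 \<in> H \<and> (\<forall>a\<in>H. \<forall>b\<in>H. a - b \<in> H) \<and>
      (\<forall>g\<in>carrier G. \<forall>a\<in>H. translate G g a \<in> H) \<longrightarrow> skeleton G F n \<subseteq> H"
    using fg unfolding finitely_generated_def by (elim exE conjE)
  define X where "X = (\<Union>c\<in>S. snd ` Poly_Mapping.keys c)"
  have "skeleton G F n \<subseteq> free_module G X"
  proof (rule gen[THEN spec, THEN mp], intro conjI)
    show "S \<subseteq> free_module G X"
    proof
      fix c assume c: "c \<in> S"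
      then have "c \<in> skeleton G F n" using S by blast
      then have "Poly_Mapping.keys c \<subseteq> carrier G \<times> UNIV" by (auto simp: skeleton_def free_module_iff)
      moreover have "snd ` Poly_Mapping.keys c \<subseteq> X" using c unfolding X_def by blast
      ultimately show "c \<in> free_module G X" unfolding free_module_iff by fastforce
    qed
  qed (auto intro: free_module_diff translate_in_free_module)
  moreover have "frag_of (\<one>, x) \<in> skeleton G F n" if "x \<in> gens F k" for x
    using that k by (auto simp: skeleton_def)
  ultimately have "frag_of (\<one>, x) \<in> free_module G X" if "x \<in> gens F k" for x
    using that by blast
  then have "gens F k \<subseteq> X" by auto
  moreover have "finite X" using S by (simp add: X_def)
  ultimately show ?thesis by (rule finite_subset)
qed

lemma CA_iff:
  assumes h: "control_map G F \<rho> h"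
  shows "CA G F h \<gamma> m \<longleftrightarrow> (\<exists>\<Lambda>. (\<forall>s. \<Lambda> s \<ge> 0) \<and> filterlim (\<lambda>s. s - \<Lambda> s) at_top at_top \<and>
    (\<forall>s. (\<forall>a. \<exists>c\<in>Ch 0. aug F c = a \<and> high (cell_height (\<lambda>x. h (frag_of (\<one>, x))) \<rho> \<gamma>) (s - \<Lambda> s) c) \<and>
      (\<forall>i<m. \<forall>z\<in>cycles G F i. high (cell_height (\<lambda>x. h (frag_of (\<one>, x))) \<rho> \<gamma>) s z \<longrightarrow>
        (\<exists>c\<in>Ch (Suc i). bd F c = z \<and>
          high (cell_height (\<lambda>x. h (frag_of (\<one>, x))) \<rho> \<gamma>) (s - \<Lambda> s) c))))"
proof -
  let ?H = "high (cell_height (\<lambda>x. h (frag_of (\<one>, x))) \<rho> \<gamma>)"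
  have C: "ereal s \<le> valuation \<gamma> h c \<longleftrightarrow> ?H s c" if "c \<in> Ch i" for c s i
    using valuation_ge_iff[OF h] that Ch_subset_Tot by blast
  have A: "(\<exists>c\<in>Ch 0. aug F c = a \<and> ereal s \<le> valuation \<gamma> h c) \<longleftrightarrow> (\<exists>c\<in>Ch 0. aug F c = a \<and> ?H s c)"
    for a s using C by blast
  have B: "(\<exists>c\<in>Ch (Suc i). bd F c = z \<and> ereal s \<le> valuation \<gamma> h c) \<longleftrightarrow>
      (\<exists>c\<in>Ch (Suc i). bd F c = z \<and> ?H s c)" for i z s using C by blast
  have D: "(\<forall>z\<in>cycles G F i. ereal s \<le> valuation \<gamma> h z \<longrightarrow> Q z) \<longleftrightarrow>
      (\<forall>z\<in>cycles G F i. ?H s z \<longrightarrow> Q z)" for i s Q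
    using C[OF cycles_Ch] by blast
  show ?thesis unfolding CA_def A B D by (rule refl)
qed

end

lemma Min_close:
  fixes f f' :: "'p \<Rightarrow> real"
  assumes "finite A" "A \<noteq> {}" "\<And>p. p \<in> A \<Longrightarrow> \<bar>f p - f' p - \<kappa>\<bar> \<le> r"
  shows "\<bar>Min (f ` A) - Min (f' ` A) - \<kappa>\<bar> \<le> r"
proof -
  have "\<exists>p'\<in>A. f p' \<le> f' p + (\<kappa> + r)" "\<exists>p'\<in>A. f' p' \<le> f p + (r - \<kappa>)" if "p \<in> A" for p
    using assms(3)[OF that] that by (auto intro!: bexI[of _ p])
  then show ?thesis
    using Min_image_le[of A A f "f'" "\<kappa> + r"] Min_image_le[of A A f' f "r - \<kappa>"] assms by fastforce
qed

section \<open>Weights coming from the actions near a given one\<close>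

text \<open>Agreement is required for genuine group elements only. A shifted height function is
  again a height function there, but not necessarily at other arguments.\<close>

definition action_weights ::
  "('g, 'b) monoid_scheme \<Rightarrow> ('x \<Rightarrow> 'm::metric_space set) \<Rightarrow> ('g \<Rightarrow> 'm \<Rightarrow> 'm) set \<Rightarrow> ('g \<times> 'x \<Rightarrow> real) set" where
  "action_weights G pts N = {w. \<exists>\<rho>\<in>N. \<exists>\<gamma>. geodesic_ray \<gamma> \<and>
     (\<forall>y\<in>carrier G \<times> UNIV. w y = cell_height pts \<rho> \<gamma> y)}"

lemma openin_Hom_subset: "openin (Hom_topology G) N \<Longrightarrow> N \<subseteq> hom G Isom_group"
  using openin_subset[of "Hom_topology G" N] by (auto simp: Hom_topology_def)

lemma (in group) shift_action_weights:
  assumes N: "N \<subseteq> hom G Isom_group" and w: "w \<in> action_weights G pts N" and g: "g \<in> carrier G"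
  shows "shift_weight G g w \<in> action_weights G pts N"
proof -
  obtain \<rho> \<gamma> where \<rho>: "\<rho> \<in> N" "geodesic_ray \<gamma>"
    and wy: "\<And>y. y \<in> carrier G \<times> UNIV \<Longrightarrow> w y = cell_height pts \<rho> \<gamma> y"
    using w unfolding action_weights_def by blast
  have hom: "\<rho> \<in> hom G Isom_group" using N \<rho> by blast
  have "shift_weight G g w (h, x) = cell_height pts \<rho> (\<rho> (inv g) \<circ> \<gamma>) (h, x)" if h: "h \<in> carrier G" for h x
  proof -
    have "shift_weight G g w (h, x) = Min ((\<lambda>p. busemann \<gamma> (\<rho> (g \<otimes> h) p)) ` pts x)"
      using wy[of "(g \<otimes> h, x)"] g h by (simp add: shift_weight_def cell_height_def image_image)
    also have "(\<lambda>p. busemann \<gamma> (\<rho> (g \<otimes> h) p)) = (\<lambda>p. busemann (\<rho> (inv g) \<circ> \<gamma>) (\<rho> h p))"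
      by (simp add: hom_Isom_mult[OF hom g h] busemann_translate[OF hom g])
    finally show ?thesis by (simp add: cell_height_def image_image)
  qed
  moreover have "geodesic_ray (\<rho> (inv g) \<circ> \<gamma>)" using geodesic_ray_translate[OF hom _ \<rho>(2)] g by simp
  ultimately show ?thesis using \<rho>(1) unfolding action_weights_def by blast
qed

context proper_CAT0
begin

text \<open>Compactness is applied to the given action alone and yields finitely many reference
  rays. Only then is the neighbourhood chosen: Busemann functions are 1-Lipschitz, so it is enough
  that the finitely many points involved move little.\<close>

lemma action_weights_approximation:
  fixes \<rho> :: "'g \<Rightarrow> 'm \<Rightarrow> 'm" and G :: "('g, 'b) monoid_scheme" and pts :: "'x \<Rightarrow> 'm set"
  assumes \<rho>: "\<rho> \<in> hom G Isom_group"
    and pts: "\<And>x. x \<in> X \<Longrightarrow> finite (pts x) \<and> pts x \<noteq> {}"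
    and S: "\<And>\<gamma>. geodesic_ray \<gamma> \<Longrightarrow> finite (S (cell_height pts \<rho> \<gamma>)) \<and> S (cell_height pts \<rho> \<gamma>) \<subseteq> carrier G \<times> X"
  shows "\<exists>N. openin (Hom_topology G) N \<and> \<rho> \<in> N \<and>
    (\<exists>\<Gamma>\<subseteq>cell_height pts \<rho> ` {\<gamma>. geodesic_ray \<gamma>}. finite \<Gamma> \<and>
      (\<forall>w\<in>action_weights G pts N. \<exists>w0\<in>\<Gamma>. \<exists>\<kappa>. \<forall>y\<in>S w0. \<bar>w y - w0 y - \<kappa>\<bar> \<le> 1))"
proof -
  define S' where "S' \<gamma> = S (cell_height pts \<rho> \<gamma>)" for \<gamma>
  define P where "P \<gamma> = (\<Union>(g, x)\<in>S' \<gamma>. \<rho> g ` pts x)" for \<gamma>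
  have finP: "finite (P \<gamma>)" if "geodesic_ray \<gamma>" for \<gamma>
  proof -
    have "finite (case y of (g, x) \<Rightarrow> \<rho> g ` pts x)" if "y \<in> carrier G \<times> X" for y
      using that pts by auto
    then show ?thesis using S[OF that] unfolding P_def S'_def by (intro finite_UN_I) blast+
  qed
  \<comment> \<open>Of the permitted error 1, one half is for the change of the ray and one half for
    the change of the action.\<close>
  have half: "0 < (1 / 2 :: real)" by simp
  have "\<exists>\<Gamma>. finite \<Gamma> \<and> (\<forall>\<gamma>\<in>\<Gamma>. geodesic_ray \<gamma>) \<and> (\<forall>\<gamma>. geodesic_ray \<gamma> \<longrightarrow>
      (\<exists>\<gamma>0\<in>\<Gamma>. \<exists>\<kappa>. \<forall>p\<in>P \<gamma>0. \<bar>busemann \<gamma> p - busemann \<gamma>0 p - \<kappa>\<bar> < 1 / 2))"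
    by (rule finite_busemann_cover[of P "1 / 2"], erule finP, rule half, blast)
  then obtain \<Gamma> where \<Gamma>: "finite \<Gamma>" "\<And>\<gamma>. \<gamma> \<in> \<Gamma> \<Longrightarrow> geodesic_ray \<gamma>"
    and cover: "\<And>\<gamma>. geodesic_ray \<gamma> \<Longrightarrow>
      \<exists>\<gamma>0\<in>\<Gamma>. \<exists>\<kappa>. \<forall>p\<in>P \<gamma>0. \<bar>busemann \<gamma> p - busemann \<gamma>0 p - \<kappa>\<bar> < 1 / 2"
    by blast
  define T where "T = (\<Union>\<gamma>\<in>\<Gamma>. \<Union>(g, x)\<in>S' \<gamma>. {g} \<times> pts x)"
  have T: "finite T" "T \<subseteq> carrier G \<times> UNIV"
  proof -
    have S': "finite (S' \<gamma>)" "S' \<gamma> \<subseteq> carrier G \<times> X" if "\<gamma> \<in> \<Gamma>" for \<gamma>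
      using S[OF \<Gamma>(2)[OF that]] by (auto simp: S'_def)
    have pt: "finite (case y of (g, x) \<Rightarrow> {g} \<times> pts x)"
      "(case y of (g, x) \<Rightarrow> {g} \<times> pts x) \<subseteq> carrier G \<times> UNIV" if "y \<in> carrier G \<times> X" for y
      using that pts by auto
    show "finite T"
      unfolding T_def
    proof (intro finite_UN_I \<Gamma>(1) S'(1))
      fix \<gamma> y assume "\<gamma> \<in> \<Gamma>" "y \<in> S' \<gamma>"
      then show "finite (case y of (g, x) \<Rightarrow> {g} \<times> pts x)" using S'(2) pt(1) by blast
    qed
    show "T \<subseteq> carrier G \<times> UNIV"
      unfolding T_def
    proof (intro UN_least)
      fix \<gamma> y assume "\<gamma> \<in> \<Gamma>" "y \<in> S' \<gamma>"
      then show "(case y of (g, x) \<Rightarrow> {g} \<times> pts x) \<subseteq> carrier G \<times> UNIV" using S'(2) pt(2) by blast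
    qed
  qed
  define N where "N = {\<rho>' \<in> hom G Isom_group. \<forall>(g, p)\<in>T. dist (\<rho>' g p) (\<rho> g p) < 1 / 2}"
  have "\<exists>\<gamma>0\<in>\<Gamma>. \<exists>\<kappa>. \<forall>y\<in>S' \<gamma>0. \<bar>w y - cell_height pts \<rho> \<gamma>0 y - \<kappa>\<bar> \<le> 1"
    if w: "w \<in> action_weights G pts N" for w
  proof -
    obtain \<rho>' \<gamma> where \<rho>': "\<rho>' \<in> N" "geodesic_ray \<gamma>"
      and wy: "\<And>y. y \<in> carrier G \<times> UNIV \<Longrightarrow> w y = cell_height pts \<rho>' \<gamma> y"
      using w unfolding action_weights_def by blast
    obtain \<gamma>0 \<kappa> where \<gamma>0: "\<gamma>0 \<in> \<Gamma>" "\<And>p. p \<in> P \<gamma>0 \<Longrightarrow> \<bar>busemann \<gamma> p - busemann \<gamma>0 p - \<kappa>\<bar> < 1 / 2"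
      using cover[OF \<rho>'(2)] by blast
    have "\<bar>w (g, x) - cell_height pts \<rho> \<gamma>0 (g, x) - \<kappa>\<bar> \<le> 1" if y: "(g, x) \<in> S' \<gamma>0" for g x
    proof -
      have gx: "g \<in> carrier G" "x \<in> X" using S[OF \<Gamma>(2)[OF \<gamma>0(1)]] y unfolding S'_def by auto
      have "\<bar>busemann \<gamma> (\<rho>' g p) - busemann \<gamma>0 (\<rho> g p) - \<kappa>\<bar> \<le> 1" if p: "p \<in> pts x" for p
      proof -
        have "(g, p) \<in> T" using y \<gamma>0(1) p unfolding T_def by blast
        then have "dist (\<rho>' g p) (\<rho> g p) < 1 / 2" using \<rho>'(1) by (auto simp: N_def)
        then have "\<bar>busemann \<gamma> (\<rho>' g p) - busemann \<gamma> (\<rho> g p)\<bar> < 1 / 2"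
          using busemann_lipschitz[OF \<rho>'(2), of "\<rho>' g p" "\<rho> g p"] by linarith
        moreover have "\<rho> g p \<in> P \<gamma>0" using y p unfolding P_def by blast
        then have "\<bar>busemann \<gamma> (\<rho> g p) - busemann \<gamma>0 (\<rho> g p) - \<kappa>\<bar> < 1 / 2" by (rule \<gamma>0(2))
        ultimately show ?thesis by linarith
      qed
      then have "\<bar>Min ((\<lambda>p. busemann \<gamma> (\<rho>' g p)) ` pts x) - Min ((\<lambda>p. busemann \<gamma>0 (\<rho> g p)) ` pts x) - \<kappa>\<bar> \<le> 1"
        using pts[OF gx(2)] by (intro Min_close) auto
      then show ?thesis using wy[of "(g, x)"] gx by (simp add: cell_height_def image_image)
    qed
    then show ?thesis using \<gamma>0(1) by (intro bexI[of _ \<gamma>0] exI[of _ \<kappa>]) auto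
  qed
  moreover have "openin (Hom_topology G) N" unfolding N_def using T by (rule openin_Hom_near)
  moreover have "\<rho> \<in> N" using \<rho> by (auto simp: N_def)
  ultimately show ?thesis
    using \<Gamma> unfolding S'_def
    by (intro exI[of _ N] conjI exI[of _ "cell_height pts \<rho> ` \<Gamma>"]) (blast | simp)+
qed

end

section \<open>Change of the control map and stability of the first invariant\<close>

lemma finite_dist_bound:
  assumes "finite A" "finite B"
  shows "\<exists>r. \<forall>p\<in>A. \<forall>q\<in>B. dist p q \<le> r"
proof -
  have "dist p q \<le> Max (insert 0 ((\<lambda>(p, q). dist p q) ` (A \<times> B)))" if "p \<in> A" "q \<in> B" for p q
    using assms that by (intro Max_ge) force+
  then show ?thesis by blast
qed

text \<open>The group acts by isometries, so the distance between two choices of points at x bounds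
  the difference of heights at all translates gx and for all rays.\<close>

lemma cell_height_change_points:
  fixes pts pts' :: "'x \<Rightarrow> 'm::metric_space set"
  assumes \<rho>: "\<rho> \<in> hom G Isom_group" and \<gamma>: "geodesic_ray \<gamma>" and g: "g \<in> carrier G"
    and pts: "finite (pts x)" "pts x \<noteq> {}" "finite (pts' x)" "pts' x \<noteq> {}"
    and r: "\<And>p p'. p \<in> pts x \<Longrightarrow> p' \<in> pts' x \<Longrightarrow> dist p p' \<le> r"
  shows "\<bar>cell_height pts \<rho> \<gamma> (g, x) - cell_height pts' \<rho> \<gamma> (g, x)\<bar> \<le> r"
proof -
  have *: "\<bar>busemann \<gamma> (\<rho> g p) - busemann \<gamma> (\<rho> g p')\<bar> \<le> r" if "p \<in> pts x" "p' \<in> pts' x" for p p'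
    using busemann_lipschitz[OF \<gamma>, of "\<rho> g p" "\<rho> g p'"] r[OF that] hom_Isom_dist[OF \<rho> g, of p p'] by linarith
  obtain q q' where q: "q \<in> pts x" "q' \<in> pts' x" using pts by blast
  have "Min ((\<lambda>p. busemann \<gamma> (\<rho> g p)) ` pts x) \<le> Min ((\<lambda>p. busemann \<gamma> (\<rho> g p)) ` pts' x) + r"
  proof (rule Min_image_le)
    show "\<exists>p'\<in>pts x. busemann \<gamma> (\<rho> g p') \<le> busemann \<gamma> (\<rho> g p) + r" if "p \<in> pts' x" for p
      using *[OF q(1) that] q(1) by (intro bexI[of _ q]) linarith
  qed (use pts in auto)
  moreover have "Min ((\<lambda>p. busemann \<gamma> (\<rho> g p)) ` pts' x) \<le> Min ((\<lambda>p. busemann \<gamma> (\<rho> g p)) ` pts x) + r"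
  proof (rule Min_image_le)
    show "\<exists>p'\<in>pts' x. busemann \<gamma> (\<rho> g p') \<le> busemann \<gamma> (\<rho> g p) + r" if "p \<in> pts x" for p
      using *[OF that q(2)] q(2) by (intro bexI[of _ q']) linarith
  qed (use pts in auto)
  ultimately show ?thesis by (simp add: cell_height_def image_image abs_le_iff)
qed

lemma high_change_weight:
  assumes "high w s c" "\<And>y. y \<in> Poly_Mapping.keys c \<Longrightarrow> \<bar>w y - w' y\<bar> \<le> r"
  shows "high w' (s - r) c"
  unfolding high_def
proof
  fix y assume y: "y \<in> Poly_Mapping.keys c"
  then have "s \<le> w y" using assms(1) by (simp add: high_def)
  then show "s - r \<le> w' y" using assms(2)[OF y] by linarith
qed

locale controlled_action = based_resolution G act F + proper_CAT0 M
  for G (structure) and act :: "'g \<Rightarrow> 'a::ab_group_add \<Rightarrow> 'a" and F :: "('g, 'x, 'a) resolution"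
    and M :: "'m::metric_space itself" +
  fixes n :: nat and \<rho> :: "'g \<Rightarrow> 'm \<Rightarrow> 'm" and h :: "('g, 'x) chain \<Rightarrow> 'm set"
  assumes fg: "finitely_generated G (translate G) (skeleton G F n)"
    and action: "\<rho> \<in> hom G Isom_group"
    and control: "control_map G F \<rho> h"
begin

abbreviation "points x \<equiv> h (frag_of (\<one>, x))"

lemma finite_below_n: "finite (below (Suc n))"
  using finite_gens_of_finitely_generated[OF fg] by (auto simp: below_def)

lemma finite_points:
  assumes "x \<in> (\<Union>k. gens F k)"
  shows "finite (points x)" "points x \<noteq> {}"
  using assms control_map_points[OF control] by blast+

text \<open>The weight comes from the points of \<open>h\<close> moved by the new action, whereas
  the conclusion concerns an arbitrary control map of that action. Up to degree n the two heights
  differ by a bounded amount.\<close>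

lemma CA_of_uniform_control:
  assumes \<rho>': "\<rho>' \<in> hom G Isom_group" and h': "control_map G F \<rho>' h'" and \<gamma>: "geodesic_ray \<gamma>"
    and w: "\<And>y. y \<in> carrier G \<times> UNIV \<Longrightarrow> w y = cell_height points \<rho>' \<gamma> y"
    and lift: "\<And>a s. \<exists>c\<in>Ch 0. aug F c = a \<and> high w s c"
    and fill: "\<And>i s z. i < n \<Longrightarrow> z \<in> cycles G F i \<Longrightarrow> high w s z \<Longrightarrow>
      \<exists>c\<in>Ch (Suc i). bd F c = z \<and> high w (s - r) c"
    and m: "m \<le> n"
  shows "CA G F h' \<gamma> m"
proof -
  let ?w' = "cell_height (\<lambda>x. h' (frag_of (\<one>, x))) \<rho>' \<gamma>"
  have sub: "below (Suc n) \<subseteq> (\<Union>k. gens F k)" by (auto simp: below_def)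
  define A where "A = (\<Union>x\<in>below (Suc n). points x)"
  define A' where "A' = (\<Union>x\<in>below (Suc n). h' (frag_of (\<one>, x)))"
  have pts': "finite (h' (frag_of (\<one>, x)))" "h' (frag_of (\<one>, x)) \<noteq> {}" if "x \<in> below (Suc n)" for x
    using that sub control_map_points[OF h'] by blast+
  have pts: "finite (points x)" "points x \<noteq> {}" if "x \<in> below (Suc n)" for x
    using that sub finite_points by blast+
  have "finite A" "finite A'" using finite_below_n pts pts' by (auto simp: A_def A'_def)
  then have "\<exists>d. \<forall>p\<in>A. \<forall>p'\<in>A'. dist p p' \<le> d" by (rule finite_dist_bound)
  then obtain d where d: "\<forall>p\<in>A. \<forall>p'\<in>A'. dist p p' \<le> d" ..
  have close: "\<bar>w y - ?w' y\<bar> \<le> d" if "y \<in> carrier G \<times> below (Suc n)" for y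
  proof -
    obtain g x where y: "y = (g, x)" "g \<in> carrier G" "x \<in> below (Suc n)" using \<open>y \<in> _\<close> by blast
    have "\<bar>cell_height points \<rho>' \<gamma> (g, x) - ?w' (g, x)\<bar> \<le> d"
      using d y(3) by (intro cell_height_change_points[OF \<rho>' \<gamma> y(2)] pts pts' y(3)) (auto simp: A_def A'_def)
    then show ?thesis using w[of y] y by simp
  qed
  have closeCh: "\<bar>w y - ?w' y\<bar> \<le> d" "\<bar>?w' y - w y\<bar> \<le> d"
    if "c \<in> Ch i" "i \<le> n" "y \<in> Poly_Mapping.keys c" for c i y
  proof -
    have "c \<in> free_module G (below (Suc n))" using that Ch_subset_below[of i "Suc n"] by auto
    then have "y \<in> carrier G \<times> below (Suc n)" using that(3) by (rule free_module_keys)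
    then show "\<bar>w y - ?w' y\<bar> \<le> d" by (rule close)
    then show "\<bar>?w' y - w y\<bar> \<le> d" by linarith
  qed
  \<comment> \<open>One \<open>d\<close> for replacing \<open>h'\<close> by the points of
    \<open>h\<close>, \<open>r\<close> for the filling, and one \<open>d\<close> for the way back;
    the maximum ensures that the lag is nonnegative.\<close>
  define L where "L = max 0 (d + r + d)"
  show ?thesis
    unfolding CA_iff[OF h']
  proof (intro exI[of _ "\<lambda>_. L"] conjI allI impI ballI)
    show "0 \<le> L" by (simp add: L_def)
    show "filterlim (\<lambda>s. s - L) at_top at_top"
      using filterlim_tendsto_add_at_top[OF tendsto_const[of "- L"] filterlim_ident] by simp
    fix s
    show "\<exists>c\<in>Ch 0. aug F c = a \<and> high ?w' (s - L) c" for a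
    proof -
      obtain c where c: "c \<in> Ch 0" "aug F c = a" "high w (s - L + d) c" using lift by blast
      have "high ?w' (s - L + d - d) c"
        using c(3) by (rule high_change_weight) (use closeCh(1)[OF c(1)] in simp)
      then show ?thesis using c by auto
    qed
    fix i z assume i: "i < m" and z: "z \<in> cycles G F i" "high ?w' s z"
    have "high w (s - d) z"
      using z(2) by (rule high_change_weight) (use closeCh(2)[OF cycles_Ch[OF z(1)]] i m in simp)
    then obtain c where c: "c \<in> Ch (Suc i)" "bd F c = z" "high w (s - d - r) c"
      using fill[of i z "s - d"] z(1) i m by auto
    have "high ?w' (s - d - r - d) c"
      using c(3) by (rule high_change_weight) (use closeCh(1)[OF c(1)] i m in simp)
    then have "high ?w' (s - L) c" by (rule high_mono) (simp add: L_def)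
    then show "\<exists>c\<in>Ch (Suc i). bd F c = z \<and> high ?w' (s - L) c" using c by blast
  qed
qed

text \<open>Control is known for the weights of \<rho> only and is obtained for the weights of all
  actions in a neighbourhood. As every ray represents some end, the hypothesis covers all of
  \<open>V0\<close>.\<close>

theorem Sigma_inv_stable:
  assumes all: "Sigma_inv n G F h = ideal_boundary"
  shows "\<exists>N. openin (Hom_topology G) N \<and> \<rho> \<in> N \<and>
    (\<forall>\<rho>'\<in>N. \<forall>h'. control_map G F \<rho>' h' \<longrightarrow> Sigma_inv n G F h' = ideal_boundary)"
proof -
  define V0 where "V0 = cell_height points \<rho> ` {\<gamma>. geodesic_ray \<gamma>}"
  define nb where "nb = {action_weights G points N | N. openin (Hom_topology G) N \<and> \<rho> \<in> N}"
  interpret W: weighted_resolution G act F n V0 nb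
  proof unfold_locales
    show "finite (gens F k)" if "k \<le> n" for k
      using finite_gens_of_finitely_generated[OF fg that] .
  next
    fix \<V> :: "('g \<times> 'x \<Rightarrow> real) set" and w g
    assume "\<V> \<in> nb" "w \<in> \<V>" "g \<in> carrier G"
    then show "shift_weight G g w \<in> \<V>"
      unfolding nb_def using shift_action_weights openin_Hom_subset by blast
  next
    fix \<V> \<W> :: "('g \<times> 'x \<Rightarrow> real) set"
    assume "\<V> \<in> nb" "\<W> \<in> nb"
    then obtain N N' where N: "\<V> = action_weights G points N" "\<W> = action_weights G points N'"
      "openin (Hom_topology G) N" "openin (Hom_topology G) N'" "\<rho> \<in> N" "\<rho> \<in> N'"
      unfolding nb_def by blast
    have "action_weights G points (N \<inter> N') \<in> nb" using N unfolding nb_def by blast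
    moreover have "action_weights G points (N \<inter> N') \<subseteq> \<V> \<inter> \<W>"
      unfolding N(1,2) action_weights_def by blast
    ultimately show "\<exists>\<U>\<in>nb. \<U> \<subseteq> \<V> \<inter> \<W>" by blast
  next
    fix S :: "('g \<times> 'x \<Rightarrow> real) \<Rightarrow> ('g \<times> 'x) set"
    assume S: "\<And>w. w \<in> V0 \<Longrightarrow> finite (S w) \<and> S w \<subseteq> carrier G \<times> (\<Union>k. gens F k)"
    have "\<exists>N. openin (Hom_topology G) N \<and> \<rho> \<in> N \<and>
      (\<exists>\<Gamma>\<subseteq>cell_height points \<rho> ` {\<gamma>. geodesic_ray \<gamma>}. finite \<Gamma> \<and>
        (\<forall>w\<in>action_weights G points N. \<exists>w0\<in>\<Gamma>. \<exists>\<kappa>. \<forall>y\<in>S w0. \<bar>w y - w0 y - \<kappa>\<bar> \<le> 1))"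
    proof (rule action_weights_approximation[OF action])
      show "finite (points x) \<and> points x \<noteq> {}" if "x \<in> (\<Union>k. gens F k)" for x
        using finite_points[OF that] by blast
      show "finite (S (cell_height points \<rho> \<gamma>)) \<and> S (cell_height points \<rho> \<gamma>) \<subseteq> carrier G \<times> (\<Union>k. gens F k)"
        if "geodesic_ray \<gamma>" for \<gamma>
        using that by (intro S) (simp add: V0_def)
    qed
    then obtain N \<Gamma> where N: "openin (Hom_topology G) N" "\<rho> \<in> N" and \<Gamma>: "\<Gamma> \<subseteq> V0" "finite \<Gamma>"
      "\<forall>w\<in>action_weights G points N. \<exists>w0\<in>\<Gamma>. \<exists>\<kappa>. \<forall>y\<in>S w0. \<bar>w y - w0 y - \<kappa>\<bar> \<le> 1"
      unfolding V0_def by blast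
    have "action_weights G points N \<in> nb" using N unfolding nb_def by blast
    then show "\<exists>\<V>\<in>nb. \<exists>\<Gamma>\<subseteq>V0. finite \<Gamma> \<and>
        (\<forall>w\<in>\<V>. \<exists>w0\<in>\<Gamma>. \<exists>\<kappa>. \<forall>y\<in>S w0. \<bar>w y - w0 y - \<kappa>\<bar> \<le> 1)"
      using \<Gamma> by blast
  next
    fix w assume "w \<in> V0"
    then obtain \<gamma> where \<gamma>: "geodesic_ray \<gamma>" "w = cell_height points \<rho> \<gamma>" by (auto simp: V0_def)
    obtain \<xi> where "\<xi> \<in> ideal_boundary" "\<gamma> \<in> \<xi>" using ideal_boundary_class[OF \<gamma>(1)] .
    then have "CA G F h \<gamma> n" using all unfolding Sigma_inv_def by blast
    then show "\<exists>\<Lambda>. filterlim (\<lambda>s. s - \<Lambda> s) at_top at_top \<and>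
      (\<forall>s. (\<forall>a. \<exists>c\<in>Ch 0. aug F c = a \<and> high w (s - \<Lambda> s) c) \<and>
        (\<forall>i<n. \<forall>z\<in>cycles G F i. high w s z \<longrightarrow>
          (\<exists>c\<in>Ch (Suc i). bd F c = z \<and> high w (s - \<Lambda> s) c)))"
      unfolding CA_iff[OF control] \<gamma>(2) by blast
  qed
  obtain N where N: "openin (Hom_topology G) N" "\<rho> \<in> N"
    and unif: "\<forall>w\<in>action_weights G points N. \<exists>r. (\<forall>a s. \<exists>c\<in>Ch 0. aug F c = a \<and> high w s c) \<and>
      (\<forall>i<n. \<forall>s. \<forall>z\<in>cycles G F i. high w s z \<longrightarrow>
        (\<exists>c\<in>Ch (Suc i). bd F c = z \<and> high w (s - r) c))"
    using W.uniformly_controlled unfolding nb_def by blast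
  have "Sigma_inv n G F h' = ideal_boundary" if \<rho>': "\<rho>' \<in> N" and h': "control_map G F \<rho>' h'" for \<rho>' h'
  proof -
    have "CA G F h' \<gamma> m" if e: "e \<in> ideal_boundary" "\<gamma> \<in> e" and m: "m \<le> n" for e \<gamma> m
    proof -
      have \<gamma>: "geodesic_ray \<gamma>" using ideal_boundaryD(2)[OF e] .
      define w where "w = cell_height points \<rho>' \<gamma>"
      have "w \<in> action_weights G points N" using \<rho>' \<gamma> unfolding action_weights_def w_def by blast
      then obtain r where "\<forall>a s. \<exists>c\<in>Ch 0. aug F c = a \<and> high w s c"
        "\<forall>i<n. \<forall>s. \<forall>z\<in>cycles G F i. high w s z \<longrightarrow>
          (\<exists>c\<in>Ch (Suc i). bd F c = z \<and> high w (s - r) c)"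
        using unif by blast
      then show ?thesis
        using openin_Hom_subset[OF N(1)] \<rho>'
        by (intro CA_of_uniform_control[OF _ h' \<gamma> _ _ _ m, of w r]) (auto simp: w_def)
    qed
    then show ?thesis unfolding Sigma_inv_def by blast
  qed
  then show ?thesis using N by blast
qed

section \<open>Openness in the Tits topology\<close>

lemma skeleton_additive_expansion:
  assumes "additive_on (skeleton G F n) \<phi>" "c \<in> skeleton G F n"
  shows "\<phi> c = frag_extend (\<lambda>y. \<phi> (frag_of y)) c"
  using assms unfolding skeleton_def by (rule additive_on_frag_extend)

text \<open>By equivariance of \<Phi> the value at gx is the g-translate of one of finitely many
  chains attached to x, and isometries preserve the distances measured at x.\<close>

lemma finitary_displacement:
  assumes "finitary G (translate G) (skeleton G F n) (translate G) (skeleton G F n) \<phi>"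
  shows "\<exists>r>0. \<forall>y\<in>carrier G \<times> below (Suc n). \<forall>p\<in>h (\<phi> (frag_of y)). \<forall>q\<in>h (frag_of y). dist q p \<le> r"
proof -
  obtain \<Phi> where equiv: "equivariant_on G (translate G) (\<lambda>g. image (translate G g)) (skeleton G F n) \<Phi>"
    and \<Phi>: "\<forall>b\<in>skeleton G F n. finite (\<Phi> b) \<and> \<Phi> b \<subseteq> skeleton G F n \<and> \<phi> b \<in> \<Phi> b"
    using assms unfolding finitary_def by blast
  have gen: "frag_of (\<one>, x) \<in> skeleton G F n" if "x \<in> below (Suc n)" for x
    using that by (simp add: skeleton_eq)
  define B where "B = (\<Union>x\<in>below (Suc n). \<Union>b\<in>\<Phi> (frag_of (\<one>, x)). h b)"
  define A where "A = (\<Union>x\<in>below (Suc n). points x)"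
  have sub: "below (Suc n) \<subseteq> (\<Union>k. gens F k)" by (auto simp: below_def)
  have finh: "finite (h b)" if "b \<in> skeleton G F n" for b
    using that below_subset_Tot control unfolding skeleton_eq control_map_def by blast
  have "finite B"
    unfolding B_def using finite_below_n
  proof (intro finite_UN_I)
    show "finite (\<Phi> (frag_of (\<one>, x)))" if "x \<in> below (Suc n)" for x using \<Phi> gen[OF that] by blast
    show "finite (h b)" if "x \<in> below (Suc n)" "b \<in> \<Phi> (frag_of (\<one>, x))" for x b
      using \<Phi> gen[OF that(1)] that(2) finh by blast
  qed
  moreover have "finite A" unfolding A_def using finite_below_n finite_points(1) sub by blast
  ultimately have "\<exists>r. \<forall>q\<in>A. \<forall>p\<in>B. dist q p \<le> r" by (intro finite_dist_bound)
  then obtain r where r: "\<forall>q\<in>A. \<forall>p\<in>B. dist q p \<le> r" ..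
  have "dist q p \<le> r"
    if y: "y \<in> carrier G \<times> below (Suc n)" and p: "p \<in> h (\<phi> (frag_of y))" and q: "q \<in> h (frag_of y)" for y p q
  proof -
    obtain g x where gx: "y = (g, x)" "g \<in> carrier G" "x \<in> below (Suc n)" using y by blast
    have y': "frag_of y = translate G g (frag_of (\<one>, x))" using gx by simp
    have "frag_of y \<in> skeleton G F n" using y by (simp add: skeleton_eq)
    then have "\<phi> (frag_of y) \<in> \<Phi> (frag_of y)" using \<Phi> by blast
    also have "\<Phi> (frag_of y) = translate G g ` \<Phi> (frag_of (\<one>, x))"
      unfolding y' using equiv gx(2) gen[OF gx(3)] unfolding equivariant_on_def by blast
    finally obtain b where b: "b \<in> \<Phi> (frag_of (\<one>, x))" "\<phi> (frag_of y) = translate G g b" by blast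
    have "b \<in> Tot" using b(1) \<Phi> gen[OF gx(3)] below_subset_Tot unfolding skeleton_eq by blast
    then have "h (\<phi> (frag_of y)) = \<rho> g ` h b"
      unfolding b(2) using control gx(2) unfolding control_map_def equivariant_on_def by blast
    then obtain p0 where p0: "p0 \<in> h b" "p = \<rho> g p0" using p by blast
    obtain k where k: "x \<in> gens F k" using gx(3) sub by blast
    have "h (frag_of y) = \<rho> g ` points x"
      using control_map_points(3)[OF control k gx(2)] gx(1) by simp
    then obtain q0 where q0: "q0 \<in> points x" "q = \<rho> g q0" using q by blast
    have "p0 \<in> B" "q0 \<in> A" using p0 q0 b gx unfolding A_def B_def by blast+
    then show ?thesis using r hom_Isom_dist[OF action gx(2)] unfolding p0(2) q0(2) by simp
  qed
  then have "\<forall>y\<in>carrier G \<times> below (Suc n). \<forall>p\<in>h (\<phi> (frag_of y)). \<forall>q\<in>h (frag_of y). dist q p \<le> max 1 r"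
    by (meson le_max_iff_disj)
  then show ?thesis by (intro exI[of _ "max 1 r"]) auto
qed

text \<open>By additivity the infimum over all chains is decided on the cells. Speaking of points
  instead of valuations also covers cells sent to 0, where the valuation is infinite and the set of
  points empty.\<close>

lemma gsh_ge_iff:
  assumes \<phi>: "additive_on (skeleton G F n) \<phi>" and mem: "\<forall>c\<in>skeleton G F n. \<phi> c \<in> skeleton G F n"
  shows "ereal \<delta> \<le> gsh G F n h \<gamma> \<phi> \<longleftrightarrow> (\<forall>y\<in>carrier G \<times> below (Suc n). \<forall>p\<in>h (\<phi> (frag_of y)).
    Min (busemann \<gamma> ` h (frag_of y)) + \<delta> \<le> busemann \<gamma> p)"
proof -
  let ?w = "cell_height points \<rho> \<gamma>"
  have sub: "skeleton G F n \<subseteq> Tot" unfolding skeleton_eq by (rule below_subset_Tot)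
  have sub': "below (Suc n) \<subseteq> (\<Union>k. gens F k)" by (auto simp: below_def)
  have val: "\<exists>v. valuation \<gamma> h c = ereal v" if "c \<noteq> 0" for c using that by (simp add: valuation_def)
  have diff: "ereal \<delta> \<le> a - ereal v \<longleftrightarrow> ereal (v + \<delta>) \<le> a" for a v
    by (cases a) (auto simp: algebra_simps)
  have gen: "frag_of y \<in> skeleton G F n" "?w y = Min (busemann \<gamma> ` h (frag_of y))"
    "valuation \<gamma> h (frag_of y) = ereal (?w y)" if "y \<in> carrier G \<times> below (Suc n)" for y
  proof -
    show "frag_of y \<in> skeleton G F n" using that by (simp add: skeleton_eq)
    show wy: "?w y = Min (busemann \<gamma> ` h (frag_of y))"
      using that sub' by (intro cell_height_eq[OF control]) auto
    show "valuation \<gamma> h (frag_of y) = ereal (?w y)" unfolding wy by (simp add: valuation_def)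
  qed
  have point: "ereal (?w y + \<delta>) \<le> valuation \<gamma> h (\<phi> (frag_of y)) \<longleftrightarrow>
      (\<forall>p\<in>h (\<phi> (frag_of y)). Min (busemann \<gamma> ` h (frag_of y)) + \<delta> \<le> busemann \<gamma> p)"
    if y: "y \<in> carrier G \<times> below (Suc n)" for y
    using valuation_ge_iff_points[OF control, of "\<phi> (frag_of y)"] bspec[OF mem gen(1)[OF y]] sub gen(2)[OF y] by auto
  have "ereal \<delta> \<le> gsh G F n h \<gamma> \<phi> \<longleftrightarrow>
      (\<forall>y\<in>carrier G \<times> below (Suc n). ereal (?w y + \<delta>) \<le> valuation \<gamma> h (\<phi> (frag_of y)))"
  proof
    assume gsh: "ereal \<delta> \<le> gsh G F n h \<gamma> \<phi>"
    show "\<forall>y\<in>carrier G \<times> below (Suc n). ereal (?w y + \<delta>) \<le> valuation \<gamma> h (\<phi> (frag_of y))"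
    proof
      fix y assume y: "y \<in> carrier G \<times> below (Suc n)"
      have "ereal \<delta> \<le> valuation \<gamma> h (\<phi> (frag_of y)) - valuation \<gamma> h (frag_of y)"
        using gsh gen(1)[OF y] unfolding gsh_def le_INF_iff by simp
      then show "ereal (?w y + \<delta>) \<le> valuation \<gamma> h (\<phi> (frag_of y))" unfolding gen(3)[OF y] diff .
    qed
  next
    assume y: "\<forall>y\<in>carrier G \<times> below (Suc n). ereal (?w y + \<delta>) \<le> valuation \<gamma> h (\<phi> (frag_of y))"
    have yh: "high ?w (?w y + \<delta>) (\<phi> (frag_of y))" if "y \<in> carrier G \<times> below (Suc n)" for y
      using y that valuation_ge_iff[OF control, of "\<phi> (frag_of y)"] bspec[OF mem gen(1)[OF that]] sub by blast
    show "ereal \<delta> \<le> gsh G F n h \<gamma> \<phi>"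
      unfolding gsh_def
    proof (rule INF_greatest)
      fix c assume c: "c \<in> skeleton G F n - {0}"
      then obtain v where v: "valuation \<gamma> h c = ereal v" using val by blast
      then have "high ?w v c" using valuation_ge_iff[OF control, of c v \<gamma>] c sub by auto
      then have "high ?w (v + \<delta>) (frag_extend (\<lambda>y. \<phi> (frag_of y)) c)"
        using c yh unfolding skeleton_eq by (intro high_frag_extend) (auto dest: free_module_keys)
      then have "high ?w (v + \<delta>) (\<phi> c)" using skeleton_additive_expansion[OF \<phi>, of c] c by simp
      then have "ereal (v + \<delta>) \<le> valuation \<gamma> h (\<phi> c)"
        using valuation_ge_iff[OF control, of "\<phi> c"] mem c sub by blast
      then show "ereal \<delta> \<le> valuation \<gamma> h (\<phi> c) - valuation \<gamma> h c" unfolding v diff .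
    qed
  qed
  then show ?thesis using point by simp
qed

text \<open>The same chain map works for all nearby ends. Nothing but the estimate of its shift has
  to be redone, and that compares Busemann values at points a bounded distance apart.\<close>

theorem oSigma_inv_open: "openin tits_topology (oSigma_inv n G F h)"
  unfolding openin_tits_topology
proof (intro conjI ballI)
  show "oSigma_inv n G F h \<subseteq> ideal_boundary" by (auto simp: oSigma_inv_def)
  fix \<xi> assume "\<xi> \<in> oSigma_inv n G F h"
  then obtain \<phi> where \<xi>: "\<xi> \<in> ideal_boundary"
    and \<phi>: "skeleton_chain_map G F n \<phi>" "\<forall>c\<in>Ch 0. aug F (\<phi> c) = aug F c"
      "finitary G (translate G) (skeleton G F n) (translate G) (skeleton G F n) \<phi>"
    and push: "\<forall>\<gamma>\<in>\<xi>. gsh G F n h \<gamma> \<phi> > 0"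
    unfolding oSigma_inv_def by blast
  obtain \<gamma> where \<gamma>: "\<gamma> \<in> \<xi>" using ideal_boundaryD(1)[OF \<xi>] by blast
  have add: "additive_on (skeleton G F n) \<phi>" using \<phi>(1) by (simp add: skeleton_chain_map_def)
  have mem: "\<forall>c\<in>skeleton G F n. \<phi> c \<in> skeleton G F n"
    using \<phi>(3) unfolding finitary_def by blast
  obtain \<delta> where \<delta>: "\<delta> > 0" "ereal \<delta> \<le> gsh G F n h \<gamma> \<phi>"
    using push \<gamma> ereal_dense2[of 0 "gsh G F n h \<gamma> \<phi>"] by (auto intro: less_imp_le)
  obtain r where r: "r > 0" and disp: "\<forall>y\<in>carrier G \<times> below (Suc n).
      \<forall>p\<in>h (\<phi> (frag_of y)). \<forall>q\<in>h (frag_of y). dist q p \<le> r"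
    using finitary_displacement[OF \<phi>(3)] by blast
  \<comment> \<open>Chosen so that over the displacement \<open>r\<close> the change of end costs at
    most half of the shift \<delta>.\<close>
  define K where "K = max 2 (6 * r / \<delta>)"
  have K: "K \<ge> 2" "3 / K * r \<le> \<delta> / 2"
  proof -
    show "K \<ge> 2" by (simp add: K_def)
    then have "6 * r \<le> \<delta> * K" using \<delta>(1) by (simp add: K_def max_def field_simps split: if_splits)
    then show "3 / K * r \<le> \<delta> / 2" using \<open>K \<ge> 2\<close> by (simp add: field_simps)
  qed
  show "\<exists>\<epsilon>>0. \<forall>\<eta>\<in>ideal_boundary. tits_metric \<xi> \<eta> < ereal \<epsilon> \<longrightarrow> \<eta> \<in> oSigma_inv n G F h"
  proof (intro exI[of _ "1 / K\<^sup>2"] conjI ballI impI)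
    show "0 < 1 / K\<^sup>2" using K by simp
    fix \<eta> assume \<eta>: "\<eta> \<in> ideal_boundary" "tits_metric \<xi> \<eta> < ereal (1 / K\<^sup>2)"
    have angle: "angular_metric \<xi> \<eta> < ereal (1 / K\<^sup>2)"
      using angular_metric_le_tits_metric \<eta>(2) by (rule le_less_trans)
    have "gsh G F n h \<gamma>' \<phi> > 0" if \<gamma>': "\<gamma>' \<in> \<eta>" for \<gamma>'
    proof -
      have "ereal (\<delta> / 2) \<le> gsh G F n h \<gamma>' \<phi>"
        unfolding gsh_ge_iff[OF add mem]
      proof (intro ballI)
        fix y p assume y: "y \<in> carrier G \<times> below (Suc n)" and p: "p \<in> h (\<phi> (frag_of y))"
        have y': "y \<in> carrier G \<times> (\<Union>k. gens F k)" using y by (auto simp: below_def)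
        have fin: "finite (h (frag_of y))" "h (frag_of y) \<noteq> {}"
          using cell_height_eq[OF control y'] by blast+
        have "Min (busemann \<gamma> ` h (frag_of y)) \<in> busemann \<gamma> ` h (frag_of y)"
          using fin by (intro Min_in) auto
        then obtain q where q: "q \<in> h (frag_of y)" "Min (busemann \<gamma> ` h (frag_of y)) = busemann \<gamma> q" by auto
        have "busemann \<gamma> q + \<delta> \<le> busemann \<gamma> p"
          using bspec[OF bspec[OF \<delta>(2)[unfolded gsh_ge_iff[OF add mem]] y] p] unfolding q(2) .
        moreover have "\<bar>(busemann \<gamma> p - busemann \<gamma>' p) - (busemann \<gamma> q - busemann \<gamma>' q)\<bar> \<le> 3 / K * dist q p"
          using busemann_diff_le_angle[OF \<xi> \<gamma> \<eta>(1) \<gamma>' K(1) angle] .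
        moreover have "dist q p \<le> r" using disp y p q(1) by blast
        then have "3 / K * dist q p \<le> 3 / K * r" using K(1) by (intro mult_left_mono) auto
        ultimately have "busemann \<gamma>' q + \<delta> / 2 \<le> busemann \<gamma>' p" using K(2) by linarith
        moreover have "Min (busemann \<gamma>' ` h (frag_of y)) \<le> busemann \<gamma>' q" using fin q(1) by simp
        ultimately show "Min (busemann \<gamma>' ` h (frag_of y)) + \<delta> / 2 \<le> busemann \<gamma>' p" by linarith
      qed
      moreover have "0 < ereal (\<delta> / 2)" using \<delta>(1) by simp
      ultimately show ?thesis by (rule less_le_trans[rotated])
    qed
    then show "\<eta> \<in> oSigma_inv n G F h" unfolding oSigma_inv_def using \<eta>(1) \<phi> by blast
  qed
qed

end

theorem theorem1p3:
  fixes n :: nat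
    and G :: "('g, 'b) monoid_scheme"
    and act :: "'g \<Rightarrow> 'a::ab_group_add \<Rightarrow> 'a"
    and F :: "('g, 'x, 'a) resolution"
    and \<rho> :: "'g \<Rightarrow> 'm::metric_space \<Rightarrow> 'm"
    and h :: "('g, 'x) chain \<Rightarrow> 'm set"
  assumes "group G"
    and "CAT0_space TYPE('m)"
    and "\<forall>(x::'m) r. compact (cball x r)"
    and "\<not> compact (UNIV :: 'm set)"
    and "ZG_module G act"
    and "based_free_resolution G act F"
    and "finitely_generated G (translate G) (skeleton G F n)"
    and "\<rho> \<in> hom G Isom_group"
    and "control_map G F \<rho> h"
  shows "(Sigma_inv n G F h = ideal_boundary \<longrightarrow>
            (\<exists>N. openin (Hom_topology G) N \<and> \<rho> \<in> N \<and>
               (\<forall>\<rho>'\<in>N. \<forall>h'. control_map G F \<rho>' h' \<longrightarrow> Sigma_inv n G F h' = ideal_boundary))) \<and>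
         openin tits_topology (oSigma_inv n G F h)"
proof -
  interpret group G by (rule assms(1))
  interpret controlled_action G act F "TYPE('m)" n \<rho> h
    by unfold_locales (use assms in auto)
  show ?thesis using Sigma_inv_stable oSigma_inv_open by blast
qed

end
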